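(* Let $A$ be a sectorial operator on a separable Hilbert space $H$ with $0\in\varrho(A)$, let $r,s\ge0$ with $r+s<1$, $B\in L(U,H_{-r})$, $C\in L(H_s^{( * )},Y)$ with Hilbert spaces $U,Y$, and suppose that the Hamiltonian $T_0$ satisfies $i\mathbb{R}\subset\varrho(T_0)$. Let $V_{0\pm}$ be the spectral subspaces of $T_0$ for $\mathbb{C}_\pm$. Then \[V_{0-}=\mathcal{R}\begin{pmatrix}I\\ X_{0-}\end{pmatrix},\qquad V_{0+}=\mathcal{R}\begin{pmatrix}Y_{0+}\\ I\end{pmatrix}\] with closed operators $X_{0-}:\mathcal{D}(X_{0-})\subset H_{-r}\to H^{( * )}_{-s}$ and $Y_{0+}:\mathcal{D}(Y_{0+})\subset H^{( * )}_{-s}\to H_{-r}$.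
   Context: Notation: $\mathcal{D},\mathcal{R},\varrho,\sigma$ denote domain, range, resolvent set, spectrum; $L(V,W)$ is the space of bounded operators; $\mathbb{C}_\pm$ are the open right/left half-planes. Sectorial operators: for $\theta\ge0$ put $\Sigma_{\frac\pi2+\theta}=\{\lambda\in\mathbb{C}\setminus\{0\}:\arg\lambda\in[-\frac\pi2-\theta,\frac\pi2+\theta]\}$. An operator $S$ on a Banach space is sectorial if for some $\theta\ge0$, $M>0$ one has $\Sigma_{\frac\pi2+\theta}\subset\varrho(S)$ and $\|(S-\lambda)^{-1}\|\le M/|\lambda|$ on $\Sigma_{\frac\pi2+\theta}$. (Sectorial operators on Hilbert spaces are closed and densely defined.) Scales: let $A$ be closed and densely defined on the separable Hilbert space $H$ (inner product $(\cdot|\cdot)$, norm $\|\cdot\|$). Put $\Lambda=(I+AA^* )^{1/2}$, $\Lambda_*=(I+A^*A)^{1/2}$. For $\tau>0$: $H_\tau=\mathcal{D}(\Lambda^\tau)$ with norm $\|\Lambda^\tau x\|$, $H_{-\tau}$ is the completion of $H$ in the norm $\|\Lambda^{-\tau}x\|$; $H_0=H$. $H_{\pm\tau}^{( * )}$ are defined likewise with $\Lambda_*$. The inner product extends by continuity to bounded sesquilinear forms $(\cdot|\cdot)_{\tau,-\tau}$ on $H_\tau\times H_{-\tau}$ and $(\cdot|\cdot)^{( * )}_{\tau,-\tau}$ on $H^{( * )}_\tau\times H^{( * )}_{-\tau}$. For each $\tau\in[0,1]$, $A$ and $A^*$ act (by extension/restriction by continuity) as bounded operators $A:H^{( * )}_{1-\tau}\to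 H_{-\tau}$, $A^*:H_{1-\tau}\to H^{( * )}_{-\tau}$, and $A-\lambda$, $A^*-\bar\lambda$ are isomorphisms between these spaces for $\lambda\in\varrho(A)$. $\varrho(A)$ refers to $A$ as operator on $H$. Hamiltonian: adjoints $B^*\in L(H_r,U)$, $C^*\in L(Y,H^{( * )}_{-s})$ are defined by $(x|Bu)_{r,-r}=(B^*x|u)_U$ and $(Cx|y)_Y=(x|C^*y)^{( * )}_{s,-s}$. The Hamiltonian is $T_0=\begin{pmatrix}A&-BB^*\\ -C^*C&-A^*\end{pmatrix}$, an unbounded operator on $V_0=H_{-r}\times H^{( * )}_{-s}$ with domain $\mathcal{D}(T_0)=H^{( * )}_{1-r}\times H_{1-s}$ (note $H^{( * )}_{1-r}\subset H^{( * )}_s$ and $H_{1-s}\subset H_r$). Spectral subspaces: under these assumptions $T_0$ is strictly dichotomous, i.e. there are (uniquely determined) closed $T_0$-invariant subspaces $V_{0\pm}$ with $V_0=V_{0+}\oplus V_{0-}$, $\sigma(T_0|_{V_{0\pm}})\subset\mathbb{C}_\pm$ and $\|(T_0|_{V_{0\pm}}-\lambda)^{-1}\|$ bounded on $\mathbb{C}_\mp$. Explicitly $V_{0\pm}=\ker L_{0\mp}$ with $L_{0\pm}=\frac{\pm1}{2\pi i}\int_{\pm h-i\infty}^{\pm h+i\infty}\frac1\lambda(T_0-\lambda)^{-1}\,d\lambda$, where $h>0$ is such that $\{|\operatorname{Re}\lambda|\le h\}\subset\varrho(T_0)$. Graphs: $\mathcal{R}\begin{pmatrix}I\\ X\end{pmatrix}=\{(x,Xx):x\in\mathcal{D}(X)\}$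 and $\mathcal{R}\begin{pmatrix}Y\\ I\end{pmatrix}=\{(Yy,y):y\in\mathcal{D}(Y)\}$. *)

theory Defs
  imports "HOL-Analysis.Analysis"
begin

section \<open>Complex Banach and Hilbert spaces\<close>

class scaleC =
  fixes scaleC :: "complex \<Rightarrow> 'a \<Rightarrow> 'a"  (infixr "*\<^sub>C" 75)

class complex_banach = banach + scaleC +
  assumes scaleC_add_right: "a *\<^sub>C (x + y) = a *\<^sub>C x + a *\<^sub>C y"
    and scaleC_add_left: "(a + b) *\<^sub>C x = a *\<^sub>C x + b *\<^sub>C x"
    and scaleC_scaleC: "a *\<^sub>C (b *\<^sub>C x) = (a * b) *\<^sub>C x"
    and scaleC_of_real: "complex_of_real t *\<^sub>C x = t *\<^sub>R x"
    and norm_scaleC: "norm (a *\<^sub>C x) = cmod a * norm x"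

text \<open>The inner product is linear in the first and conjugate linear in the second argument.\<close>

class complex_hilbert = complex_banach +
  fixes cinner :: "'a \<Rightarrow> 'a \<Rightarrow> complex"
  assumes cinner_commute: "cinner x y = cnj (cinner y x)"
    and cinner_add_left: "cinner (x + y) z = cinner x z + cinner y z"
    and cinner_scaleC_left: "cinner (a *\<^sub>C x) y = a * cinner x y"
    and cinner_self: "cinner x x = complex_of_real ((norm x)\<^sup>2)"

global_interpretation complex_vector: vector_space "scaleC :: complex \<Rightarrow> 'a \<Rightarrow> 'a::complex_banach"
proof
  show "1 *\<^sub>C x = x" for x :: 'a
    using scaleC_of_real[of 1 x] by simp
qed (simp_all add: scaleC_add_right scaleC_add_left scaleC_scaleC)

instantiation complex :: complex_hilbert
begin
definition scaleC_complex :: "complex \<Rightarrow> complex \<Rightarrow> complex"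
  where "scaleC_complex a x = a * x"
definition cinner_complex :: "complex \<Rightarrow> complex \<Rightarrow> complex"
  where "cinner_complex x y = x * cnj y"
instance
  by standard
    (simp_all add: scaleC_complex_def cinner_complex_def algebra_simps norm_mult
      scaleR_conv_of_real complex_norm_square del: of_real_power)
end

text \<open>The norm on a product is the Hilbertian one of \<^theory>\<open>HOL-Analysis.Product_Vector\<close>.\<close>

instantiation prod :: (complex_banach, complex_banach) complex_banach
begin
definition scaleC_prod :: "complex \<Rightarrow> 'a \<times> 'b \<Rightarrow> 'a \<times> 'b"
  where "scaleC_prod a p = (a *\<^sub>C fst p, a *\<^sub>C snd p)"
instance
proof
  fix a b :: complex and t :: real and x y :: "'a \<times> 'b"
  show "norm (a *\<^sub>C x) = cmod a * norm x"
    by (simp add: scaleC_prod_def norm_prod_def norm_scaleC power_mult_distrib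
        real_sqrt_mult flip: distrib_left)
qed (simp_all add: scaleC_prod_def scaleC_add_right scaleC_add_left scaleC_scaleC
      scaleC_of_real prod_eq_iff)
end

definition bounded_clinear :: "('a::complex_banach \<Rightarrow> 'b::complex_banach) \<Rightarrow> bool"
  where "bounded_clinear f \<longleftrightarrow> bounded_linear f \<and> (\<forall>a x. f (a *\<^sub>C x) = a *\<^sub>C f x)"


section \<open>Unbounded operators\<close>

text \<open>An operator is a domain together with a function whose values outside the domain are
  irrelevant.  Linearity is the separate predicate \<open>linear_op\<close>.\<close>

datatype ('a, 'b) unbounded_op = Op (opdom: "'a set") (app: "'a \<Rightarrow> 'b")

definition linear_op :: "('a::complex_banach, 'b::complex_banach) unbounded_op \<Rightarrow> bool"
  where "linear_op T \<longleftrightarrow> complex_vector.subspace (opdom T) \<and>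
    (\<forall>x\<in>opdom T. \<forall>y\<in>opdom T. app T (x + y) = app T x + app T y) \<and>
    (\<forall>a. \<forall>x\<in>opdom T. app T (a *\<^sub>C x) = a *\<^sub>C app T x)"

definition closed_op :: "('a::complex_banach, 'b::complex_banach) unbounded_op \<Rightarrow> bool"
  where "closed_op T \<longleftrightarrow> linear_op T \<and> closed {(x, app T x) | x. x \<in> opdom T}"

definition op_comp :: "('b, 'c) unbounded_op \<Rightarrow> ('a, 'b) unbounded_op \<Rightarrow> ('a, 'c) unbounded_op"
  where "op_comp S T = Op {x \<in> opdom T. app T x \<in> opdom S} (\<lambda>x. app S (app T x))"

definition id_plus :: "('a::plus, 'a) unbounded_op \<Rightarrow> ('a, 'a) unbounded_op"
  where "id_plus T = Op (opdom T) (\<lambda>x. x + app T x)"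

definition op_restrict :: "('a, 'b) unbounded_op \<Rightarrow> 'a set \<Rightarrow> ('a, 'b) unbounded_op"
  where "op_restrict T V = Op (opdom T \<inter> V) (app T)"

definition hilbert_adjoint ::
    "('a::complex_hilbert, 'b::complex_hilbert) unbounded_op \<Rightarrow> ('b, 'a) unbounded_op"
  where "hilbert_adjoint T =
    Op {y. \<exists>z. \<forall>x\<in>opdom T. cinner (app T x) y = cinner x z}
       (\<lambda>y. THE z. \<forall>x\<in>opdom T. cinner (app T x) y = cinner x z)"

text \<open>\<open>resolvent T \<mu> = (T - \<mu>)\<inverse>\<close>.\<close>

definition resolvent ::
    "('a::complex_banach, 'a) unbounded_op \<Rightarrow> complex \<Rightarrow> 'a \<Rightarrow> 'a"
  where "resolvent T \<mu> = inv_into (opdom T) (\<lambda>x. app T x - \<mu> *\<^sub>C x)"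

text \<open>\<open>resolvent_set_on V T\<close> is the resolvent set of an operator \<open>T\<close> on the Banach space \<open>V\<close>,
  where \<open>V\<close> is a closed subspace of the ambient type.\<close>

definition resolvent_set_on ::
    "'a::complex_banach set \<Rightarrow> ('a, 'a) unbounded_op \<Rightarrow> complex set"
  where "resolvent_set_on V T =
    {\<mu>. bij_betw (\<lambda>x. app T x - \<mu> *\<^sub>C x) (opdom T) V \<and>
        (\<exists>c. \<forall>y\<in>V. norm (resolvent T \<mu> y) \<le> c * norm y)}"

abbreviation resolvent_set :: "('a::complex_banach, 'a) unbounded_op \<Rightarrow> complex set"
  where "resolvent_set \<equiv> resolvent_set_on UNIV"

definition spectrum_on ::
    "'a::complex_banach set \<Rightarrow> ('a, 'a) unbounded_op \<Rightarrow> complex set"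
  where "spectrum_on V T = - resolvent_set_on V T"


section \<open>Sectorial operators\<close>

definition sector :: "real \<Rightarrow> complex set"
  where "sector \<phi> = {\<mu>. \<mu> \<noteq> 0 \<and> Arg \<mu> \<in> {- \<phi>..\<phi>}}"

definition sectorial :: "('a::complex_banach, 'a) unbounded_op \<Rightarrow> bool"
  where "sectorial S \<longleftrightarrow> linear_op S \<and>
    (\<exists>\<theta>\<ge>0. \<exists>M>0. sector (pi / 2 + \<theta>) \<subseteq> resolvent_set S \<and>
      (\<forall>\<mu>\<in>sector (pi / 2 + \<theta>). \<forall>y. norm (resolvent S \<mu> y) \<le> M / cmod \<mu> * norm y))"


section \<open>Fractional powers\<close>

text \<open>For a positive self-adjoint \<open>T\<close> with \<open>0\<close> in its resolvent set and \<open>\<alpha> \<ge> 0\<close>, write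
  \<open>\<alpha> = n + \<beta>\<close> with a natural number \<open>n\<close> and \<open>0 \<le> \<beta> < 1\<close>.  Then \<open>T\<close> to the power \<open>-\<alpha>\<close> is the
  \<open>n\<close>-fold iterate of the inverse of \<open>T\<close>, applied after the power \<open>-\<beta>\<close> given by Balakrishnan's
  formula \<open>sin (\<pi>\<beta>) / \<pi> \<integral> t powr (-\<beta>) (t + T)\<inverse> dt\<close> over \<open>(0, \<infinity>)\<close>.\<close>

definition balakrishnan ::
    "('a::{complex_hilbert, second_countable_topology}, 'a) unbounded_op \<Rightarrow> real \<Rightarrow> 'a \<Rightarrow> 'a"
  where "balakrishnan T \<beta> x =
    (if \<beta> = 0 then x
     else (sin (pi * \<beta>) / pi) *\<^sub>R
       (LINT t:{0<..}|lborel. (t powr - \<beta>) *\<^sub>R resolvent T (- complex_of_real t) x))"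

definition neg_power ::
    "('a::{complex_hilbert, second_countable_topology}, 'a) unbounded_op \<Rightarrow> real \<Rightarrow> 'a \<Rightarrow> 'a"
  where "neg_power T \<alpha> = (resolvent T 0 ^^ nat \<lfloor>\<alpha>\<rfloor>) \<circ> balakrishnan T (frac \<alpha>)"

text \<open>The power with a positive exponent is the inverse of the one with the negative exponent.\<close>

definition op_power ::
    "('a::{complex_hilbert, second_countable_topology}, 'a) unbounded_op \<Rightarrow> real
      \<Rightarrow> ('a, 'a) unbounded_op"
  where "op_power T \<alpha> =
    (if \<alpha> \<le> 0 then Op UNIV (neg_power T (- \<alpha>))
     else Op (range (neg_power T \<alpha>)) (inv (neg_power T \<alpha>)))"


section \<open>The scales of a closed densely defined operator\<close>

text \<open>\<open>Lam A\<close> and \<open>Lam_star A\<close> are the square roots of \<open>I + A A*\<close> and \<open>I + A* A\<close>.\<close>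

definition Lam ::
    "('h::{complex_hilbert, second_countable_topology}, 'h) unbounded_op \<Rightarrow> ('h, 'h) unbounded_op"
  where "Lam A = op_power (id_plus (op_comp A (hilbert_adjoint A))) (1 / 2)"

definition Lam_star ::
    "('h::{complex_hilbert, second_countable_topology}, 'h) unbounded_op \<Rightarrow> ('h, 'h) unbounded_op"
  where "Lam_star A = op_power (id_plus (op_comp (hilbert_adjoint A) A)) (1 / 2)"

text \<open>In the following, \<open>L\<close> is \<open>Lam A\<close> or \<open>Lam_star A\<close>.  The space \<open>H\<^sub>\<tau>\<close> of the corresponding
  scale is the set \<open>scale_space L \<tau>\<close> with norm \<open>scale_norm L \<tau>\<close>.\<close>

definition scale_space ::
    "('h::{complex_hilbert, second_countable_topology}, 'h) unbounded_op \<Rightarrow> real \<Rightarrow> 'h set"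
  where "scale_space L \<tau> = opdom (op_power L \<tau>)"

definition scale_norm ::
    "('h::{complex_hilbert, second_countable_topology}, 'h) unbounded_op \<Rightarrow> real \<Rightarrow> 'h \<Rightarrow> real"
  where "scale_norm L \<tau> x = norm (app (op_power L \<tau>) x)"

text \<open>A completion is determined only up to isometric isomorphism.  The predicate says that the
  type \<open>'v\<close> together with the embedding \<open>\<iota>\<close> is a completion of \<open>H\<close> in the norm
  \<open>scale_norm L (-\<tau>)\<close>; completeness of \<open>'v\<close> is part of its type class.\<close>

definition is_neg_scale_space ::
    "('h::{complex_hilbert, second_countable_topology}, 'h) unbounded_op \<Rightarrow> real
      \<Rightarrow> ('h \<Rightarrow> 'v::complex_banach) \<Rightarrow> bool"
  where "is_neg_scale_space L \<tau> \<iota> \<longleftrightarrow>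
    (\<forall>x y. \<iota> (x + y) = \<iota> x + \<iota> y) \<and> (\<forall>a x. \<iota> (a *\<^sub>C x) = a *\<^sub>C \<iota> x) \<and>
    (\<forall>x. norm (\<iota> x) = scale_norm L (- \<tau>) x) \<and>
    closure (range \<iota>) = UNIV"

text \<open>Extension by continuity of the inner product to \<open>H\<^sub>\<tau> \<times> H\<^sub>-\<^sub>\<tau>\<close>: the limit of \<open>(x | z)\<close> as
  \<open>z \<in> H\<close> tends to \<open>\<phi>\<close> in the space \<open>H\<^sub>-\<^sub>\<tau>\<close> with embedding \<open>\<iota>\<close>.\<close>

definition pairing ::
    "('h::complex_hilbert \<Rightarrow> 'v::complex_banach) \<Rightarrow> 'h \<Rightarrow> 'v \<Rightarrow> complex"
  where "pairing \<iota> x \<phi> = Lim (filtercomap \<iota> (nhds \<phi>)) (\<lambda>z. cinner x z)"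

text \<open>Extension by continuity of \<open>S\<close> to an operator from \<open>scale_space L \<tau>\<close> to the completion with
  embedding \<open>\<iota>\<close>: the limit of \<open>S z\<close> as \<open>z \<in> D(S)\<close> tends to \<open>x\<close> in \<open>scale_norm L \<tau>\<close>.\<close>

definition scale_ext ::
    "('h::{complex_hilbert, second_countable_topology}, 'h) unbounded_op \<Rightarrow> real
      \<Rightarrow> ('h \<Rightarrow> 'v::complex_banach) \<Rightarrow> ('h, 'h) unbounded_op \<Rightarrow> 'h \<Rightarrow> 'v"
  where "scale_ext L \<tau> \<iota> S x =
    Lim (inf (principal (opdom S)) (filtercomap (\<lambda>z. scale_norm L \<tau> (z - x)) (nhds 0)))
        (\<lambda>z. \<iota> (app S z))"

text \<open>\<open>C \<in> L(H\<^sub>\<tau>, Y)\<close> for a space \<open>H\<^sub>\<tau>\<close> of the scale with \<open>\<tau> \<ge> 0\<close>.\<close>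

definition bounded_on_scale ::
    "('h::{complex_hilbert, second_countable_topology}, 'h) unbounded_op \<Rightarrow> real
      \<Rightarrow> ('h, 'y::complex_hilbert) unbounded_op \<Rightarrow> bool"
  where "bounded_on_scale L \<tau> C \<longleftrightarrow> linear_op C \<and> opdom C = scale_space L \<tau> \<and>
    (\<exists>K. \<forall>x\<in>opdom C. norm (app C x) \<le> K * scale_norm L \<tau> x)"


section \<open>The Hamiltonian\<close>

text \<open>\<open>\<iota>r\<close> and \<open>\<iota>s\<close> are the embeddings of \<open>H\<close> into \<open>H\<^sub>-\<^sub>r\<close> and into the space with index \<open>-s\<close> of the
  scale of \<open>Lam_star A\<close>.\<close>

definition B_adj ::
    "('h::complex_hilbert \<Rightarrow> 'v::complex_banach) \<Rightarrow> ('u::complex_hilbert \<Rightarrow> 'v) \<Rightarrow> 'h \<Rightarrow> 'u"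
  where "B_adj \<iota>r B x = (THE w. \<forall>u. pairing \<iota>r x (B u) = cinner w u)"

definition C_adj ::
    "('h::complex_hilbert \<Rightarrow> 'w::complex_banach) \<Rightarrow> ('h, 'y::complex_hilbert) unbounded_op
      \<Rightarrow> 'y \<Rightarrow> 'w"
  where "C_adj \<iota>s C y = (THE \<phi>. \<forall>x\<in>opdom C. cinner (app C x) y = pairing \<iota>s x \<phi>)"

text \<open>The domain consists of elements of \<open>H \<times> H\<close>, viewed in \<open>V\<^sub>0\<close> through the embeddings.  The
  continuous extension of \<open>A\<close> lives on the scale of \<open>Lam_star A\<close>, that of \<open>A*\<close> on the scale of
  \<open>Lam A\<close>.\<close>

definition hamiltonian ::
    "('h::{complex_hilbert, second_countable_topology}, 'h) unbounded_op \<Rightarrow> real \<Rightarrow> real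
      \<Rightarrow> ('h \<Rightarrow> 'v::complex_banach) \<Rightarrow> ('h \<Rightarrow> 'w::complex_banach)
      \<Rightarrow> ('u::complex_hilbert \<Rightarrow> 'v) \<Rightarrow> ('h, 'y::complex_hilbert) unbounded_op
      \<Rightarrow> ('v \<times> 'w, 'v \<times> 'w) unbounded_op"
  where "hamiltonian A r s \<iota>r \<iota>s B C =
    Op (\<iota>r ` scale_space (Lam_star A) (1 - r) \<times> \<iota>s ` scale_space (Lam A) (1 - s))
       (\<lambda>(v, w). let x = inv \<iota>r v; y = inv \<iota>s w in
          (scale_ext (Lam_star A) (1 - r) \<iota>r A x - B (B_adj \<iota>r B y),
           - C_adj \<iota>s C (app C x) - scale_ext (Lam A) (1 - s) \<iota>s (hilbert_adjoint A) y))"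


section \<open>Strict dichotomy\<close>

text \<open>\<open>Vp\<close> and \<open>Vm\<close> are the spectral subspaces of the strictly dichotomous operator \<open>T\<close> for the
  open right and left half-planes.\<close>

definition spectral_subspaces ::
    "('a::complex_banach, 'a) unbounded_op \<Rightarrow> 'a set \<Rightarrow> 'a set \<Rightarrow> bool"
  where "spectral_subspaces T Vp Vm \<longleftrightarrow>
    complex_vector.subspace Vp \<and> closed Vp \<and> complex_vector.subspace Vm \<and> closed Vm \<and>
    app T ` (opdom T \<inter> Vp) \<subseteq> Vp \<and> app T ` (opdom T \<inter> Vm) \<subseteq> Vm \<and>
    Vp \<inter> Vm = {0} \<and> (\<forall>v. \<exists>a\<in>Vp. \<exists>b\<in>Vm. v = a + b) \<and>
    spectrum_on Vp (op_restrict T Vp) \<subseteq> {\<mu>. Re \<mu> > 0} \<and>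
    spectrum_on Vm (op_restrict T Vm) \<subseteq> {\<mu>. Re \<mu> < 0} \<and>
    (\<exists>M. \<forall>\<mu>. Re \<mu> < 0 \<longrightarrow>
      (\<forall>y\<in>Vp. norm (resolvent (op_restrict T Vp) \<mu> y) \<le> M * norm y)) \<and>
    (\<exists>M. \<forall>\<mu>. Re \<mu> > 0 \<longrightarrow>
      (\<forall>y\<in>Vm. norm (resolvent (op_restrict T Vm) \<mu> y) \<le> M * norm y))"

end

theory Submission
  imports Defs "HOL-Complex_Analysis.Complex_Analysis"
begin

text \<open>
  If \<open>(0, w)\<close> lies in \<open>V0m\<close>, then the resolvent \<open>(x, y)(\<mu>)\<close> of the Hamiltonian at \<open>(0, w)\<close> is
  holomorphic on the closed right half-plane and grows at most linearly there in the graph norm.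
  On the imaginary axis, pairing the first row with \<open>y\<close> and the second one with \<open>x\<close> gives
  \<open>(x | w) = - |B* y|\<^sup>2 - |C x|\<^sup>2\<close>.  As this is real, \<open>(x | w)\<close> extends by reflection to an entire function, which
  is affine by Liouville's theorem.  Since \<open>r + s < 1\<close>, the resolvent of \<open>A\<close> decays like a negative power
  of \<open>\<mu>\<close> from \<open>H\<close> with index \<open>-r\<close> to \<open>H\<close> with index \<open>s\<close>; hence the affine function vanishes, and \<open>B* y = 0\<close>,
  \<open>x = 0\<close> on the axis.  Thus \<open>y\<close> is the resolvent of \<open>-A*\<close> at \<open>w\<close> there, which is bounded and holomorphic on
  the left half-plane, and a second application of Liouville's theorem gives \<open>w = 0\<close>.
  Exchanging \<open>A\<close> with its adjoint reverses the sign of the Hamiltonian and gives the statement on \<open>V0p\<close>.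

  All operators are expressed through the bounded inverse of \<open>A\<close>, and the powers of the inverse of \<open>\<Lambda>\<close>
  are binomial series; Balakrishnan's integral is integrated term by term to identify the two.
\<close>

section \<open>Complex Hilbert spaces\<close>

text \<open>The dichotomy bounds the resolvent in the norm of V0 only, whereas
  \<open>(x | w)\<close> needs \<open>x\<close> in the space of index \<open>s\<close>. Writing the
  resolvent as \<open>T\<inverse> (u + \<mu> (T - \<mu>)\<inverse> u)\<close> repairs this at the
  cost of one factor \<mu>, hence the linear growth. The affine function is excluded by a
  self-improving estimate on the axis: there \<open>(A - \<mu>) x = B B* y\<close>, so
  \<open>(x | w)\<close> is at most a decaying power of \<mu> times the norm of
  \<open>B B* y\<close>, and the square of that norm is itself at most a multiple of
  \<open>|B* y|\<close> squared, hence of \<open>(x | w)\<close>. No decay of \<open>y\<close>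
  enters. Every space of either scale is identified with \<open>H\<close> by a power of \<Lambda> or
  of its counterpart for \<open>A* A\<close>: \<open>x = dual.Q (1 - r) z\<close> and
  \<open>y = Q (1 - s) e\<close>, while vectors of negative order are represented by their images
  under extensions of \<open>Q r\<close> or \<open>dual.Q s\<close>. Both rows then consist of
  bounded operators on \<open>H\<close>, and \<open>r + s < 1\<close> appears as the positive
  exponent \<open>1 - r - s\<close> with which \<open>z\<close> and \<open>e\<close> enter the terms
  of \<open>B\<close> and \<open>C\<close>.\<close>

lemma scaleR_scaleC: "t *\<^sub>R x = complex_of_real t *\<^sub>C (x::'a::complex_banach)"
  by (simp add: scaleC_of_real)

lemma bounded_linear_scaleC: "bounded_linear (\<lambda>x::'a::complex_banach. a *\<^sub>C x)"
  by (rule bounded_linear_intro[where K="cmod a"])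
    (simp_all add: scaleC_add_right norm_scaleC scaleR_scaleC scaleC_scaleC mult.commute)

lemma bounded_clinearI:
  assumes "\<And>x y. f (x + y) = f x + f y" "\<And>a x. f (a *\<^sub>C x) = a *\<^sub>C f x"
    "\<And>x. norm (f x) \<le> K * norm x"
  shows "bounded_clinear f"
  unfolding bounded_clinear_def
  by (auto intro!: bounded_linear_intro[where K=K] simp: assms scaleR_scaleC mult.commute)

lemma bounded_clinear_imp_bounded_linear: "bounded_clinear f \<Longrightarrow> bounded_linear f"
  by (simp add: bounded_clinear_def)

lemma bounded_clinear_scaleC: "bounded_clinear f \<Longrightarrow> f (a *\<^sub>C x) = a *\<^sub>C f x"
  by (simp add: bounded_clinear_def)

lemma bounded_clinear_add: "bounded_clinear f \<Longrightarrow> f (x + y) = f x + f y"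
  by (simp add: bounded_clinear_def linear_simps)

lemma bounded_clinear_diff: "bounded_clinear f \<Longrightarrow> f (x - y) = f x - f y"
  by (simp add: bounded_clinear_def linear_simps)

lemma bounded_clinear_minus: "bounded_clinear f \<Longrightarrow> f (- x) = - f x"
  by (simp add: bounded_clinear_def linear_simps)

lemma bounded_clinear_zero: "bounded_clinear f \<Longrightarrow> f 0 = 0"
  by (simp add: bounded_clinear_def linear_simps)

lemma bounded_clinear_scaleR: "bounded_clinear f \<Longrightarrow> f (t *\<^sub>R x) = t *\<^sub>R f x"
  by (simp add: bounded_clinear_def linear_simps)

lemmas bounded_clinear_simps = bounded_clinear_add bounded_clinear_diff bounded_clinear_minus
  bounded_clinear_zero bounded_clinear_scaleC bounded_clinear_scaleR

lemma bounded_clinear_bound: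
  assumes "bounded_clinear f"
  obtains K where "K > 0" "\<And>x. norm (f x) \<le> K * norm x"
  using bounded_linear.pos_bounded[OF bounded_clinear_imp_bounded_linear[OF assms]]
  by (auto simp: mult.commute)

lemma bounded_clinear_ident: "bounded_clinear (\<lambda>x. x)"
  by (simp add: bounded_clinear_def bounded_linear_ident)

lemma bounded_clinear_const_scaleC: "bounded_clinear (\<lambda>x::'a::complex_banach. a *\<^sub>C x)"
  by (simp add: bounded_clinear_def bounded_linear_scaleC scaleC_scaleC mult.commute)

lemma bounded_clinear_compose:
  "bounded_clinear f \<Longrightarrow> bounded_clinear g \<Longrightarrow> bounded_clinear (\<lambda>x. f (g x))"
  by (simp add: bounded_clinear_def bounded_linear_compose)

lemma bounded_clinear_plus:
  "bounded_clinear f \<Longrightarrow> bounded_clinear g \<Longrightarrow> bounded_clinear (\<lambda>x. f x + g x)"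
  by (simp add: bounded_clinear_def bounded_linear_add scaleC_add_right)

lemma bounded_clinear_uminus: "bounded_clinear f \<Longrightarrow> bounded_clinear (\<lambda>x. - f x)"
  using bounded_clinear_compose[OF bounded_clinear_const_scaleC[of "-1"]]
  by simp

lemma bounded_clinear_sub:
  "bounded_clinear f \<Longrightarrow> bounded_clinear g \<Longrightarrow> bounded_clinear (\<lambda>x. f x - g x)"
  using bounded_clinear_plus[of f "\<lambda>x. - g x"] bounded_clinear_uminus[of g] by simp

lemma bounded_clinear_scaleC_compose:
  "bounded_clinear f \<Longrightarrow> bounded_clinear (\<lambda>x. a *\<^sub>C f x)"
  using bounded_clinear_compose[OF bounded_clinear_const_scaleC] .

lemma bounded_clinear_injI:
  assumes "bounded_clinear f" "\<And>x. f x = 0 \<Longrightarrow> x = 0"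
  shows "inj f"
  by (rule injI) (metis assms bounded_clinear_diff eq_iff_diff_eq_0)

lemma bounded_clinear_tendsto:
  "bounded_clinear f \<Longrightarrow> (g \<longlongrightarrow> x) F \<Longrightarrow> ((\<lambda>n. f (g n)) \<longlongrightarrow> f x) F"
  by (rule bounded_linear.tendsto[OF bounded_clinear_imp_bounded_linear])

lemma bounded_clinear_continuous_on: "bounded_clinear f \<Longrightarrow> continuous_on X f"
  using bounded_clinear_imp_bounded_linear linear_continuous_on by blast

lemma cinner_add_right: "cinner x (y + z) = cinner x y + cinner x (z::'a::complex_hilbert)"
  by (metis cinner_add_left cinner_commute complex_cnj_add)

lemma cinner_scaleC_right: "cinner x (a *\<^sub>C y) = cnj a * cinner x (y::'a::complex_hilbert)"
  by (metis cinner_scaleC_left cinner_commute complex_cnj_mult)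

lemma cinner_scaleR_left: "cinner (t *\<^sub>R x) y = t *\<^sub>R cinner x (y::'a::complex_hilbert)"
  by (simp add: scaleR_scaleC cinner_scaleC_left scaleC_complex_def)

lemma cinner_scaleR_right: "cinner x (t *\<^sub>R y) = t *\<^sub>R cinner x (y::'a::complex_hilbert)"
  by (simp add: scaleR_scaleC cinner_scaleC_right scaleC_complex_def)

lemma cinner_minus_left: "cinner (- x) y = - cinner x (y::'a::complex_hilbert)"
  using cinner_scaleC_left[of "-1" x y] by simp

lemma cinner_minus_right: "cinner x (- y) = - cinner x (y::'a::complex_hilbert)"
  using cinner_scaleC_right[of x "-1" y] by simp

lemma cinner_diff_left: "cinner (x - y) z = cinner x z - cinner y (z::'a::complex_hilbert)"
  using cinner_add_left[of x "-y" z] by (simp add: cinner_minus_left)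

lemma cinner_diff_right: "cinner x (y - z) = cinner x y - cinner x (z::'a::complex_hilbert)"
  using cinner_add_right[of x y "-z"] by (simp add: cinner_minus_right)

lemma cinner_zero_left [simp]: "cinner 0 (x::'a::complex_hilbert) = 0"
  using cinner_diff_left[of x x x] by simp

lemma cinner_zero_right [simp]: "cinner (x::'a::complex_hilbert) 0 = 0"
  using cinner_diff_right[of x x x] by simp

lemmas cinner_simps = cinner_add_left cinner_add_right cinner_diff_left cinner_diff_right
  cinner_minus_left cinner_minus_right cinner_scaleC_left cinner_scaleC_right
  cinner_scaleR_left cinner_scaleR_right

lemma cinner_self_eq_0 [simp]: "cinner x x = 0 \<longleftrightarrow> (x::'a::complex_hilbert) = 0"
  by (simp add: cinner_self)

lemma Re_cinner_self: "Re (cinner x x) = (norm (x::'a::complex_hilbert))\<^sup>2"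
  by (simp add: cinner_self del: of_real_power)

lemma Re_cinner_commute: "Re (cinner x y) = Re (cinner y (x::'a::complex_hilbert))"
  by (subst cinner_commute) simp

lemma norm_add_square:
  "(norm (x + y))\<^sup>2 = (norm x)\<^sup>2 + 2 * Re (cinner x y) + (norm (y::'a::complex_hilbert))\<^sup>2"
  by (simp add: cinner_simps Re_cinner_commute[of y x] flip: Re_cinner_self)

lemma norm_diff_square:
  "(norm (x - y))\<^sup>2 = (norm x)\<^sup>2 - 2 * Re (cinner x y) + (norm (y::'a::complex_hilbert))\<^sup>2"
  using norm_add_square[of x "-y"] by (simp add: cinner_simps)

text \<open>Pythagoras for the projection onto the line of \<open>y\<close>; it yields both
  Cauchy-Schwarz and the orthogonality of closest points.\<close>

lemma norm_diff_projection_square: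
  fixes x y :: "'a::complex_hilbert"
  assumes "y \<noteq> 0"
  shows "(norm (x - (cinner x y / (norm y)\<^sup>2) *\<^sub>C y))\<^sup>2 = (norm x)\<^sup>2 - (cmod (cinner x y))\<^sup>2 / (norm y)\<^sup>2"
proof -
  have "Re (cinner x ((cinner x y / (norm y)\<^sup>2) *\<^sub>C y)) = (cmod (cinner x y))\<^sup>2 / (norm y)\<^sup>2"
    by (simp add: cinner_simps complex_mult_cnj cmod_power2 mult.commute flip: of_real_power)
  moreover have "(norm ((cinner x y / (norm y)\<^sup>2) *\<^sub>C y))\<^sup>2 = (cmod (cinner x y))\<^sup>2 / (norm y)\<^sup>2"
    using assms by (simp add: norm_scaleC norm_divide norm_mult power2_eq_square)
  ultimately show ?thesis
    by (simp add: norm_diff_square)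
qed

lemma cinner_Cauchy_Schwarz: "cmod (cinner x y) \<le> norm x * norm (y::'a::complex_hilbert)"
proof (cases "y = 0")
  case False
  have "0 \<le> (norm x)\<^sup>2 - (cmod (cinner x y))\<^sup>2 / (norm y)\<^sup>2"
    by (metis norm_diff_projection_square[OF False] zero_le_power2)
  then have "(cmod (cinner x y))\<^sup>2 \<le> (norm x * norm y)\<^sup>2"
    using False by (simp add: field_simps power_mult_distrib)
  then show ?thesis
    by (rule power2_le_imp_le) simp
qed simp

lemma bounded_bilinear_cinner: "bounded_bilinear (cinner :: 'a::complex_hilbert \<Rightarrow> 'a \<Rightarrow> complex)"
  by unfold_locales (auto simp: cinner_simps intro!: exI[of _ 1] cinner_Cauchy_Schwarz)

lemmas tendsto_cinner = bounded_bilinear.tendsto[OF bounded_bilinear_cinner]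

lemma bounded_clinear_cinner_left: "bounded_clinear (\<lambda>x. cinner x (y::'a::complex_hilbert))"
  by (rule bounded_clinearI[where K="norm y"])
    (use cinner_Cauchy_Schwarz[of _ y] in \<open>simp_all add: cinner_simps scaleC_complex_def mult.commute\<close>)

lemma cinner_ext: "(\<And>y. cinner x y = cinner x' y) \<Longrightarrow> x = (x'::'a::complex_hilbert)"
  by (metis cinner_diff_left cinner_self_eq_0 eq_iff_diff_eq_0)

lemma cinner_ext_right: "(\<And>y. cinner y x = cinner y x') \<Longrightarrow> x = (x'::'a::complex_hilbert)"
  by (metis cinner_diff_right cinner_self_eq_0 eq_iff_diff_eq_0)

section \<open>Closest points, orthogonal vectors and the Riesz representation\<close>

lemma exists_closest_point_subspace:
  fixes M :: "'a::complex_hilbert set"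
  assumes M: "complex_vector.subspace M" "closed M"
  shows "\<exists>m\<in>M. \<forall>u\<in>M. norm (x - m) \<le> norm (x - u)"
proof -
  define d where "d = (INF u\<in>M. norm (x - u))"
  have "0 \<in> M"
    using M(1) by (rule complex_vector.subspace_0)
  then have ne: "M \<noteq> {}"
    by blast
  have bdd: "bdd_below ((\<lambda>u. norm (x - u)) ` M)"
    by (rule bdd_belowI[of _ 0]) auto
  have d: "d \<le> norm (x - u)" if "u \<in> M" for u
    unfolding d_def by (rule cINF_lower[OF bdd that])
  have "d \<ge> 0"
    unfolding d_def by (rule cINF_greatest[OF ne]) simp
  have "\<exists>u\<in>M. norm (x - u) < d + 1 / Suc n" for n
    using cInf_less_iff[of "(\<lambda>u. norm (x - u)) ` M" "d + 1 / Suc n"] ne bdd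
    unfolding d_def by simp
  then obtain m where m: "\<And>n. m n \<in> M" "\<And>n. norm (x - m n) < d + 1 / Suc n"
    by metis
  \<comment> \<open>Parallelogram law for \<open>x - u\<close> and \<open>x - v\<close>: their mean
    is \<open>x\<close> minus the midpoint, which lies in \<open>M\<close> and so is at distance at
    least \<open>d\<close>. Minimising sequences are therefore Cauchy.\<close>
  have mid: "(norm (u - v))\<^sup>2 \<le> 2 * (norm (x - u))\<^sup>2 + 2 * (norm (x - v))\<^sup>2 - 4 * d\<^sup>2"
    if "u \<in> M" "v \<in> M" for u v
  proof -
    have "(1/2) *\<^sub>C (u + v) \<in> M"
      using that M(1) by (simp add: complex_vector.subspace_add complex_vector.subspace_scale)
    then have "d\<^sup>2 \<le> (norm (x - (1/2) *\<^sub>C (u + v)))\<^sup>2"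
      using d \<open>d \<ge> 0\<close> by (simp add: power_mono)
    moreover have "x - (1/2) *\<^sub>C (u + v) = (1/2) *\<^sub>R ((x - u) + (x - v))"
      using scaleC_of_real[of "1/2" "u + v"] scaleC_of_real[of "1/2" "x"]
      by (simp add: algebra_simps flip: scaleR_add_left)
    moreover have "(norm ((x - u) + (x - v)))\<^sup>2 + (norm ((x - u) - (x - v)))\<^sup>2
        = 2 * (norm (x - u))\<^sup>2 + 2 * (norm (x - v))\<^sup>2"
      unfolding norm_add_square[of "x - u"] norm_diff_square[of "x - u"] by simp
    moreover have "norm ((x - u) - (x - v)) = norm (u - v)"
      by (simp add: norm_minus_commute)
    ultimately show ?thesis
      by (simp add: power_mult_distrib power_divide)
  qed
  have "Cauchy m"
  proof (rule metric_CauchyI)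
    fix e :: real assume "e > 0"
    have "(\<lambda>n. 4 * (d + 1 / Suc n)\<^sup>2 - 4 * d\<^sup>2) \<longlonglongrightarrow> 4 * (d + 0)\<^sup>2 - 4 * d\<^sup>2"
      by (intro tendsto_intros lim_1_over_n LIMSEQ_Suc[OF lim_1_over_n])
    then have "\<forall>\<^sub>F n in sequentially. 4 * (d + 1 / Suc n)\<^sup>2 - 4 * d\<^sup>2 < e\<^sup>2"
      using \<open>e > 0\<close> by (intro order_tendstoD) auto
    then obtain N where N: "4 * (d + 1 / Suc N)\<^sup>2 - 4 * d\<^sup>2 < e\<^sup>2"
      by (auto simp: eventually_sequentially)
    have small: "(norm (x - m n))\<^sup>2 \<le> (d + 1 / Suc N)\<^sup>2" if "n \<ge> N" for n
    proof (rule power_mono)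
      have "1 / real (Suc n) \<le> 1 / Suc N"
        using that by (simp add: field_simps)
      then show "norm (x - m n) \<le> d + 1 / Suc N"
        using m(2)[of n] by simp
    qed simp
    have "dist (m i) (m j) < e" if "i \<ge> N" "j \<ge> N" for i j
    proof -
      have "(norm (m i - m j))\<^sup>2 < e\<^sup>2"
        using mid[OF m(1) m(1), of i j] small[OF that(1)] small[OF that(2)] N by linarith
      then show ?thesis
        using \<open>e > 0\<close> by (simp add: dist_norm power2_less_imp_less)
    qed
    then show "\<exists>N. \<forall>i\<ge>N. \<forall>j\<ge>N. dist (m i) (m j) < e"
      by blast
  qed
  then obtain l where l: "m \<longlonglongrightarrow> l"
    using Cauchy_convergent convergent_def by blast
  have "l \<in> M"
    using closed_sequentially[OF M(2)] m(1) l by blast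
  have "norm (x - l) \<le> d + 0"
  proof (rule LIMSEQ_le)
    show "(\<lambda>n. norm (x - m n)) \<longlonglongrightarrow> norm (x - l)"
      by (intro tendsto_intros l)
    show "(\<lambda>n. d + 1 / Suc n) \<longlonglongrightarrow> d + 0"
      by (intro tendsto_intros LIMSEQ_Suc[OF lim_1_over_n])
  qed (use m(2) less_imp_le in blast)
  then show ?thesis
    using \<open>l \<in> M\<close> d by (metis add.right_neutral order.trans)
qed

text \<open>Minimality of the closest point \<open>m\<close> is tested against
  \<open>m + c x\<close> with \<open>c\<close> the projection coefficient: a nonzero inner product
  would shorten the distance.\<close>

lemma exists_orthogonal_vector:
  fixes M :: "'a::complex_hilbert set"
  assumes M: "complex_vector.subspace M" "closed M" "M \<noteq> UNIV"
  obtains y where "y \<noteq> 0" "\<And>x. x \<in> M \<Longrightarrow> cinner x y = 0"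
proof -
  obtain x0 where "x0 \<notin> M"
    using M(3) by blast
  obtain m where m: "m \<in> M" "\<And>u. u \<in> M \<Longrightarrow> norm (x0 - m) \<le> norm (x0 - u)"
    using exists_closest_point_subspace[OF M(1,2)] by blast
  have "cinner (x0 - m) x = 0" if "x \<in> M" for x
  proof (cases "x = 0")
    case False
    have "m + c *\<^sub>C x \<in> M" for c
      using M(1) m(1) that by (simp add: complex_vector.subspace_add complex_vector.subspace_scale)
    then have "norm (x0 - m) \<le> norm (x0 - m - c *\<^sub>C x)" for c
      using m(2) by (metis diff_diff_add)
    then have "(norm (x0 - m))\<^sup>2 \<le> (norm (x0 - m))\<^sup>2 - (cmod (cinner (x0 - m) x))\<^sup>2 / (norm x)\<^sup>2"
      by (metis norm_diff_projection_square[OF False] norm_ge_zero power_mono)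
    then show ?thesis
      using False by (simp add: divide_le_0_iff)
  qed simp
  then have "cinner x (x0 - m) = 0" if "x \<in> M" for x
    using that by (metis cinner_commute complex_cnj_zero)
  moreover have "x0 - m \<noteq> 0"
    using \<open>x0 \<notin> M\<close> m(1) by auto
  ultimately show ?thesis
    using that by blast
qed

lemma closed_kernel:
  assumes "bounded_clinear f"
  shows "closed {x. f x = 0}"
  using continuous_closed_vimage[of "{0}" f] bounded_clinear_continuous_on[OF assms, of UNIV]
  by (simp add: closed_vimage vimage_def continuous_on_eq_continuous_at)

text \<open>The representing vector is a multiple of a vector \<open>y\<close> orthogonal to the
  kernel, because every \<open>x\<close> differs from \<open>(l x / l y) y\<close> by an element of
  the kernel.\<close>

theorem Riesz_representation:
  fixes l :: "'a::complex_hilbert \<Rightarrow> complex"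
  assumes l: "bounded_clinear l"
  shows "\<exists>z. \<forall>x. l x = cinner x z"
proof (cases "{x. l x = 0} = UNIV")
  case True
  then show ?thesis
    by (auto intro!: exI[of _ 0])
next
  case False
  have sub: "complex_vector.subspace {x. l x = 0}"
    by (auto simp: complex_vector.subspace_def bounded_clinear_simps[OF l])
  obtain y where y: "y \<noteq> 0" "\<And>x. l x = 0 \<Longrightarrow> cinner x y = 0"
    by (rule exists_orthogonal_vector[OF sub closed_kernel[OF l] False]) simp
  have ly: "l y \<noteq> 0"
    using y(1) y(2)[of y] by auto
  have "l x = cinner x ((cnj (l y) / (norm y)\<^sup>2) *\<^sub>C y)" for x
  proof -
    have "l (x - (l x / l y) *\<^sub>C y) = 0"
      using ly by (simp add: bounded_clinear_simps[OF l] scaleC_complex_def)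
    then have "cinner x y = l x / l y * (norm y)\<^sup>2"
      using y(2)[of "x - (l x / l y) *\<^sub>C y"] by (simp add: cinner_simps cinner_self)
    then show ?thesis
      using ly y(1) by (simp add: cinner_simps)
  qed
  then show ?thesis
    by blast
qed

text \<open>Riesz representation of \<open>x \<mapsto> (f x | y)\<close>; linearity of
  \<open>g\<close> follows from uniqueness of the representing vector, its bound from testing at
  \<open>g y\<close>.\<close>

lemma exists_adjoint:
  fixes f :: "'a::complex_hilbert \<Rightarrow> 'b::complex_hilbert"
  assumes f: "bounded_clinear f"
  obtains g where "bounded_clinear g" "\<And>x y. cinner (f x) y = cinner x (g y)"
proof -
  have "\<exists>z. \<forall>x. cinner (f x) y = cinner x z" for y
    using Riesz_representation[OF bounded_clinear_compose[OF bounded_clinear_cinner_left f]] .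
  then obtain g where g: "\<And>x y. cinner (f x) y = cinner x (g y)"
    by metis
  obtain K where K: "K > 0" "\<And>x. norm (f x) \<le> K * norm x"
    using bounded_clinear_bound[OF f] by blast
  have "bounded_clinear g"
  proof (rule bounded_clinearI[where K=K])
    show "g (x + y) = g x + g y" for x y
      by (rule cinner_ext_right) (simp add: cinner_simps flip: g)
    show "g (a *\<^sub>C x) = a *\<^sub>C g x" for a x
      by (rule cinner_ext_right) (simp add: cinner_simps flip: g)
    show "norm (g y) \<le> K * norm y" for y
    proof (cases "g y = 0")
      case False
      have "(norm (g y))\<^sup>2 = cmod (cinner (f (g y)) y)"
        by (simp add: g cinner_self norm_power)
      also have "\<dots> \<le> norm (f (g y)) * norm y"
        by (rule cinner_Cauchy_Schwarz)
      also have "\<dots> \<le> K * norm (g y) * norm y"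
        by (intro mult_right_mono K) simp
      finally show ?thesis
        using False by (simp add: power2_eq_square)
    qed (use K in simp)
  qed
  then show ?thesis
    using that g by blast
qed

lemma adjoint_sym:
  assumes "\<And>x y. cinner (f x) y = cinner x (g y)"
  shows "cinner (g y) x = cinner y (f x)"
  by (metis assms cinner_commute)

section \<open>Dense ranges and extension by continuity\<close>

lemma closure_range_sequential: "y \<in> closure (range f) \<longleftrightarrow> (\<exists>s. (\<lambda>n. f (s n)) \<longlonglongrightarrow> y)"
  for f :: "'a \<Rightarrow> 'b::first_countable_topology"
proof
  assume "y \<in> closure (range f)"
  then obtain t where t: "\<forall>n. t n \<in> range f" "t \<longlonglongrightarrow> y"
    unfolding closure_sequential by blast
  then have "t n = f (inv_into UNIV f (t n))" for n
    by (simp add: f_inv_into_f)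
  then have "t = (\<lambda>n. f (inv_into UNIV f (t n)))"
    by (simp add: fun_eq_iff)
  then show "\<exists>s. (\<lambda>n. f (s n)) \<longlonglongrightarrow> y"
    using t(2) by (intro exI[of _ "\<lambda>n. inv_into UNIV f (t n)"]) metis
next
  assume "\<exists>s. (\<lambda>n. f (s n)) \<longlonglongrightarrow> y"
  then obtain s where "(\<lambda>n. f (s n)) \<longlonglongrightarrow> y"
    by blast
  then show "y \<in> closure (range f)"
    unfolding closure_sequential by (intro exI[of _ "\<lambda>n. f (s n)"]) simp
qed

text \<open>A proper closed subspace would leave a nonzero orthogonal vector. The hypothesis is
  injectivity of the adjoint, phrased without naming one, so that the domain may be a mere Banach
  space.\<close>

lemma dense_range_if_adjoint_inj:
  fixes f :: "'a::complex_banach \<Rightarrow> 'b::complex_hilbert"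
  assumes f: "bounded_clinear f" and adj: "\<And>y. (\<And>x. cinner (f x) y = 0) \<Longrightarrow> y = 0"
  shows "closure (range f) = UNIV"
proof (rule ccontr)
  assume *: "closure (range f) \<noteq> UNIV"
  have sub: "complex_vector.subspace (closure (range f))"
    unfolding complex_vector.subspace_def
  proof (intro conjI ballI allI)
    show "0 \<in> closure (range f)"
      using closure_subset bounded_clinear_zero[OF f] by (metis rangeI subsetD)
    show "x + y \<in> closure (range f)" if "x \<in> closure (range f)" "y \<in> closure (range f)" for x y
    proof -
      obtain a b where "(\<lambda>n. f (a n)) \<longlonglongrightarrow> x" "(\<lambda>n. f (b n)) \<longlonglongrightarrow> y"
        using \<open>x \<in> _\<close> \<open>y \<in> _\<close> unfolding closure_range_sequential by blast
      then have "(\<lambda>n. f (a n + b n)) \<longlonglongrightarrow> x + y"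
        by (simp add: bounded_clinear_add[OF f] tendsto_add)
      then show ?thesis
        unfolding closure_range_sequential by (rule exI[of _ "\<lambda>n. a n + b n"])
    qed
    show "c *\<^sub>C x \<in> closure (range f)" if "x \<in> closure (range f)" for x c
    proof -
      obtain a where "(\<lambda>n. f (a n)) \<longlonglongrightarrow> x"
        using \<open>x \<in> _\<close> unfolding closure_range_sequential by blast
      then have "(\<lambda>n. f (c *\<^sub>C a n)) \<longlonglongrightarrow> c *\<^sub>C x"
        by (simp add: bounded_clinear_scaleC[OF f] bounded_clinear_tendsto[OF bounded_clinear_const_scaleC])
      then show ?thesis
        unfolding closure_range_sequential by (rule exI[of _ "\<lambda>n. c *\<^sub>C a n"])
    qed
  qed
  obtain y where y: "y \<noteq> 0" "\<And>x. x \<in> closure (range f) \<Longrightarrow> cinner x y = 0"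
    using exists_orthogonal_vector[OF sub _ *] by auto
  have "cinner (f x) y = 0" for x
    by (rule y(2)) (rule subsetD[OF closure_subset rangeI])
  then show False
    using adj y(1) by simp
qed

lemma bounded_clinear_eq_on_dense:
  assumes "bounded_clinear f" "bounded_clinear g" "closure (range e) = UNIV"
    and "\<And>x. f (e x) = g (e x)"
  shows "f y = g y"
proof -
  have "closed {y. f y - g y = 0}"
    by (rule closed_kernel[OF bounded_clinear_sub[OF assms(1,2)]])
  moreover have "range e \<subseteq> {y. f y - g y = 0}"
    using assms(4) by auto
  ultimately have "closure (range e) \<subseteq> {y. f y - g y = 0}"
    by (simp add: closure_minimal)
  then show ?thesis
    using assms(3) by auto
qed

lemma norm_le_on_dense:
  assumes "bounded_clinear f" "bounded_clinear g" "closure (range e) = UNIV"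
    and "\<And>x. norm (f (e x)) \<le> c * norm (g (e x))"
  shows "norm (f y) \<le> c * norm (g y)"
proof -
  have "closed {y. norm (f y) \<le> c * norm (g y)}"
    using assms(1,2) by (intro closed_Collect_le continuous_intros bounded_clinear_continuous_on)
  moreover have "range e \<subseteq> {y. norm (f y) \<le> c * norm (g y)}"
    using assms(4) by auto
  ultimately have "closure (range e) \<subseteq> {y. norm (f y) \<le> c * norm (g y)}"
    by (simp add: closure_minimal)
  then show ?thesis
    using assms(3) by auto
qed

text \<open>The bound makes \<open>f x\<close> a well-defined Lipschitz function of
  \<open>e x\<close>, even where \<open>e\<close> is not injective. This serves both to identify the
  abstract completions and to factor one operator through another.\<close>

lemma extend_bounded_clinear:
  fixes e :: "'a::complex_banach \<Rightarrow> 'b::complex_banach" and f :: "'a \<Rightarrow> 'c::complex_banach"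
  assumes e: "\<And>x y. e (x + y) = e x + e y" "\<And>a x. e (a *\<^sub>C x) = a *\<^sub>C e x"
    and f: "\<And>x y. f (x + y) = f x + f y" "\<And>a x. f (a *\<^sub>C x) = a *\<^sub>C f x"
    and dense: "closure (range e) = UNIV"
    and bound: "\<And>x. norm (f x) \<le> K * norm (e x)"
  obtains g where "bounded_clinear g" "\<And>x. g (e x) = f x"
proof -
  have diff: "e (x - y) = e x - e y" "f (x - y) = f x - f y" for x y
    using e(1)[of "x - y" y] f(1)[of "x - y" y] by (simp_all add: algebra_simps)
  define h where "h b = f (SOME x. e x = b)" for b
  have h: "h (e x) = f x" for x
  proof -
    have "e (SOME y. e y = e x) = e x"
      by (rule someI) simp
    then have "norm (f ((SOME y. e y = e x) - x)) \<le> K * 0"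
      by (metis bound diff(1) diff_self norm_zero)
    then show ?thesis
      by (simp add: h_def diff)
  qed
  \<comment> \<open>\<open>K\<close> may be nonpositive; \<open>C\<close> is a bound that one can
    divide by.\<close>
  define C where "C = max K 1"
  have "K \<le> C" "C > 0"
    by (auto simp: C_def)
  have lip: "norm (f x) \<le> C * norm (e x)" for x
    using bound[of x] \<open>K \<le> C\<close> mult_right_mono[of K C "norm (e x)"] by simp
  have "uniformly_continuous_on (range e) h"
    unfolding uniformly_continuous_on_def
  proof (intro allI impI)
    fix \<epsilon> :: real assume "\<epsilon> > 0"
    have "dist (h x') (h x) < \<epsilon>" if range: "x \<in> range e" "x' \<in> range e" and "dist x' x < \<epsilon> / C" for x x'
    proof -
      obtain a a' where [simp]: "x = e a" "x' = e a'"
        using range by (metis imageE)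
      have "norm (f a' - f a) \<le> C * norm (e a' - e a)"
        using lip[of "a' - a"] by (simp add: diff)
      also have "\<dots> < \<epsilon>"
        using \<open>dist x' x < _\<close> \<open>C > 0\<close> by (simp add: dist_norm field_simps)
      finally show ?thesis
        by (simp add: h dist_norm)
    qed
    then show "\<exists>d>0. \<forall>x\<in>range e. \<forall>x'\<in>range e. dist x' x < d \<longrightarrow> dist (h x') (h x) < \<epsilon>"
      using \<open>\<epsilon> > 0\<close> \<open>C > 0\<close> by (intro exI[of _ "\<epsilon> / C"]) auto
  qed
  from uniformly_continuous_on_extension_on_closure[OF this]
  obtain g where g: "uniformly_continuous_on (closure (range e)) g" "\<And>x. x \<in> range e \<Longrightarrow> h x = g x"
    by metis
  have cont: "isCont g b" for b
    using uniformly_continuous_imp_continuous[OF g(1)] dense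
    by (simp add: continuous_on_eq_continuous_at)
  have ge: "g (e x) = f x" for x
    using g(2) h by (metis rangeI)
  have seq: "\<exists>s. (\<lambda>n. e (s n)) \<longlonglongrightarrow> b \<and> (\<lambda>n. f (s n)) \<longlonglongrightarrow> g b" for b
  proof -
    obtain s where s: "(\<lambda>n. e (s n)) \<longlonglongrightarrow> b"
      using dense closure_range_sequential[of b e] by auto
    have "(\<lambda>n. g (e (s n))) \<longlonglongrightarrow> g b"
      using isCont_tendsto_compose[OF cont s] .
    then show ?thesis
      using s by (auto simp: ge)
  qed
  have lim_unique: "g b = l" if "(\<lambda>n. e (s n)) \<longlonglongrightarrow> b" "(\<lambda>n. f (s n)) \<longlonglongrightarrow> l" for s b l
    using isCont_tendsto_compose[OF cont that(1)] that(2) by (simp add: ge LIMSEQ_unique)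
  have "bounded_clinear g"
  proof (rule bounded_clinearI[where K=C])
    fix x y
    obtain s t where st: "(\<lambda>n. e (s n)) \<longlonglongrightarrow> x" "(\<lambda>n. f (s n)) \<longlonglongrightarrow> g x"
      "(\<lambda>n. e (t n)) \<longlonglongrightarrow> y" "(\<lambda>n. f (t n)) \<longlonglongrightarrow> g y"
      using seq by meson
    show "g (x + y) = g x + g y"
      by (rule lim_unique[of "\<lambda>n. s n + t n"]) (auto simp: e f intro!: tendsto_add st)
    show "g (a *\<^sub>C x) = a *\<^sub>C g x" for a
      by (rule lim_unique[of "\<lambda>n. a *\<^sub>C s n"])
        (auto simp: e f intro!: bounded_linear.tendsto[OF bounded_linear_scaleC] st)
    show "norm (g x) \<le> C * norm x"
      by (rule LIMSEQ_le[OF tendsto_norm[OF st(2)] tendsto_mult_left[OF tendsto_norm[OF st(1)], of C]])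
        (use lip in blast)
  qed
  then show ?thesis
    using that ge by blast
qed

section \<open>Power series in a contraction\<close>

text \<open>The norm may equal 1, so the binomial series is used on the boundary of its disc and
  convergence has to come from absolutely summable coefficients.\<close>

locale contraction =
  fixes E :: "'a::complex_banach \<Rightarrow> 'a"
  assumes clinear: "bounded_clinear E"
    and contractive: "norm (E x) \<le> norm x"
begin

definition series :: "(nat \<Rightarrow> real) \<Rightarrow> 'a \<Rightarrow> 'a"
  where "series a h = (\<Sum>k. a k *\<^sub>R (E ^^ k) h)"

lemma norm_iter_le: "norm ((E ^^ k) h) \<le> norm h"
  by (induction k) (use contractive order_trans in auto)

lemma iter_clinear: "bounded_clinear (E ^^ k)"
proof (induction k)
  case 0
  then show ?case
    using bounded_clinear_ident by (simp add: id_def)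
next
  case (Suc k)
  then show ?case
    using bounded_clinear_compose[OF clinear] by (simp add: o_def)
qed

lemma iter_commute: "(E ^^ i) ((E ^^ j) h) = (E ^^ j) ((E ^^ i) h)"
  by (metis add.commute comp_apply funpow_add)

lemma summable_norm_series:
  assumes "summable (\<lambda>k. \<bar>a k\<bar>)"
  shows "summable (\<lambda>k. norm (a k *\<^sub>R (E ^^ k) h))"
proof (rule summable_comparison_test_ev)
  show "summable (\<lambda>k. \<bar>a k\<bar> * norm h)"
    by (rule summable_mult2[OF assms])
qed (simp add: mult_left_mono norm_iter_le)

lemma series_sums:
  assumes "summable (\<lambda>k. \<bar>a k\<bar>)"
  shows "(\<lambda>k. a k *\<^sub>R (E ^^ k) h) sums series a h"
  unfolding series_def by (rule summable_sums[OF summable_norm_cancel[OF summable_norm_series[OF assms]]])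

lemma norm_series_le:
  assumes "summable (\<lambda>k. \<bar>a k\<bar>)"
  shows "norm (series a h) \<le> (\<Sum>k. \<bar>a k\<bar>) * norm h"
proof -
  have "norm (series a h) \<le> (\<Sum>k. norm (a k *\<^sub>R (E ^^ k) h))"
    unfolding series_def by (rule summable_norm[OF summable_norm_series[OF assms]])
  also have "\<dots> \<le> (\<Sum>k. \<bar>a k\<bar> * norm h)"
    by (rule suminf_le[OF _ summable_norm_series[OF assms] summable_mult2[OF assms]])
      (simp add: mult_left_mono norm_iter_le)
  finally show ?thesis
    using suminf_mult2[OF assms] by simp
qed

lemma bounded_clinear_series:
  assumes a: "summable (\<lambda>k. \<bar>a k\<bar>)"
  shows "bounded_clinear (series a)"
proof (rule bounded_clinearI[where K="\<Sum>k. \<bar>a k\<bar>"])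
  show "series a (x + y) = series a x + series a y" for x y
    using sums_unique2[OF series_sums[OF a, of "x + y"]] sums_add[OF series_sums[OF a, of x] series_sums[OF a, of y]]
    by (simp add: bounded_clinear_add[OF iter_clinear] scaleR_add_right)
  show "series a (c *\<^sub>C x) = c *\<^sub>C series a x" for c x
  proof -
    have "(\<lambda>k. c *\<^sub>C (a k *\<^sub>R (E ^^ k) x)) sums (c *\<^sub>C series a x)"
      by (rule bounded_linear.sums[OF bounded_linear_scaleC series_sums[OF a]])
    moreover have "c *\<^sub>C (a k *\<^sub>R (E ^^ k) x) = a k *\<^sub>R (E ^^ k) (c *\<^sub>C x)" for k
      by (simp add: bounded_clinear_scaleC[OF iter_clinear] scaleR_scaleC scaleC_scaleC mult.commute)
    ultimately show ?thesis
      using sums_unique2[OF series_sums[OF a, of "c *\<^sub>C x"]] by simp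
  qed
qed (rule norm_series_le[OF a])

text \<open>Cauchy product: the doubly indexed family is absolutely summable, so summing by rows
  gives the left side and summing along antidiagonals the right side.\<close>

lemma series_mult:
  assumes a: "summable (\<lambda>k. \<bar>a k\<bar>)" and b: "summable (\<lambda>k. \<bar>b k\<bar>)"
    and c: "summable (\<lambda>k. \<bar>c k\<bar>)" "\<And>n. c n = (\<Sum>i\<le>n. a i * b (n - i))"
  shows "series a (series b h) = series c h"
proof -
  define f where "f = (\<lambda>(i, j). (a i * b j) *\<^sub>R (E ^^ (i + j)) h)"
  have A: "(\<lambda>i. \<bar>a i\<bar>) summable_on UNIV" and B: "(\<lambda>i. \<bar>b i\<bar>) summable_on UNIV"
    using a b by (auto intro: summable_nonneg_imp_summable_on)
  have bound: "(\<lambda>(i, j). \<bar>a i\<bar> * \<bar>b j\<bar>) summable_on UNIV \<times> UNIV"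
  proof -
    have "(\<lambda>p. norm (case p of (i, j) \<Rightarrow> \<bar>a i\<bar> * \<bar>b j\<bar>)) summable_on (SIGMA i:UNIV. UNIV)"
      unfolding Infinite_Sum.abs_summable_on_Sigma_iff
    proof (intro conjI ballI)
      have "(\<lambda>i. \<bar>a i\<bar> * infsum (\<lambda>j. \<bar>b j\<bar>) UNIV) summable_on UNIV"
        by (rule summable_on_cmult_left[OF A])
      then show "(\<lambda>i. norm (infsum (\<lambda>j. norm (case (i, j) of (i, j) \<Rightarrow> \<bar>a i\<bar> * \<bar>b j\<bar>)) UNIV)) summable_on UNIV"
        by (simp add: infsum_cmult_right' abs_mult infsum_nonneg)
    qed (auto simp: abs_mult intro!: summable_on_cmult_right B)
    then show ?thesis
      by (simp add: case_prod_unfold abs_mult)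
  qed
  have "(\<lambda>p. norm (f p)) summable_on UNIV \<times> UNIV"
  proof (rule Infinite_Sum.abs_summable_on_comparison_test)
    show "(\<lambda>p. norm (case p of (i, j) \<Rightarrow> \<bar>a i\<bar> * \<bar>b j\<bar> * norm h)) summable_on UNIV \<times> UNIV"
      using summable_on_cmult_left[OF bound, of "norm h"]
      by (simp add: case_prod_unfold abs_mult)
  qed (auto simp: f_def abs_mult norm_iter_le mult_left_mono)
  then have f: "f summable_on UNIV \<times> UNIV"
    by (rule abs_summable_summable)
  have infsum_series: "infsum (\<lambda>k. d k *\<^sub>R (E ^^ k) x) UNIV = series d x"
    if "summable (\<lambda>k. \<bar>d k\<bar>)" for d x
    using norm_summable_imp_has_sum[OF summable_norm_series[OF that] series_sums[OF that]]
    by (rule infsumI)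
  have inner: "infsum (\<lambda>j. f (i, j)) UNIV = a i *\<^sub>R (E ^^ i) (series b h)" for i
  proof -
    have "f (i, j) = a i *\<^sub>R (b j *\<^sub>R (E ^^ j) ((E ^^ i) h))" for j
      by (simp add: f_def funpow_add iter_commute[of i j])
    then have "infsum (\<lambda>j. f (i, j)) UNIV = a i *\<^sub>R infsum (\<lambda>j. b j *\<^sub>R (E ^^ j) ((E ^^ i) h)) UNIV"
      by (simp add: infsum_scaleR_right del: scaleR_scaleR)
    also have "infsum (\<lambda>j. b j *\<^sub>R (E ^^ j) ((E ^^ i) h)) UNIV = series b ((E ^^ i) h)"
      by (rule infsum_series[OF b])
    also have "series b ((E ^^ i) h) = (E ^^ i) (series b h)"
    proof (rule sums_unique2[OF series_sums[OF b]])
      have "(\<lambda>k. (E ^^ i) (b k *\<^sub>R (E ^^ k) h)) sums (E ^^ i) (series b h)"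
        by (rule bounded_linear.sums[OF bounded_clinear_imp_bounded_linear[OF iter_clinear] series_sums[OF b]])
      moreover have "(E ^^ i) (b k *\<^sub>R (E ^^ k) h) = b k *\<^sub>R (E ^^ k) ((E ^^ i) h)" for k
        by (simp add: bounded_clinear_scaleR[OF iter_clinear] iter_commute[of i k])
      ultimately show "(\<lambda>k. b k *\<^sub>R (E ^^ k) ((E ^^ i) h)) sums (E ^^ i) (series b h)"
        by simp
    qed
    finally show ?thesis .
  qed
  have 1: "infsum f (UNIV \<times> UNIV) = series a (series b h)"
    using infsum_Sigma_banach[OF f] infsum_series[OF a, of "series b h"] by (simp add: inner)
  \<comment> \<open>The pair \<open>(n, i)\<close> names the \<open>i\<close>-th entry of the
    \<open>n\<close>-th antidiagonal.\<close>
  have bij: "bij_betw (\<lambda>(n, i). (i, n - i)) (SIGMA n:UNIV. {..n}) (UNIV \<times> UNIV :: (nat \<times> nat) set)"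
    by (rule bij_betwI[where g="\<lambda>(i, j). (i + j, i)"]) auto
  let ?g = "\<lambda>p. f (case p of (n, i) \<Rightarrow> (i, n - i))"
  have g: "?g summable_on (SIGMA n:UNIV. {..n})"
    using summable_on_reindex_bij_betw[OF bij, of f] f by simp
  have "infsum f (UNIV \<times> UNIV) = infsum ?g (SIGMA n:UNIV. {..n})"
    using infsum_reindex_bij_betw[OF bij, of f] by simp
  also have "\<dots> = infsum (\<lambda>n. infsum (\<lambda>i. ?g (n, i)) {..n}) UNIV"
    using infsum_Sigma_banach[OF g] by simp
  also have "(\<lambda>n. infsum (\<lambda>i. ?g (n, i)) {..n}) = (\<lambda>n. c n *\<^sub>R (E ^^ n) h)"
    by (auto simp: f_def c(2) scaleR_sum_left intro!: sum.cong)
  also have "infsum (\<lambda>n. c n *\<^sub>R (E ^^ n) h) UNIV = series c h"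
    by (rule infsum_series[OF c(1)])
  finally show ?thesis
    using 1 by simp
qed

end

text \<open>The relation passes to iterates and to limits of partial sums. In this way the inverse
  of \<open>A\<close> will carry the powers of one scale into those of the other.\<close>

lemma series_intertwine:
  assumes "contraction E" "contraction E'" and X: "bounded_clinear X" "\<And>x. X (E x) = E' (X x)"
    and a: "summable (\<lambda>k. \<bar>a k\<bar>)"
  shows "X (contraction.series E a h) = contraction.series E' a (X h)"
proof -
  interpret E: contraction E by fact
  interpret E': contraction E' by fact
  have iter: "X ((E ^^ k) h) = (E' ^^ k) (X h)" for k
    by (induction k) (simp_all add: X(2))
  have "(\<lambda>k. X (a k *\<^sub>R (E ^^ k) h)) sums X (E.series a h)"
    by (rule bounded_linear.sums[OF bounded_clinear_imp_bounded_linear[OF X(1)] E.series_sums[OF a]])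
  then have "(\<lambda>k. a k *\<^sub>R (E' ^^ k) (X h)) sums X (E.series a h)"
    by (simp add: bounded_clinear_scaleR[OF X(1)] iter)
  then show ?thesis
    using sums_unique2[OF E'.series_sums[OF a]] by simp
qed

lemma series_adjoint:
  fixes E :: "'a::complex_hilbert \<Rightarrow> 'a"
  assumes "contraction E" and adj: "\<And>x y. cinner (E x) y = cinner x (E y)"
    and a: "summable (\<lambda>k. \<bar>a k\<bar>)"
  shows "cinner (contraction.series E a x) y = cinner x (contraction.series E a y)"
proof -
  interpret contraction E by fact
  have iter: "cinner ((E ^^ k) x) y = cinner x ((E ^^ k) y)" for k x y
    by (induction k arbitrary: x y) (simp_all add: adj flip: funpow_swap1)
  have "(\<lambda>k. cinner (a k *\<^sub>R (E ^^ k) x) y) sums cinner (series a x) y"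
    by (rule bounded_linear.sums[OF bounded_bilinear.bounded_linear_left[OF bounded_bilinear_cinner] series_sums[OF a]])
  moreover have "(\<lambda>k. cinner x (a k *\<^sub>R (E ^^ k) y)) sums cinner x (series a y)"
    by (rule bounded_linear.sums[OF bounded_bilinear.bounded_linear_right[OF bounded_bilinear_cinner] series_sums[OF a]])
  ultimately show ?thesis
    by (simp add: cinner_scaleR_left cinner_scaleR_right iter sums_unique2)
qed

section \<open>Fractional powers of a bounded operator\<close>

text \<open>The coefficients of the binomial series of \<open>(1 - x)\<close> to the power \<open>\<tau>\<close>.\<close>

definition binom_coeff :: "real \<Rightarrow> nat \<Rightarrow> real"
  where "binom_coeff \<tau> k = (-1) ^ k * (\<tau> gchoose k)"

lemma binom_coeff_0 [simp]: "binom_coeff \<tau> 0 = 1"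
  by (simp add: binom_coeff_def)

lemma binom_coeff_Suc: "binom_coeff \<tau> (Suc k) = binom_coeff \<tau> k * ((real k - \<tau>) / (real k + 1))"
proof -
  have "(\<tau> gchoose Suc k) = (\<tau> gchoose k) * (\<tau> - real k) / (real k + 1)"
    using gbinomial_mult_1[of \<tau> k] by (simp add: field_simps)
  then show ?thesis
    by (simp add: binom_coeff_def minus_divide_left algebra_simps)
qed

lemma binom_coeff_nonpos:
  assumes "0 \<le> \<tau>" "\<tau> \<le> 1"
  shows "binom_coeff \<tau> (Suc k) \<le> 0"
proof (induction k)
  case (Suc k)
  then show ?case
    using assms unfolding binom_coeff_Suc[of \<tau> "Suc k"] by (intro mult_nonpos_nonneg) auto
qed (use assms in \<open>simp add: binom_coeff_Suc\<close>)

text \<open>Summation amounts to dividing the series by \<open>1 - x\<close>: the partial sums are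
  the coefficients for the exponent \<open>\<tau> - 1\<close>, and the ratios of consecutive ones
  are nonnegative.\<close>

lemma sum_binom_coeff:
  assumes "0 \<le> \<tau>" "\<tau> \<le> 1"
  shows "0 \<le> (\<Sum>k\<le>n. binom_coeff \<tau> k)"
proof -
  have "(\<Sum>k\<le>n. binom_coeff \<tau> k) = binom_coeff (\<tau> - 1) n"
    using gbinomial_sum_lower_neg[of \<tau> n] by (simp add: binom_coeff_def mult.commute)
  also have "\<dots> \<ge> 0"
    by (induction n) (use assms in \<open>auto simp: binom_coeff_Suc\<close>)
  finally show ?thesis .
qed

text \<open>All coefficients after the constant 1 are nonpositive, so nonnegative partial sums bound
  their absolute sum by 1. This exact constant is what keeps fractional powers near the
  identity.\<close>

lemma
  assumes "0 \<le> \<tau>" "\<tau> \<le> 1"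
  shows summable_binom_coeff: "summable (\<lambda>k. \<bar>binom_coeff \<tau> k\<bar>)"
    and suminf_binom_coeff_le: "(\<Sum>k. \<bar>binom_coeff \<tau> (Suc k)\<bar>) \<le> 1"
proof -
  have bound: "(\<Sum>k<n. \<bar>binom_coeff \<tau> (Suc k)\<bar>) \<le> 1" for n
  proof -
    have "(\<Sum>k<n. \<bar>binom_coeff \<tau> (Suc k)\<bar>) = - (\<Sum>k<n. binom_coeff \<tau> (Suc k))"
      using binom_coeff_nonpos[OF assms] by (simp flip: sum_negf)
    also have "\<dots> = 1 - (\<Sum>k\<le>n. binom_coeff \<tau> k)"
      by (simp only: lessThan_Suc_atMost[symmetric] sum.lessThan_Suc_shift) simp
    finally show ?thesis
      using sum_binom_coeff[OF assms, of n] by simp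
  qed
  have "summable (\<lambda>k. \<bar>binom_coeff \<tau> (Suc k)\<bar>)"
    by (rule summableI_nonneg_bounded[where x=1]) (use bound in auto)
  then show "summable (\<lambda>k. \<bar>binom_coeff \<tau> k\<bar>)"
    by (subst (asm) summable_Suc_iff)
  show "(\<Sum>k. \<bar>binom_coeff \<tau> (Suc k)\<bar>) \<le> 1"
    by (rule suminf_le_const[OF \<open>summable (\<lambda>k. \<bar>binom_coeff \<tau> (Suc k)\<bar>)\<close> bound])
qed

text \<open>The binomial series of \<open>I - E\<close> to the power \<open>\<tau>\<close> at
  \<open>E = I - F\<close>; it takes the place of the spectral calculus.\<close>

definition frac_pow :: "('a::complex_banach \<Rightarrow> 'a) \<Rightarrow> real \<Rightarrow> 'a \<Rightarrow> 'a"
  where "frac_pow F \<tau> h = (\<Sum>k. binom_coeff \<tau> k *\<^sub>R ((\<lambda>x. x - F x) ^^ k) h)"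

text \<open>Fractional powers inherit this condition, so powers of powers can be formed: the powers
  of \<Lambda> are powers of a square root.\<close>

locale near_identity =
  fixes F :: "'a::complex_banach \<Rightarrow> 'a"
  assumes clinear: "bounded_clinear F"
    and near: "norm (x - F x) \<le> norm x"
begin

sublocale defect: contraction "\<lambda>x. x - F x"
  by unfold_locales (simp_all add: near bounded_clinear_sub[OF bounded_clinear_ident clinear])

lemma frac_pow_series: "frac_pow F \<tau> = defect.series (binom_coeff \<tau>)"
  by (simp add: fun_eq_iff frac_pow_def defect.series_def)

lemma bounded_clinear_frac_pow: "0 \<le> \<tau> \<Longrightarrow> \<tau> \<le> 1 \<Longrightarrow> bounded_clinear (frac_pow F \<tau>)"
  by (simp add: frac_pow_series defect.bounded_clinear_series summable_binom_coeff)

lemma frac_pow_0: "frac_pow F 0 h = h"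
proof -
  have "binom_coeff 0 k = 0" if "k \<notin> {0}" for k
    using that by (cases k) (simp_all add: binom_coeff_def)
  then show ?thesis
    unfolding frac_pow_def by (subst suminf_finite[of "{0}"]) auto
qed

lemma frac_pow_1: "frac_pow F 1 h = F h"
proof -
  have "binom_coeff 1 k = 0" if "k \<notin> {0, 1}" for k
  proof -
    have "binom_coeff 1 (Suc (Suc k)) = 0" for k
      by (induction k) (simp_all add: binom_coeff_Suc)
    then show ?thesis
      using that by (metis insertCI not0_implies_Suc One_nat_def)
  qed
  then show ?thesis
    unfolding frac_pow_def by (subst suminf_finite[of "{0, 1}"]) (auto simp: binom_coeff_Suc)
qed

text \<open>Vandermonde's convolution of binomial coefficients. The sum of the exponents stays in
  [0, 1], where summability of the coefficients is established.\<close>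

lemma frac_pow_add:
  assumes "0 \<le> \<sigma>" "0 \<le> \<tau>" "\<sigma> + \<tau> \<le> 1"
  shows "frac_pow F \<sigma> (frac_pow F \<tau> h) = frac_pow F (\<sigma> + \<tau>) h"
  unfolding frac_pow_series
proof (rule defect.series_mult)
  show "binom_coeff (\<sigma> + \<tau>) n = (\<Sum>i\<le>n. binom_coeff \<sigma> i * binom_coeff \<tau> (n - i))" for n
  proof -
    have "binom_coeff \<sigma> i * binom_coeff \<tau> (n - i) = (-1) ^ n * ((\<sigma> gchoose i) * (\<tau> gchoose (n - i)))"
      if "i \<le> n" for i
    proof -
      have "(-1::real) ^ n = (-1) ^ i * (-1) ^ (n - i)"
        using that by (simp flip: power_add)
      then show ?thesis
        by (simp add: binom_coeff_def)
    qed
    then have "(\<Sum>i\<le>n. binom_coeff \<sigma> i * binom_coeff \<tau> (n - i))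
        = (\<Sum>i\<le>n. (-1) ^ n * ((\<sigma> gchoose i) * (\<tau> gchoose (n - i))))"
      by (intro sum.cong) auto
    then show ?thesis
      using gbinomial_Vandermonde[of \<sigma> \<tau> n]
      by (simp add: binom_coeff_def[of "\<sigma> + \<tau>"] atLeast0AtMost flip: sum_distrib_left)
  qed
qed (use assms in \<open>auto intro!: summable_binom_coeff\<close>)

text \<open>The constant coefficient cancels against the identity, and the others have absolute sum
  at most 1.\<close>

lemma norm_sub_frac_pow_le:
  assumes "0 \<le> \<tau>" "\<tau> \<le> 1"
  shows "norm (h - frac_pow F \<tau> h) \<le> norm h"
proof -
  let ?a = "\<lambda>k. if k = 0 then 0 else - binom_coeff \<tau> k"
  have s: "summable (\<lambda>k. \<bar>?a k\<bar>)"
    by (rule summable_comparison_test'[OF summable_binom_coeff[OF assms]]) auto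
  have "(\<lambda>k. if k = 0 then ((\<lambda>x. x - F x) ^^ k) h else 0) sums h"
    using sums_single[of 0 "\<lambda>k. ((\<lambda>x. x - F x) ^^ k) h"] by simp
  from sums_diff[OF this defect.series_sums[OF summable_binom_coeff[OF assms], of h]]
  have "(\<lambda>k. ?a k *\<^sub>R ((\<lambda>x. x - F x) ^^ k) h) sums (h - frac_pow F \<tau> h)"
    unfolding frac_pow_series by (rule sums_cong[THEN iffD1, rotated]) (auto simp: binom_coeff_def)
  then have "h - frac_pow F \<tau> h = defect.series ?a h"
    by (rule sums_unique2[OF _ defect.series_sums[OF s]])
  moreover have "(\<Sum>k. \<bar>?a k\<bar>) \<le> 1"
    using suminf_split_head[OF s] suminf_binom_coeff_le[OF assms] by simp
  ultimately show ?thesis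
    using defect.norm_series_le[OF s, of h] mult_right_mono[of "\<Sum>k. \<bar>?a k\<bar>" 1 "norm h"] by simp
qed

lemma near_identity_frac_pow: "0 \<le> \<tau> \<Longrightarrow> \<tau> \<le> 1 \<Longrightarrow> near_identity (frac_pow F \<tau>)"
  by unfold_locales (auto simp: bounded_clinear_frac_pow norm_sub_frac_pow_le)

end

lemma frac_pow_intertwine:
  assumes "near_identity F" "near_identity F'" and X: "bounded_clinear X" "\<And>x. X (F x) = F' (X x)"
    and "0 \<le> \<tau>" "\<tau> \<le> 1"
  shows "X (frac_pow F \<tau> h) = frac_pow F' \<tau> (X h)"
proof -
  interpret F: near_identity F by fact
  interpret F': near_identity F' by fact
  show ?thesis
    unfolding F.frac_pow_series F'.frac_pow_series
    by (rule series_intertwine) (use assms in \<open>auto simp: bounded_clinear_simps[OF X(1)]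
        summable_binom_coeff F.defect.contraction_axioms F'.defect.contraction_axioms\<close>)
qed

section \<open>Balakrishnan's formula\<close>

text \<open>The substitution \<open>t = u / (1 - u)\<close> moves Euler's integral from the unit
  interval to the half-line.\<close>

lemma Beta_half_line:
  fixes p q :: real
  assumes "p > 0" "q > 0"
  shows set_integrable_Beta_half_line:
      "set_integrable lborel {0<..} (\<lambda>t. t powr (p - 1) * (1 + t) powr - (p + q))" (is ?int)
    and set_integral_Beta_half_line:
      "(LINT t:{0<..}|lborel. t powr (p - 1) * (1 + t) powr - (p + q)) = Beta p q" (is ?eq)
proof -
  let ?f = "\<lambda>t::real. t powr (p - 1) * (1 + t) powr - (p + q)"
  let ?g = "\<lambda>u::real. u / (1 - u)" and ?g' = "\<lambda>u::real. 1 / (1 - u)\<^sup>2"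
  let ?h = "\<lambda>u::real. u powr (p - 1) * (1 - u) powr (q - 1)"
  have fg: "?f (?g u) * ?g' u = ?h u" if "u \<in> {0<..<1}" for u
  proof -
    have *: "1 + u / (1 - u) = 1 / (1 - u)"
      using that by (simp add: field_simps)
    have "(1 - u) powr (p + q) = (1 - u) powr (p - 1) * (1 - u) powr (q - 1) * (1 - u)\<^sup>2"
    proof -
      have "(1 - u) powr (p + q) = (1 - u) powr ((p - 1) + (q - 1) + 2)"
        by simp
      also have "\<dots> = (1 - u) powr (p - 1) * (1 - u) powr (q - 1) * (1 - u) powr 2"
        by (simp only: powr_add)
      finally show ?thesis
        using that by simp
    qed
    moreover have "(1 / (1 - u)) powr - (p + q) = (1 - u) powr (p + q)"
      using that by (simp only: powr_minus) (simp add: powr_divide)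
    ultimately have "?f (?g u) * ?g' u =
        (u / (1 - u)) powr (p - 1) * ((1 - u) powr (p - 1) * (1 - u) powr (q - 1))"
      using that unfolding * by simp
    then show ?thesis
      using that by (simp add: powr_divide)
  qed
  have int: "set_integrable lborel {0<..<1} ?h"
    by (rule set_integrable_subset[OF integrable_Beta[OF assms]]) auto
  have deriv: "DERIV ?g x :> ?g' x" if "ereal 0 < ereal x" "ereal x < ereal 1" for x
    using that by (auto intro!: derivative_eq_intros simp: field_simps power2_eq_square)
  have cont: "isCont ?f (?g x)" if "ereal 0 < ereal x" "ereal x < ereal 1" for x
    using that by (auto intro!: continuous_intros simp: add_pos_nonneg) (auto simp: field_simps)
  have cont': "isCont ?g' x" if "ereal 0 < ereal x" "ereal x < ereal 1" for x
    using that by (auto intro!: continuous_intros)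
  have lim0: "((ereal \<circ> ?g \<circ> real_of_ereal) \<longlongrightarrow> ereal 0) (at_right (ereal 0))"
    unfolding ereal_tendsto_simps by (auto intro!: tendsto_eq_intros)
  have lim1: "((ereal \<circ> ?g \<circ> real_of_ereal) \<longlongrightarrow> \<infinity>) (at_left (ereal 1))"
    unfolding ereal_tendsto_simps
    by (rule LIM_at_top_divide[where a=1]) (auto intro!: tendsto_eq_intros simp: eventually_at_filter)
  have int': "set_integrable lborel (einterval (ereal 0) (ereal 1)) (\<lambda>x. ?f (?g x) * ?g' x)"
    unfolding einterval_eq using int fg by (subst set_integrable_cong[OF refl refl fg]) auto
  have "ereal 0 < ereal 1" "\<And>x. 0 \<le> ?f (?g x)" "\<And>x. 0 \<le> ?g' x"
    by simp_all
  note sub = interval_integral_substitution_nonneg[OF this(1) deriv cont cont' this(2,3) lim0 lim1 int']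
  show ?int
    using sub(1) by simp
  have "(LINT t:{0<..}|lborel. ?f t) = (LBINT x=ereal 0..\<infinity>. ?f x)"
    by (simp add: interval_lebesgue_integral_def)
  also have "\<dots> = (LBINT x:{0<..<1}. ?f (?g x) * ?g' x)"
    using sub(2) by (simp add: interval_lebesgue_integral_def)
  also have "\<dots> = (LBINT x:{0<..<1}. ?h x)"
    using fg by (intro set_lebesgue_integral_cong) auto
  also have "\<dots> = (LBINT x=ereal 0..ereal 1. ?h x)"
    by (simp add: interval_lebesgue_integral_def)
  also have "\<dots> = (LBINT x:{0..1}. ?h x)"
    by (rule interval_integral_Icc) simp
  also have "\<dots> = Beta p q"
    using set_borel_integral_eq_integral(2)[OF integrable_Beta[OF assms]]
      integral_unique[OF has_integral_Beta_real[OF assms]] by simp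
  finally show ?eq .
qed

lemma Gamma_reflection_real:
  assumes "0 < \<beta>" "\<beta> < 1"
  shows "Gamma \<beta> * Gamma (1 - \<beta>) = pi / sin (pi * (\<beta>::real))"
proof -
  have "complex_of_real (Gamma \<beta> * Gamma (1 - \<beta>)) = complex_of_real (pi / sin (pi * \<beta>))"
    using Gamma_reflection_complex[of "of_real \<beta>"]
    by (simp flip: Gamma_complex_of_real sin_of_real)
  then show ?thesis
    by (simp only: of_real_eq_iff)
qed

lemma sin_pi_pos: "0 < \<beta> \<Longrightarrow> \<beta> < 1 \<Longrightarrow> sin (pi * \<beta>) > 0"
  by (rule sin_gt_zero) auto

lemma Beta_complement:
  assumes "0 < \<beta>" "\<beta> < 1"
  shows "Beta (1 - \<beta>) \<beta> = pi / sin (pi * \<beta>)"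
  using Gamma_reflection_real[OF assms] by (simp add: Beta_def Gamma_def mult.commute)

text \<open>Both sides obey the same recursion in \<open>k\<close>, and the reflection formula for
  Gamma settles the first value. So each coefficient after the first is, up to a common factor, a
  Beta integral on the half-line.\<close>

lemma binom_coeff_Suc_Beta:
  assumes \<beta>: "0 < \<beta>" "\<beta> < 1"
  shows "binom_coeff \<beta> (Suc k) = - (sin (pi * \<beta>) / pi * Beta (real k + 1 - \<beta>) (1 + \<beta>))"
proof (induction k)
  case 0
  have "\<beta> \<notin> \<int>\<^sub>\<le>\<^sub>0"
    using \<beta> by (auto elim!: nonpos_Ints_cases)
  then have "Beta (1 - \<beta>) (1 + \<beta>) = \<beta> * (pi / sin (pi * \<beta>))"
    using Beta_plus1_right[of \<beta> "1 - \<beta>"] Beta_complement[OF \<beta>] by (simp add: add.commute)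
  then show ?case
    using sin_pi_pos[OF \<beta>] by (simp add: binom_coeff_Suc)
next
  case (Suc k)
  have "real k + 1 - \<beta> \<notin> \<int>\<^sub>\<le>\<^sub>0"
    using \<beta> by (auto elim!: nonpos_Ints_cases)
  then have "(real k + 2) * Beta (real k + 1 - \<beta> + 1) (1 + \<beta>)
      = (real k + 1 - \<beta>) * Beta (real k + 1 - \<beta>) (1 + \<beta>)"
    using Beta_plus1_left[of "real k + 1 - \<beta>" "1 + \<beta>"] by (simp add: algebra_simps)
  then have *: "Beta (real k + 1 - \<beta> + 1) (1 + \<beta>)
      = (real k + 1 - \<beta>) * Beta (real k + 1 - \<beta>) (1 + \<beta>) / (real k + 2)"
    by (simp add: field_simps)
  have eq: "real (Suc k) + 1 - \<beta> = real k + 1 - \<beta> + 1"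
    by simp
  show ?case
    unfolding binom_coeff_Suc[of \<beta> "Suc k"] Suc eq * by (simp add: field_simps)
qed

text \<open>The coefficients of \<open>(1 - x) / (1 + t - t x)\<close>, which is \<open>F\<close>
  times the inverse of \<open>1 + t F\<close> when \<open>x\<close> stands for
  \<open>I - F\<close>.\<close>

definition res_coeff :: "real \<Rightarrow> nat \<Rightarrow> real"
  where "res_coeff t k = (case k of 0 \<Rightarrow> 1 / (1 + t) | Suc k \<Rightarrow> - (t ^ k / (1 + t) ^ (k + 2)))"

context near_identity
begin

text \<open>\<open>res t\<close> is the inverse of \<open>1 + t F\<close>, so that \<open>F (res t h)\<close> is the resolvent of the inverse
  of \<open>F\<close> at \<open>-t\<close>.\<close>

definition res :: "real \<Rightarrow> 'a \<Rightarrow> 'a"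
  where "res t = defect.series (\<lambda>k. t ^ k / (1 + t) ^ (k + 1))"

text \<open>A geometric series with ratio \<open>t / (1 + t)\<close>. That the sum is exactly 1
  gives \<open>res t\<close> norm at most 1.\<close>

lemma res_sums:
  fixes t :: real
  assumes "t \<ge> 0"
  shows "(\<lambda>k. \<bar>t ^ k / (1 + t) ^ (k + 1)\<bar>) sums 1"
proof -
  have "norm (t / (1 + t)) < 1"
    using assms by (simp add: field_simps)
  from sums_mult[OF geometric_sums[OF this], of "1 / (1 + t)"]
  have "(\<lambda>k. 1 / (1 + t) * (t / (1 + t)) ^ k) sums (1 / (1 + t) * (1 / (1 - t / (1 + t))))" .
  moreover have "1 / (1 + t) * (1 / (1 - t / (1 + t))) = 1"
    using assms by (simp add: field_simps)
  moreover have "1 / (1 + t) * (t / (1 + t)) ^ k = \<bar>t ^ k / (1 + t) ^ (k + 1)\<bar>" for k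
    using assms by (simp add: power_divide abs_mult)
  ultimately show ?thesis
    by simp
qed

lemma bounded_clinear_res: "t \<ge> 0 \<Longrightarrow> bounded_clinear (res t)"
  unfolding res_def by (rule defect.bounded_clinear_series[OF sums_summable[OF res_sums]])

lemma norm_res_le: "t \<ge> 0 \<Longrightarrow> norm (res t h) \<le> norm h"
  using defect.norm_series_le[OF sums_summable[OF res_sums], of t h] sums_unique[OF res_sums, of t]
  by (simp add: res_def)

lemma F_res_sums:
  assumes t: "t \<ge> 0"
  shows "(\<lambda>k. res_coeff t k *\<^sub>R ((\<lambda>x. x - F x) ^^ k) h) sums F (res t h)"
    and "(1 + t) *\<^sub>R res t h - t *\<^sub>R (res t h - F (res t h)) = h"
proof -
  let ?E = "\<lambda>x. x - F x" and ?r = "\<lambda>k. t ^ k / (1 + t) ^ (k + 1)"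
  have r: "(\<lambda>k. ?r k *\<^sub>R (?E ^^ k) h) sums res t h"
    unfolding res_def by (rule defect.series_sums[OF sums_summable[OF res_sums[OF t]]])
  have "(\<lambda>k. ?E (?r k *\<^sub>R (?E ^^ k) h)) sums (res t h - F (res t h))"
    using bounded_linear.sums[OF bounded_clinear_imp_bounded_linear[OF defect.clinear] r] .
  moreover have "?E (?r k *\<^sub>R (?E ^^ k) h) = ?r k *\<^sub>R (?E ^^ Suc k) h" for k
    by (simp add: bounded_clinear_scaleR[OF clinear] scaleR_diff_right)
  ultimately have E: "(\<lambda>k. ?r k *\<^sub>R (?E ^^ Suc k) h) sums (res t h - F (res t h))"
    by simp
  \<comment> \<open>Applying \<open>I - F\<close> raises each power by one, so the
    \<open>k\<close>-th power now carries the coefficient of index \<open>k - 1\<close>, and 0 for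
    \<open>k = 0\<close>.\<close>
  have shift: "(\<lambda>k. (case k of 0 \<Rightarrow> 0 | Suc j \<Rightarrow> ?r j) *\<^sub>R (?E ^^ k) h) sums (res t h - F (res t h))"
    using sums_Suc[of "\<lambda>k. (case k of 0 \<Rightarrow> 0 | Suc j \<Rightarrow> ?r j) *\<^sub>R (?E ^^ k) h"] E by simp
  have coeff: "?r k - (case k of 0 \<Rightarrow> 0 | Suc j \<Rightarrow> ?r j) = res_coeff t k" for k
  proof (cases k)
    case (Suc n)
    define D where "D = (1 + t) ^ (n + 2)"
    have "t ^ n / (1 + t) ^ (n + 1) = (1 + t) * t ^ n / ((1 + t) * (1 + t) ^ (n + 1))"
      using t by (intro mult_divide_mult_cancel_left[symmetric]) simp
    also have "\<dots> = t ^ n / D + t ^ (n + 1) / D"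
      by (simp add: D_def distrib_right add_divide_distrib)
    finally have "t ^ (n + 1) / D - t ^ n / (1 + t) ^ (n + 1) = - (t ^ n / D)"
      by linarith
    then show ?thesis
      by (simp add: Suc res_coeff_def D_def)
  qed (simp add: res_coeff_def)
  show "(\<lambda>k. res_coeff t k *\<^sub>R (?E ^^ k) h) sums F (res t h)"
    using sums_diff[OF r shift] unfolding scaleR_diff_left[symmetric] coeff by simp
  \<comment> \<open>The product of \<open>1 + t - t (I - F)\<close> with the series telescopes to
    its constant term.\<close>
  have tr: "(1 + t) * ?r k - t * (case k of 0 \<Rightarrow> 0 | Suc j \<Rightarrow> ?r j) = (if k = 0 then 1 else 0)" for k
  proof -
    have "(1 + t) * ?r k = t ^ k / (1 + t) ^ k" for k
      using t by simp
    then show ?thesis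
      using t by (cases k) simp_all
  qed
  have "(\<lambda>k. (if k = 0 then 1 else 0) *\<^sub>R (?E ^^ k) h) sums
      ((1 + t) *\<^sub>R res t h - t *\<^sub>R (res t h - F (res t h)))"
    using sums_diff[OF sums_scaleR_right[OF r, of "1 + t"] sums_scaleR_right[OF shift, of t]]
    by (simp only: scaleR_scaleR tr flip: scaleR_diff_left)
  then have "(\<lambda>k. if k = 0 then (?E ^^ k) h else 0) sums
      ((1 + t) *\<^sub>R res t h - t *\<^sub>R (res t h - F (res t h)))"
    by (rule sums_cong[THEN iffD1, rotated]) simp
  moreover have "(\<lambda>k. if k = 0 then (?E ^^ k) h else 0) sums h"
    using sums_single[of 0 "\<lambda>k. (?E ^^ k) h"] by simp
  ultimately show "(1 + t) *\<^sub>R res t h - t *\<^sub>R (res t h - F (res t h)) = h"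
    by (rule sums_unique2)
qed

lemma res_eq: "t \<ge> 0 \<Longrightarrow> res t h + t *\<^sub>R F (res t h) = h"
  using F_res_sums(2)[of t h] by (simp add: algebra_simps)

lemma F_res_commute:
  assumes "t \<ge> 0"
  shows "F (res t h) = res t (F h)"
  unfolding res_def
  by (rule series_intertwine)
    (use defect.contraction_axioms sums_summable[OF res_sums[OF assms]] in
      \<open>auto simp: clinear bounded_clinear_diff[OF clinear]\<close>)

text \<open>\<open>t F (res t h)\<close> is \<open>h - res t h\<close>, and both terms have norm at
  most that of \<open>h\<close>.\<close>

lemma norm_F_res_le:
  assumes "t > 0"
  shows "norm (F (res t h)) \<le> 2 / t * norm h"
proof -
  have "t *\<^sub>R F (res t h) = h - res t h"
    using res_eq[of t h] assms by (simp add: eq_diff_eq add.commute)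
  then have "t * norm (F (res t h)) = norm (h - res t h)"
    using assms by (metis abs_of_pos norm_scaleR)
  also have "\<dots> \<le> 2 * norm h"
    using norm_triangle_ineq4[of h "res t h"] norm_res_le[of t h] assms by simp
  finally show ?thesis
    using assms by (simp add: field_simps)
qed

end

text \<open>The constant coefficient is a Beta integral with parameters \<open>1 - \<beta>\<close>
  and \<open>\<beta>\<close>, the one of index \<open>j + 1\<close> is minus that with
  \<open>j + 1 - \<beta>\<close> and \<open>1 + \<beta>\<close>: exactly the Beta forms of the
  binomial coefficients.\<close>

lemma set_integral_res_coeff:
  assumes \<beta>: "0 < \<beta>" "\<beta> < 1"
  shows "set_integrable lborel {0<..} (\<lambda>t. t powr - \<beta> * res_coeff t k)" (is ?int)
    and "(LINT t:{0<..}|lborel. t powr - \<beta> * res_coeff t k)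
      = pi / sin (pi * \<beta>) * binom_coeff \<beta> k" (is ?eq)
proof -
  let ?f = "\<lambda>t. t powr - \<beta> * res_coeff t k"
  have "?int \<and> ?eq"
  proof (cases k)
    case 0
    let ?g = "\<lambda>t. t powr ((1 - \<beta>) - 1) * (1 + t) powr - ((1 - \<beta>) + \<beta>)"
    have eq: "?f t = ?g t" if "t \<in> {0<..}" for t
      using that by (simp add: 0 res_coeff_def powr_minus[of "1 + t"] inverse_eq_divide)
    have "set_integrable lborel {0<..} ?f \<longleftrightarrow> set_integrable lborel {0<..} ?g"
      using eq by (intro set_integrable_cong) auto
    moreover have "(LINT t:{0<..}|lborel. ?f t) = (LINT t:{0<..}|lborel. ?g t)"
      using eq by (intro set_lebesgue_integral_cong) auto
    ultimately show ?thesis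
      using set_integrable_Beta_half_line[of "1 - \<beta>" \<beta>] set_integral_Beta_half_line[of "1 - \<beta>" \<beta>] \<beta>
      by (simp add: 0 Beta_complement)
  next
    case (Suc j)
    let ?g = "\<lambda>t. t powr ((real j + 1 - \<beta>) - 1) * (1 + t) powr - ((real j + 1 - \<beta>) + (1 + \<beta>))"
    have eq: "?f t = - ?g t" if "t \<in> {0<..}" for t
    proof -
      have "t powr - \<beta> * t ^ j = t powr (real j - \<beta>)"
        using that by (simp add: powr_diff powr_realpow powr_minus field_simps)
      moreover have "(1 + t) powr - (real j + 2) = 1 / (1 + t) ^ (j + 2)"
      proof -
        have "(1 + t) powr real (j + 2) = (1 + t) ^ (j + 2)"
          using that by (intro powr_realpow) simp
        moreover have "real (j + 2) = real j + 2"
          by simp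
        ultimately show ?thesis
          by (simp only: powr_minus inverse_eq_divide)
      qed
      moreover have "(real j + 1 - \<beta>) - 1 = real j - \<beta>" "(real j + 1 - \<beta>) + (1 + \<beta>) = real j + 2"
        by simp_all
      ultimately show ?thesis
        by (simp only: Suc res_coeff_def nat.case) (simp add: mult.assoc[symmetric])
    qed
    have "set_integrable lborel {0<..} ?f \<longleftrightarrow> set_integrable lborel {0<..} (\<lambda>t. - ?g t)"
      using eq by (intro set_integrable_cong) auto
    moreover have "(LINT t:{0<..}|lborel. ?f t) = (LINT t:{0<..}|lborel. - ?g t)"
      using eq by (intro set_lebesgue_integral_cong) auto
    moreover have "set_integrable lborel {0<..} (\<lambda>t. - ?g t)"
      using set_integrable_Beta_half_line[of "real j + 1 - \<beta>" "1 + \<beta>"] \<beta>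
      by (simp add: set_integrable_def)
    moreover have "(LINT t:{0<..}|lborel. - ?g t) = - (LINT t:{0<..}|lborel. ?g t)"
      by (simp add: set_lebesgue_integral_def)
    ultimately show ?thesis
      using set_integral_Beta_half_line[of "real j + 1 - \<beta>" "1 + \<beta>"] \<beta> sin_pi_pos[OF \<beta>]
      by (simp add: Suc binom_coeff_Suc_Beta)
  qed
  then show ?int ?eq
    by auto
qed

text \<open>The expansion of \<open>F (res t h)\<close> is integrated term by term. Each coefficient
  keeps its sign as \<open>t\<close> varies, so the integral of its modulus is the modulus of its
  integral, a multiple of a binomial coefficient; these are absolutely summable.\<close>

lemma
  fixes F :: "'a::{complex_hilbert, second_countable_topology} \<Rightarrow> 'a"
  assumes F: "near_identity F" and \<beta>: "0 < \<beta>" "\<beta> < 1"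
  shows set_integrable_Balakrishnan:
      "set_integrable lborel {0<..} (\<lambda>t. t powr - \<beta> *\<^sub>R F (near_identity.res F t h))"
    and frac_pow_Balakrishnan:
      "frac_pow F \<beta> h = (sin (pi * \<beta>) / pi) *\<^sub>R
        (LINT t:{0<..}|lborel. t powr - \<beta> *\<^sub>R F (near_identity.res F t h))"
proof -
  interpret near_identity F by fact
  let ?E = "\<lambda>x. x - F x"
  define f where "f i t = indicator {0<..} t *\<^sub>R ((t powr - \<beta> * res_coeff t i) *\<^sub>R (?E ^^ i) h)" for i and t :: real
  have s_pos: "sin (pi * \<beta>) > 0"
    by (rule sin_pi_pos[OF \<beta>])
  have int_f: "integrable lborel (f i)" for i
  proof -
    have "integrable lborel (\<lambda>t. (indicator {0<..} t *\<^sub>R (t powr - \<beta> * res_coeff t i)) *\<^sub>R (?E ^^ i) h)"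
      using set_integral_res_coeff(1)[OF \<beta>, of i] unfolding set_integrable_def
      by (rule integrable_scaleR_left)
    then show ?thesis
      by (simp add: f_def[abs_def])
  qed
  have integral_f: "integral\<^sup>L lborel (f i) = (pi / sin (pi * \<beta>) * binom_coeff \<beta> i) *\<^sub>R (?E ^^ i) h" for i
  proof -
    have "integral\<^sup>L lborel (f i) =
        integral\<^sup>L lborel (\<lambda>t. (indicator {0<..} t *\<^sub>R (t powr - \<beta> * res_coeff t i)) *\<^sub>R (?E ^^ i) h)"
      by (simp add: f_def[abs_def])
    also have "\<dots> = integral\<^sup>L lborel (\<lambda>t. indicator {0<..} t *\<^sub>R (t powr - \<beta> * res_coeff t i)) *\<^sub>R (?E ^^ i) h"
      by (rule integral_scaleR_left) (use set_integral_res_coeff(1)[OF \<beta>, of i] in \<open>simp add: set_integrable_def\<close>)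
    finally show ?thesis
      using set_integral_res_coeff(2)[OF \<beta>, of i] by (simp add: set_lebesgue_integral_def)
  qed
  have integral_norm_f: "(LINT t|lborel. norm (f i t)) \<le> pi / sin (pi * \<beta>) * \<bar>binom_coeff \<beta> i\<bar> * norm h" for i
  proof -
    \<comment> \<open>\<open>\<sigma>\<close> is the sign of \<open>res_coeff t i\<close> for all
      \<open>t > 0\<close>, and it also turns the binomial coefficient into its modulus.\<close>
    define \<sigma> :: real where "\<sigma> = (if i = 0 then 1 else - 1)"
    have abs: "\<bar>t powr - \<beta> * res_coeff t i\<bar> = \<sigma> * (t powr - \<beta> * res_coeff t i)" if "t > 0" for t
      using that by (cases i) (simp_all add: \<sigma>_def res_coeff_def abs_mult)
    have "norm (f i t) = (\<sigma> * norm ((?E ^^ i) h)) * (indicator {0<..} t *\<^sub>R (t powr - \<beta> * res_coeff t i))" for t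
      by (cases "t > 0") (simp_all add: f_def abs)
    then have "(LINT t|lborel. norm (f i t)) = \<sigma> * norm ((?E ^^ i) h) * (pi / sin (pi * \<beta>) * binom_coeff \<beta> i)"
      using set_integral_res_coeff(2)[OF \<beta>, of i] by (simp add: set_lebesgue_integral_def)
    also have "\<dots> = pi / sin (pi * \<beta>) * (\<sigma> * binom_coeff \<beta> i) * norm ((?E ^^ i) h)"
      by simp
    also have "\<sigma> * binom_coeff \<beta> i = \<bar>binom_coeff \<beta> i\<bar>"
      using binom_coeff_nonpos[of \<beta> "i - 1"] \<beta> by (cases i) (simp_all add: \<sigma>_def)
    also have "pi / sin (pi * \<beta>) * \<bar>binom_coeff \<beta> i\<bar> * norm ((?E ^^ i) h)
        \<le> pi / sin (pi * \<beta>) * \<bar>binom_coeff \<beta> i\<bar> * norm h"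
      using s_pos by (intro mult_left_mono defect.norm_iter_le) simp
    finally show ?thesis .
  qed
  have sums: "(\<lambda>i. f i t) sums (indicator {0<..} t *\<^sub>R (t powr - \<beta> *\<^sub>R F (res t h)))" for t
  proof (cases "t > 0")
    case True
    then show ?thesis
      using sums_scaleR_right[OF F_res_sums(1)[of t h], of "t powr - \<beta>"] by (simp add: f_def)
  qed (simp add: f_def)
  have summable_res_coeff: "summable (\<lambda>i. \<bar>res_coeff t i\<bar>)" if "t > 0" for t
  proof -
    have "summable (\<lambda>i. 1 / (1 + t) * \<bar>t ^ i / (1 + t) ^ (i + 1)\<bar>)"
      using sums_summable[OF res_sums[of t]] that by (intro summable_mult) auto
    moreover have "1 / (1 + t) * \<bar>t ^ i / (1 + t) ^ (i + 1)\<bar> = \<bar>res_coeff t (Suc i)\<bar>" for i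
      using that by (simp add: res_coeff_def abs_mult)
    ultimately show ?thesis
      by (subst summable_Suc_iff[symmetric]) simp
  qed
  have AE: "AE t in lborel. summable (\<lambda>i. norm (f i t))"
  proof (rule AE_I2)
    fix t :: real
    show "summable (\<lambda>i. norm (f i t))"
    proof (cases "t > 0")
      case True
      have "summable (\<lambda>i. t powr - \<beta> * (\<bar>res_coeff t i\<bar> * norm h))"
        by (intro summable_mult summable_mult2 summable_res_coeff True)
      then show ?thesis
        by (rule summable_comparison_test'[where N=0])
          (use True in \<open>simp add: f_def abs_mult mult.assoc mult_left_mono defect.norm_iter_le\<close>)
    qed (simp add: f_def)
  qed
  have "summable (\<lambda>i. pi / sin (pi * \<beta>) * \<bar>binom_coeff \<beta> i\<bar> * norm h)"
    using \<beta> by (intro summable_mult2 summable_mult summable_binom_coeff) auto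
  then have summable_norm: "summable (\<lambda>i. LINT t|lborel. norm (f i t))"
    by (rule summable_comparison_test'[where N=0]) (use integral_norm_f in simp)
  have suminf_f: "(\<Sum>i. f i t) = indicator {0<..} t *\<^sub>R (t powr - \<beta> *\<^sub>R F (res t h))" for t
    using sums_unique[OF sums] by simp
  show "set_integrable lborel {0<..} (\<lambda>t. t powr - \<beta> *\<^sub>R F (res t h))"
    using integrable_suminf[OF int_f AE summable_norm] by (simp add: suminf_f set_integrable_def)
  have "(\<lambda>i. (pi / sin (pi * \<beta>)) *\<^sub>R (binom_coeff \<beta> i *\<^sub>R (?E ^^ i) h)) sums
      (LINT t:{0<..}|lborel. t powr - \<beta> *\<^sub>R F (res t h))"
    using sums_integral[OF int_f AE summable_norm]
    by (simp add: suminf_f set_lebesgue_integral_def integral_f)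
  moreover have "(\<lambda>i. (pi / sin (pi * \<beta>)) *\<^sub>R (binom_coeff \<beta> i *\<^sub>R (?E ^^ i) h)) sums
      ((pi / sin (pi * \<beta>)) *\<^sub>R frac_pow F \<beta> h)"
    unfolding frac_pow_series
    by (intro sums_scaleR_right defect.series_sums summable_binom_coeff) (use \<beta> in auto)
  ultimately have "(LINT t:{0<..}|lborel. t powr - \<beta> *\<^sub>R F (res t h)) = (pi / sin (pi * \<beta>)) *\<^sub>R frac_pow F \<beta> h"
    by (rule sums_unique2)
  then show "frac_pow F \<beta> h = (sin (pi * \<beta>) / pi) *\<^sub>R
        (LINT t:{0<..}|lborel. t powr - \<beta> *\<^sub>R F (res t h))"
    using s_pos by simp
qed

text \<open>\<open>A\<close>, its adjoint, \<open>I + A A*\<close> and \<Lambda> all enter in this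
  form, as the inverse of a total operator whose range is exactly the domain.\<close>

definition is_inverse_op :: "('a \<Rightarrow> 'b) \<Rightarrow> ('b, 'a) unbounded_op \<Rightarrow> bool"
  where "is_inverse_op F T \<longleftrightarrow> opdom T = range F \<and> (\<forall>u. app T (F u) = u)"

lemma is_inverse_op_inj: "is_inverse_op F T \<Longrightarrow> inj F"
  by (metis injI is_inverse_op_def)

context near_identity
begin

text \<open>On \<open>x = F u\<close> the operator \<open>T + t\<close> acts as
  \<open>u \<mapsto> u + t F u\<close>, which \<open>res t\<close> inverts; \<open>t = 0\<close>
  gives the inverse of \<open>T\<close> itself.\<close>

lemma resolvent_inverse_op:
  assumes T: "is_inverse_op F T" and t: "t \<ge> 0"
  shows "resolvent T (- complex_of_real t) h = F (res t h)"
  unfolding resolvent_def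
proof (rule inv_into_f_eq)
  have *: "app T (F u) - - complex_of_real t *\<^sub>C F u = u + t *\<^sub>R F u" for u
    using T scaleC_of_real[of "- t" "F u"] by (simp add: is_inverse_op_def)
  show "inj_on (\<lambda>x. app T x - - complex_of_real t *\<^sub>C x) (opdom T)"
  proof (rule inj_onI)
    fix x y assume xy: "x \<in> opdom T" "y \<in> opdom T"
      "app T x - - complex_of_real t *\<^sub>C x = app T y - - complex_of_real t *\<^sub>C y"
    obtain u v where uv: "x = F u" "y = F v"
      using xy(1,2) T by (auto simp: is_inverse_op_def)
    have w: "res t (w + t *\<^sub>R F w) = w" for w
      using res_eq[OF t, of w]
      by (simp add: bounded_clinear_add[OF bounded_clinear_res[OF t]]
          bounded_clinear_scaleR[OF bounded_clinear_res[OF t]] F_res_commute[OF t])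
    have "u + t *\<^sub>R F u = v + t *\<^sub>R F v"
      using xy(3) unfolding uv * .
    then have "u = v"
      using w by metis
    then show "x = y"
      using uv by simp
  qed
  show "F (res t h) \<in> opdom T"
    using T by (simp add: is_inverse_op_def)
  show "app T (F (res t h)) - - complex_of_real t *\<^sub>C F (res t h) = h"
    using res_eq[OF t] * by simp
qed

end

lemma neg_power_inverse_op:
  fixes F :: "'a::{complex_hilbert, second_countable_topology} \<Rightarrow> 'a"
  assumes F: "near_identity F" and T: "is_inverse_op F T" and \<tau>: "0 \<le> \<tau>" "\<tau> \<le> 1"
  shows "neg_power T \<tau> = frac_pow F \<tau>"
proof -
  interpret near_identity F by fact
  consider "\<tau> = 0" | "0 < \<tau>" "\<tau> < 1" | "\<tau> = 1"
    using \<tau> by linarith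
  then show ?thesis
  proof cases
    case 1
    then show ?thesis
      by (auto simp: fun_eq_iff neg_power_def balakrishnan_def frac_pow_0)
  next
    case 2
    then have "frac \<tau> = \<tau>" "\<lfloor>\<tau>\<rfloor> = 0"
      by (auto simp: frac_eq floor_eq_iff)
    moreover have "(LINT t:{0<..}|lborel. (t powr - \<tau>) *\<^sub>R resolvent T (- complex_of_real t) h)
        = (LINT t:{0<..}|lborel. t powr - \<tau> *\<^sub>R F (res t h))" for h
      by (rule set_lebesgue_integral_cong) (auto simp: resolvent_inverse_op[OF T])
    ultimately show ?thesis
      using 2 by (simp add: fun_eq_iff neg_power_def balakrishnan_def frac_pow_Balakrishnan[OF F 2])
  next
    case 3
    \<comment> \<open>Floor 1 and fractional part 0 leave a single application of
      \<open>resolvent T 0\<close>, that is \<open>F (res 0 h)\<close>.\<close>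
    have "res 0 h = h" for h
      using res_eq[of 0 h] by simp
    then show ?thesis
      using 3 resolvent_inverse_op[OF T, of 0]
      by (auto simp: fun_eq_iff neg_power_def balakrishnan_def frac_pow_1)
  qed
qed

context near_identity
begin

text \<open>The power \<open>1 - \<tau>\<close> completes the power \<open>\<tau>\<close> to
  \<open>F\<close>.\<close>

lemma inj_frac_pow:
  assumes "inj F" "0 \<le> \<tau>" "\<tau> \<le> 1"
  shows "inj (frac_pow F \<tau>)"
proof (rule injI)
  fix x y assume "frac_pow F \<tau> x = frac_pow F \<tau> y"
  then have "frac_pow F (1 - \<tau>) (frac_pow F \<tau> x) = frac_pow F (1 - \<tau>) (frac_pow F \<tau> y)"
    by simp
  then show "x = y"
    using assms by (simp add: frac_pow_add frac_pow_1 inj_eq)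
qed

end

lemma
  fixes F :: "'a::{complex_hilbert, second_countable_topology} \<Rightarrow> 'a"
  assumes F: "near_identity F" and L: "is_inverse_op F L" and \<tau>: "0 \<le> \<tau>" "\<tau> \<le> 1"
  shows is_inverse_op_op_power: "is_inverse_op (frac_pow F \<tau>) (op_power L \<tau>)"
    and scale_space_eq: "scale_space L \<tau> = range (frac_pow F \<tau>)"
    and scale_norm_eq: "scale_norm L \<tau> (frac_pow F \<tau> z) = norm z"
    and scale_norm_neg_eq: "scale_norm L (- \<tau>) x = norm (frac_pow F \<tau> x)"
proof -
  interpret near_identity F by fact
  note inj = inj_frac_pow[OF is_inverse_op_inj[OF L] \<tau>]
  show *: "is_inverse_op (frac_pow F \<tau>) (op_power L \<tau>)"
  proof (cases "\<tau> = 0")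
    case True
    \<comment> \<open>At exponent 0 \<open>op_power\<close> takes its branch for nonpositive
      exponents, whose domain is everything.\<close>
    then show ?thesis
      using neg_power_inverse_op[OF F L \<tau>] frac_pow_0
      by (simp add: op_power_def is_inverse_op_def surj_def)
  next
    case False
    then show ?thesis
      using \<tau> neg_power_inverse_op[OF F L \<tau>] inj by (simp add: op_power_def is_inverse_op_def)
  qed
  show "scale_space L \<tau> = range (frac_pow F \<tau>)" "scale_norm L \<tau> (frac_pow F \<tau> z) = norm z"
    using * by (simp_all add: scale_space_def scale_norm_def is_inverse_op_def)
  show "scale_norm L (- \<tau>) x = norm (frac_pow F \<tau> x)"
    using \<tau> neg_power_inverse_op[OF F L \<tau>] by (simp add: scale_norm_def op_power_def)
qed

section \<open>Norm estimates for fractional powers from bounds on the resolvent\<close>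

lemma set_integral_split_power:
  fixes \<beta> b T :: real
  assumes "\<beta> < 1" "1 < \<beta> + b" "0 < T"
  defines "g \<equiv> \<lambda>t. t powr - \<beta> * (if t \<le> T then 1 else (T / t) powr b)"
  shows "set_integrable lborel {0<..} g"
    and "(LINT t:{0<..}|lborel. g t) = (1 / (1 - \<beta>) + 1 / (\<beta> + b - 1)) * T powr (1 - \<beta>)"
proof -
  have 1: "((\<lambda>t. t powr - \<beta>) has_integral (T powr (1 - \<beta>) / (1 - \<beta>))) {0..T}"
    using has_integral_powr_from_0[of "- \<beta>" T] assms by (simp add: add.commute)
  have 2: "((\<lambda>t. T powr b * t powr - (\<beta> + b)) has_integral T powr b * (T powr (1 - \<beta> - b) / (\<beta> + b - 1))) {T..}"
    using has_integral_mult_right[OF has_integral_powr_to_inf[of "- (\<beta> + b)" T], of "T powr b"] assms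
    by (simp add: minus_divide_right algebra_simps)
  have "(g has_integral T powr (1 - \<beta>) / (1 - \<beta>)) {0..T}"
    using 1 by (rule has_integral_eq[rotated]) (simp add: g_def)
  moreover have "(g has_integral T powr b * (T powr (1 - \<beta> - b) / (\<beta> + b - 1))) {T..}"
  proof (rule has_integral_eq[OF _ 2])
    fix t assume "t \<in> {T..}"
    then show "T powr b * t powr - (\<beta> + b) = g t"
      using \<open>0 < T\<close> powr_add[of t "- \<beta>" "- b"]
      by (auto simp: g_def powr_divide powr_minus field_simps)
  qed
  ultimately have "(g has_integral (T powr (1 - \<beta>) / (1 - \<beta>) + T powr b * (T powr (1 - \<beta> - b) / (\<beta> + b - 1))))
      ({0..T} \<union> {T..})"
    by (rule has_integral_Un) (auto intro: negligible_subset[of "{T}"])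
  moreover have "T powr b * (T powr (1 - \<beta> - b) / (\<beta> + b - 1)) = T powr (1 - \<beta>) / (\<beta> + b - 1)"
    using powr_add[of T b "1 - \<beta> - b"] by simp
  moreover have "T powr (1 - \<beta>) / (1 - \<beta>) + T powr (1 - \<beta>) / (\<beta> + b - 1)
      = (1 / (1 - \<beta>) + 1 / (\<beta> + b - 1)) * T powr (1 - \<beta>)"
    by (simp add: distrib_right)
  moreover have "{0..T} \<union> {T..} = {0..}"
    using \<open>0 < T\<close> by auto
  ultimately have "(g has_integral (1 / (1 - \<beta>) + 1 / (\<beta> + b - 1)) * T powr (1 - \<beta>)) {0..}"
    by (simp only:)
  then have hi: "(g has_integral (1 / (1 - \<beta>) + 1 / (\<beta> + b - 1)) * T powr (1 - \<beta>)) {0<..}"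
    by (rule has_integral_spike_set_eq[THEN iffD1, rotated 2]) (auto intro: negligible_subset[of "{0}"])
  have "g absolutely_integrable_on {0<..}"
    using hi by (intro nonnegative_absolutely_integrable_1) (auto simp: g_def)
  moreover have "(\<lambda>t. indicator {0<..} t *\<^sub>R g t) \<in> borel_measurable lborel"
    unfolding g_def by measurable
  ultimately show "set_integrable lborel {0<..} g"
    unfolding set_integrable_def by (simp add: integrable_completion)
  from set_borel_integral_eq_integral(2)[OF this]
  show "(LINT t:{0<..}|lborel. g t) = (1 / (1 - \<beta>) + 1 / (\<beta> + b - 1)) * T powr (1 - \<beta>)"
    using integral_unique[OF hi] by simp
qed

text \<open>\<open>X\<close> is taken under Balakrishnan's integral, whose prefactor has modulus at
  most 1. The majorant is constant up to \<open>T\<close> and decays with exponent \<open>-b\<close>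
  beyond, so the integral converges at 0 by \<open>\<beta> < 1\<close> and at infinity by
  \<open>1 < \<beta> + b\<close>.\<close>

lemma norm_frac_pow_le:
  fixes F :: "'a::{complex_hilbert, second_countable_topology} \<Rightarrow> 'a"
    and X :: "'a \<Rightarrow> 'b::{complex_hilbert, second_countable_topology}"
  assumes F: "near_identity F" and \<beta>: "0 < \<beta>" "\<beta> < 1" and b: "1 < \<beta> + b" and T: "0 < T"
    and X: "bounded_clinear X"
    and le: "\<And>t. 0 < t \<Longrightarrow> norm (X (F (near_identity.res F t h))) \<le> m * (if t \<le> T then 1 else (T / t) powr b)"
  shows "norm (X (frac_pow F \<beta> h)) \<le> (1 / (1 - \<beta>) + 1 / (\<beta> + b - 1)) * m * T powr (1 - \<beta>)"
proof -
  interpret near_identity F by fact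
  let ?g = "\<lambda>t. t powr - \<beta> * (if t \<le> T then 1 else (T / t) powr b)"
  let ?f = "\<lambda>t. indicator {0<..} t *\<^sub>R (t powr - \<beta> *\<^sub>R F (res t h))"
  have int_f: "integrable lborel ?f"
    using set_integrable_Balakrishnan[OF F \<beta>, of h] by (simp add: set_integrable_def)
  note Xlin = bounded_clinear_imp_bounded_linear[OF X]
  have int_g: "integrable lborel (\<lambda>t. m * (indicator {0<..} t *\<^sub>R ?g t))"
    using set_integral_split_power(1)[OF \<beta>(2) b T] by (simp add: set_integrable_def)
  have "X (frac_pow F \<beta> h) = (sin (pi * \<beta>) / pi) *\<^sub>R (LINT t|lborel. X (?f t))"
    unfolding frac_pow_Balakrishnan[OF F \<beta>] set_lebesgue_integral_def
    using integral_bounded_linear[OF Xlin int_f] by (simp add: bounded_clinear_scaleR[OF X])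
  moreover have "\<bar>sin (pi * \<beta>) / pi\<bar> \<le> 1"
  proof -
    have "\<bar>sin (pi * \<beta>)\<bar> \<le> pi"
      using abs_sin_le_one[of "pi * \<beta>"] pi_ge_two by linarith
    then show ?thesis
      by (simp add: abs_divide)
  qed
  ultimately have "norm (X (frac_pow F \<beta> h)) \<le> norm (LINT t|lborel. X (?f t))"
    using mult_right_mono[of "\<bar>sin (pi * \<beta>) / pi\<bar>" 1 "norm (LINT t|lborel. X (?f t))"] by simp
  also have "\<dots> \<le> (LINT t|lborel. m * (indicator {0<..} t *\<^sub>R ?g t))"
  proof (rule Bochner_Integration.integral_norm_bound_integral)
    show "integrable lborel (\<lambda>t. X (?f t))"
      by (rule integrable_bounded_linear[OF Xlin int_f])
    show "norm (X (?f t)) \<le> m * (indicator {0<..} t *\<^sub>R ?g t)" for t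
    proof (cases "t > 0")
      case True
      have "norm (X (?f t)) = t powr - \<beta> * norm (X (F (res t h)))"
        using True by (simp add: bounded_clinear_scaleR[OF X])
      also have "\<dots> \<le> t powr - \<beta> * (m * (if t \<le> T then 1 else (T / t) powr b))"
        by (rule mult_left_mono[OF le[OF True]]) simp
      finally show ?thesis
        using True by (simp add: mult.left_commute)
    qed (simp add: bounded_clinear_simps[OF X])
  qed (rule int_g)
  also have "\<dots> = m * (LINT t:{0<..}|lborel. ?g t)"
    unfolding set_lebesgue_integral_def by (rule integral_mult_right_zero)
  finally show ?thesis
    using set_integral_split_power(2)[OF \<beta>(2) b T] by (simp add: mult_ac)
qed

text \<open>\<open>F (res t q)\<close> is bounded by \<open>m2\<close> through \<open>F q\<close>
  and by \<open>2 m1 / t\<close> through \<open>q\<close>; the two bounds meet at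
  \<open>T = 2 m1 / m2\<close>. Majorants replace the norms so that they can be taken
  positive.\<close>

lemma moment_inequality:
  fixes F :: "'a::{complex_hilbert, second_countable_topology} \<Rightarrow> 'a"
  assumes F: "near_identity F" and \<beta>: "0 < \<beta>" "\<beta> \<le> 1"
  obtains K where "K > 0"
    "\<And>q m1 m2. norm q \<le> m1 \<Longrightarrow> norm (F q) \<le> m2 \<Longrightarrow> 0 < m1 \<Longrightarrow> 0 < m2 \<Longrightarrow>
      norm (frac_pow F \<beta> q) \<le> K * (m1 powr (1 - \<beta>) * m2 powr \<beta>)"
proof (cases "\<beta> = 1")
  case True
  then show ?thesis
    using that[of 1] near_identity.frac_pow_1[OF F] by auto
next
  case False
  interpret near_identity F by fact
  have \<beta>': "\<beta> < 1"
    using \<beta> False by simp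
  define c where "c = (1 / (1 - \<beta>) + 1 / \<beta>) * 2 powr (1 - \<beta>)"
  have "norm (frac_pow F \<beta> q) \<le> c * (m1 powr (1 - \<beta>) * m2 powr \<beta>)"
    if m: "norm q \<le> m1" "norm (F q) \<le> m2" "0 < m1" "0 < m2" for q m1 m2
  proof -
    have "norm (frac_pow F \<beta> q) \<le> (1 / (1 - \<beta>) + 1 / (\<beta> + 1 - 1)) * m2 * (2 * m1 / m2) powr (1 - \<beta>)"
    proof (rule norm_frac_pow_le[OF F \<beta>(1) \<beta>' _ _ bounded_clinear_ident])
      fix t :: real assume t: "0 < t"
      have "norm (F (res t q)) \<le> m2"
        using norm_res_le[of t "F q"] t m(2) by (simp add: F_res_commute)
      moreover have "norm (F (res t q)) \<le> 2 / t * m1"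
        using norm_F_res_le[OF t, of q] mult_left_mono[OF m(1), of "2 / t"] t by simp
      ultimately show "norm (F (res t q)) \<le> m2 * (if t \<le> 2 * m1 / m2 then 1 else (2 * m1 / m2 / t) powr 1)"
        using t m by (simp add: powr_one)
    qed (use m \<beta> in auto)
    moreover have "m2 * (2 * m1 / m2) powr (1 - \<beta>) = 2 powr (1 - \<beta>) * (m1 powr (1 - \<beta>) * m2 powr \<beta>)"
      using m by (simp add: powr_divide powr_mult powr_diff)
    ultimately show ?thesis
      by (simp add: c_def mult.assoc)
  qed
  moreover have "c > 0"
    using \<beta> \<beta>' unfolding c_def by (intro mult_pos_pos add_pos_pos) auto
  ultimately show ?thesis
    using that by blast
qed

section \<open>The scales of an operator with bounded inverse\<close>

text \<open>An operator bounded from below has closed range, and a trivial orthogonal complement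
  makes the range dense.\<close>

lemma adjoint_surjI:
  fixes T :: "'a::complex_hilbert \<Rightarrow> 'b::complex_hilbert"
  assumes T: "bounded_clinear T" and below: "\<And>x. norm x \<le> c * norm (T x)"
    and adj: "\<And>y. (\<And>x. cinner (T x) y = 0) \<Longrightarrow> y = 0"
  shows "surj T"
proof -
  have "\<exists>x. T x = y" for y
  proof -
    have "y \<in> closure (range T)"
      using dense_range_if_adjoint_inj[OF T adj] by simp
    then obtain s where s: "(\<lambda>n. T (s n)) \<longlonglongrightarrow> y"
      unfolding closure_range_sequential by blast
    have "Cauchy s"
    proof (rule metric_CauchyI)
      fix e :: real assume "e > 0"
      define C where "C = max c 1"
      have C: "C > 0" "norm x \<le> C * norm (T x)" for x
        using below[of x] mult_right_mono[of c C "norm (T x)"] by (auto simp: C_def)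
      obtain N where N: "dist (T (s m)) (T (s n)) < e / C" if "m \<ge> N" "n \<ge> N" for m n
        using metric_CauchyD[OF LIMSEQ_imp_Cauchy[OF s], of "e / C"] \<open>e > 0\<close> C(1) by auto
      have "dist (s m) (s n) < e" if "m \<ge> N" "n \<ge> N" for m n
      proof -
        have "dist (s m) (s n) \<le> C * dist (T (s m)) (T (s n))"
          using C(2)[of "s m - s n"] by (simp add: dist_norm bounded_clinear_diff[OF T])
        also have "\<dots> < e"
          using N[OF that] C(1) by (simp add: field_simps)
        finally show ?thesis .
      qed
      then show "\<exists>N. \<forall>m\<ge>N. \<forall>n\<ge>N. dist (s m) (s n) < e"
        by blast
    qed
    then obtain x where "s \<longlonglongrightarrow> x"
      using Cauchy_convergent convergent_def by blast
    then have "T x = y"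
      using LIMSEQ_unique[OF bounded_clinear_tendsto[OF T] s] by blast
    then show ?thesis ..
  qed
  then show ?thesis
    by (metis surjI)
qed

lemma bounded_clinear_inv:
  assumes T: "bounded_clinear T" "surj T" and below: "\<And>x. norm x \<le> c * norm (T x)"
  shows "bounded_clinear (inv T)" "inv T (T x) = x" "T (inv T y) = y"
proof -
  have inj: "inj T"
    by (rule bounded_clinear_injI[OF T(1)]) (metis below mult_zero_right norm_le_zero_iff norm_zero)
  show 1: "inv T (T x) = x" for x
    by (rule inv_f_f[OF inj])
  show 2: "T (inv T y) = y" for y
    by (rule surj_f_inv_f[OF T(2)])
  show "bounded_clinear (inv T)"
  proof (rule bounded_clinearI[where K=c])
    show "inv T (x + y) = inv T x + inv T y" for x y
      by (rule inv_f_eq[OF inj]) (simp add: bounded_clinear_simps[OF T(1)] 2)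
    show "inv T (a *\<^sub>C x) = a *\<^sub>C inv T x" for a x
      by (rule inv_f_eq[OF inj]) (simp add: bounded_clinear_simps[OF T(1)] 2)
    show "norm (inv T x) \<le> c * norm x" for x
      using below[of "inv T x"] by (simp add: 2)
  qed
qed

text \<open>In terms of \<open>S\<close> and its adjoint \<open>S'\<close>, which play the role of the inverses of \<open>A\<close> and \<open>A*\<close>,
  \<open>G\<close> is the inverse of \<open>I + A A*\<close> and \<open>F\<close> that of its square root.  Exchanging \<open>S\<close> and \<open>S'\<close> gives
  the corresponding operators for \<open>I + A* A\<close>.\<close>

locale adjoint_pair =
  fixes S S' :: "'h::{complex_hilbert, second_countable_topology} \<Rightarrow> 'h"
  assumes S: "bounded_clinear S" and S': "bounded_clinear S'"
    and adj: "cinner (S x) y = cinner x (S' y)"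
    and S_0: "S x = 0 \<Longrightarrow> x = 0" and S'_0: "S' x = 0 \<Longrightarrow> x = 0"
begin

lemma adj': "cinner (S' x) y = cinner x (S y)"
  by (rule adjoint_sym[OF adj])

lemma inj_S: "inj S"
  by (rule bounded_clinear_injI[OF S S_0])

definition gram :: "'h \<Rightarrow> 'h"
  where "gram x = x + S' (S x)"

definition Th :: "'h \<Rightarrow> 'h"
  where "Th = inv gram"

text \<open>\<open>P = S' S\<close> is the inverse of \<open>A A*\<close>, so the inverse of
  \<open>I + A A*\<close> is \<open>P (I + P)\<inverse> = I - (I + P)\<inverse>\<close>, with
  \<open>Th\<close> for the last inverse. In this form \<open>I - G\<close> is a contraction because
  \<open>Th\<close> is.\<close>

definition G :: "'h \<Rightarrow> 'h"
  where "G x = x - Th x"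

definition F :: "'h \<Rightarrow> 'h"
  where "F = frac_pow G (1 / 2)"

text \<open>\<open>Q \<tau>\<close> is \<Lambda> to the power \<open>-\<tau>\<close>, and
  \<open>dual.Q \<tau>\<close> the same for \<open>Lam_star\<close>. A vector
  \<open>Q \<tau> h\<close> has scale norm \<open>norm h\<close>, so that \<open>h\<close> serves as
  its coordinate.\<close>

definition Q :: "real \<Rightarrow> 'h \<Rightarrow> 'h"
  where "Q = frac_pow F"

lemma bounded_clinear_gram: "bounded_clinear gram"
  unfolding gram_def[abs_def]
  by (rule bounded_clinear_plus[OF bounded_clinear_ident bounded_clinear_compose[OF S' S]])

lemma cinner_gram: "cinner (gram x) x = of_real ((norm x)\<^sup>2 + (norm (S x))\<^sup>2)"
  by (simp add: gram_def cinner_add_left adj' cinner_self)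

lemma gram_adj: "cinner (gram x) y = cinner x (gram y)"
  by (simp add: gram_def cinner_add_left cinner_add_right adj adj')

lemma norm_le_gram: "norm x \<le> 1 * norm (gram x)"
proof (cases "x = 0")
  case False
  have "(norm x)\<^sup>2 \<le> (norm x)\<^sup>2 + (norm (S x))\<^sup>2"
    by simp
  also have "\<dots> = cmod (cinner (gram x) x)"
    unfolding cinner_gram by (simp del: of_real_add of_real_power)
  also have "\<dots> \<le> norm (gram x) * norm x"
    by (rule cinner_Cauchy_Schwarz)
  finally show ?thesis
    using False by (simp add: power2_eq_square)
qed (simp add: bounded_clinear_zero[OF bounded_clinear_gram])

lemma surj_gram: "surj gram"
proof (rule adjoint_surjI[OF bounded_clinear_gram norm_le_gram])
  fix y assume "\<And>x. cinner (gram x) y = 0"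
  then have "cinner (gram y) (gram y) = 0"
    using gram_adj[of "gram y" y] by simp
  then have "gram y = 0"
    by simp
  then show "y = 0"
    using norm_le_gram[of y] by simp
qed

lemmas bounded_clinear_Th = bounded_clinear_inv(1)[OF bounded_clinear_gram surj_gram norm_le_gram, folded Th_def]
lemmas Th_gram = bounded_clinear_inv(2)[OF bounded_clinear_gram surj_gram norm_le_gram, folded Th_def]
lemmas gram_Th = bounded_clinear_inv(3)[OF bounded_clinear_gram surj_gram norm_le_gram, folded Th_def]

lemma norm_Th_le: "norm (Th x) \<le> norm x"
  using norm_le_gram[of "Th x"] by (simp add: gram_Th)

lemma Th_adj: "cinner (Th x) y = cinner x (Th y)"
  using gram_adj[of "Th x" "Th y"] by (simp add: gram_Th)

lemma near_identity_G: "near_identity G"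
proof
  show "bounded_clinear G"
    unfolding G_def[abs_def] by (rule bounded_clinear_sub[OF bounded_clinear_ident bounded_clinear_Th])
  show "norm (x - G x) \<le> norm x" for x
    by (simp add: G_def norm_Th_le)
qed

lemma G_eq: "G x = S' (S (Th x))"
proof -
  have "x = Th x + S' (S (Th x))"
    using gram_Th[of x] unfolding gram_def by (rule sym)
  then show ?thesis
    unfolding G_def by (simp add: diff_eq_eq add.commute)
qed

lemma inj_G: "inj G"
proof (rule bounded_clinear_injI)
  show "bounded_clinear G"
    using near_identity_G by (simp add: near_identity_def)
  show "x = 0" if "G x = 0" for x
  proof -
    have "S (Th x) = 0"
      using that by (simp add: S'_0 G_eq)
    then have "Th x = 0"
      by (rule S_0)
    then show ?thesis
      using gram_Th[of x] bounded_clinear_zero[OF bounded_clinear_gram] by simp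
  qed
qed

lemma near_identity_F: "near_identity F"
  unfolding F_def by (rule near_identity.near_identity_frac_pow[OF near_identity_G]) auto

lemma F_F: "F (F x) = G x"
  using near_identity.frac_pow_add[OF near_identity_G, of "1/2" "1/2"] near_identity.frac_pow_1[OF near_identity_G]
  by (simp add: F_def)

lemma inj_F: "inj F"
  unfolding F_def by (rule near_identity.inj_frac_pow[OF near_identity_G inj_G]) auto

lemma bounded_clinear_F: "bounded_clinear F"
  using near_identity_F by (simp add: near_identity_def)

lemma F_0: "F x = 0 \<Longrightarrow> x = 0"
  using inj_F bounded_clinear_zero[OF bounded_clinear_F] by (metis injD)

lemma bounded_clinear_Q: "0 \<le> \<tau> \<Longrightarrow> \<tau> \<le> 1 \<Longrightarrow> bounded_clinear (Q \<tau>)"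
  unfolding Q_def by (rule near_identity.bounded_clinear_frac_pow[OF near_identity_F])

lemma inj_Q: "0 \<le> \<tau> \<Longrightarrow> \<tau> \<le> 1 \<Longrightarrow> inj (Q \<tau>)"
  unfolding Q_def by (rule near_identity.inj_frac_pow[OF near_identity_F inj_F])

lemma Q_eq_0: "0 \<le> \<tau> \<Longrightarrow> \<tau> \<le> 1 \<Longrightarrow> Q \<tau> x = 0 \<Longrightarrow> x = 0"
  using inj_Q bounded_clinear_zero[OF bounded_clinear_Q] by (metis injD)

lemma Q_add: "0 \<le> \<sigma> \<Longrightarrow> 0 \<le> \<tau> \<Longrightarrow> \<sigma> + \<tau> \<le> 1 \<Longrightarrow> Q \<sigma> (Q \<tau> h) = Q (\<sigma> + \<tau>) h"
  unfolding Q_def by (rule near_identity.frac_pow_add[OF near_identity_F])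

lemma Q_1: "Q 1 h = F h"
  unfolding Q_def by (rule near_identity.frac_pow_1[OF near_identity_F])

lemma Q_0: "Q 0 h = h"
  unfolding Q_def by (rule near_identity.frac_pow_0[OF near_identity_F])

lemma frac_pow_adj:
  assumes N: "near_identity N" and N_adj: "\<And>x y. cinner (N x) y = cinner x (N y)"
    and \<tau>: "0 \<le> \<tau>" "\<tau> \<le> 1"
  shows "cinner (frac_pow N \<tau> x) y = cinner x (frac_pow N \<tau> (y::'h))"
proof -
  interpret near_identity N by fact
  show ?thesis
    unfolding frac_pow_series
    by (rule series_adjoint[OF defect.contraction_axioms _ summable_binom_coeff[OF \<tau>]])
      (simp add: cinner_simps N_adj)
qed

lemma F_adj: "cinner (F x) y = cinner x (F y)"
  unfolding F_def
  by (rule frac_pow_adj[OF near_identity_G]) (auto simp: G_def cinner_simps Th_adj)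

lemma Q_adj: "0 \<le> \<tau> \<Longrightarrow> \<tau> \<le> 1 \<Longrightarrow> cinner (Q \<tau> x) y = cinner x (Q \<tau> y)"
  unfolding Q_def by (rule frac_pow_adj[OF near_identity_F F_adj])

lemma dense_range_S: "closure (range S) = UNIV"
proof (rule dense_range_if_adjoint_inj[OF S])
  fix y assume "\<And>x. cinner (S x) y = 0"
  then have "cinner (S' y) (S' y) = 0"
    by (simp only: adj)
  then show "y = 0"
    by (simp add: S'_0)
qed

lemma dense_range_F: "closure (range F) = UNIV"
proof (rule dense_range_if_adjoint_inj[OF bounded_clinear_F])
  fix y assume "\<And>x. cinner (F x) y = 0"
  then have "cinner (F y) (F y) = 0"
    by (simp only: F_adj)
  then show "y = 0"
    by (simp add: F_0)
qed

lemma dense_range_Q: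
  assumes "0 \<le> \<tau>" "\<tau> \<le> 1"
  shows "closure (range (Q \<tau>)) = UNIV"
proof (rule dense_range_if_adjoint_inj[OF bounded_clinear_Q[OF assms]])
  fix y assume "\<And>x. cinner (Q \<tau> x) y = 0"
  then have "cinner (Q \<tau> y) (Q \<tau> y) = 0"
    by (simp only: Q_adj[OF assms])
  then show "y = 0"
    using Q_eq_0[OF assms] by simp
qed

end

sublocale adjoint_pair \<subseteq> dual: adjoint_pair S' S
  by unfold_locales (fact S S' adj' S_0 S'_0)+

section \<open>The inverse of \<open>A\<close> intertwines the two scales\<close>

context adjoint_pair
begin

lemma S_Th: "S (Th x) = dual.Th (S x)"
proof -
  have "dual.gram (S (Th x)) = S (gram (Th x))"
    by (simp add: dual.gram_def gram_def bounded_clinear_add[OF S])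
  then have "dual.Th (dual.gram (S (Th x))) = dual.Th (S x)"
    by (simp add: gram_Th)
  then show ?thesis
    by (simp add: dual.Th_gram)
qed

lemma S_G: "S (G x) = dual.G (S x)"
  unfolding G_def dual.G_def bounded_clinear_diff[OF S] S_Th ..

lemma S_F: "S (F x) = dual.F (S x)"
proof -
  have "S (frac_pow G (1/2) x) = frac_pow dual.G (1/2) (S x)"
  proof (rule frac_pow_intertwine)
    show "near_identity G" "near_identity dual.G" "bounded_clinear S"
      by (fact near_identity_G dual.near_identity_G S)+
    show "S (G x) = dual.G (S x)" for x
      by (fact S_G)
  qed simp_all
  then show ?thesis
    unfolding F_def dual.F_def .
qed

end

section \<open>Bounded factors between the inverse of \<open>A\<close> and the square roots\<close>

context adjoint_pair
begin

text \<open>Symmetry removes the square root: the left side is \<open>(dual.G h | h)\<close>, and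
  \<open>dual.G\<close> is \<open>S Th S'\<close>. Both factorisations compare \<open>dual.F\<close>
  with \<open>S'\<close> through this formula.\<close>

lemma norm_dual_F: "(norm (dual.F h))\<^sup>2 = Re (cinner (Th (S' h)) (S' h))"
proof -
  have "dual.G h = S (Th (S' h))"
    by (simp add: dual.G_eq dual.S_Th)
  then have "cinner (Th (S' h)) (S' h) = cinner (dual.F (dual.F h)) h"
    by (simp add: dual.F_F adj)
  then show ?thesis
    by (simp only: dual.F_adj[of "dual.F h" h] Re_cinner_self)
qed

text \<open>Douglas factorisation: \<open>dual.F\<close> is dominated in norm by \<open>S'\<close>,
  hence equals \<open>Y S'\<close> with a bounded \<open>Y\<close>; adjoints turn this into
  \<open>S\<close> times the adjoint of \<open>Y\<close>.\<close>

lemma exists_Z: "\<exists>Z. bounded_clinear Z \<and> (\<forall>h. S (Z h) = dual.F h)"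
proof -
  have "norm (dual.F h) \<le> 1 * norm (S' h)" for h
  proof -
    have "(norm (dual.F h))\<^sup>2 \<le> cmod (cinner (Th (S' h)) (S' h))"
      by (simp add: norm_dual_F complex_Re_le_cmod)
    also have "\<dots> \<le> norm (Th (S' h)) * norm (S' h)"
      by (rule cinner_Cauchy_Schwarz)
    also have "\<dots> \<le> (norm (S' h))\<^sup>2"
      by (simp add: norm_Th_le mult_right_mono power2_eq_square)
    finally have "norm (dual.F h) \<le> norm (S' h)"
      by (rule power2_le_imp_le) simp
    then show ?thesis
      by simp
  qed
  note bound = this
  obtain Y where Y: "bounded_clinear Y" "\<And>h. Y (S' h) = dual.F h"
    by (rule extend_bounded_clinear[OF bounded_clinear_add[OF S'] bounded_clinear_scaleC[OF S']
      bounded_clinear_add[OF dual.bounded_clinear_F] bounded_clinear_scaleC[OF dual.bounded_clinear_F]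
      dual.dense_range_S bound]) (rule that)
  obtain Z where Z: "bounded_clinear Z" "\<And>x y. cinner (Y x) y = cinner x (Z y)"
    by (rule exists_adjoint[OF Y(1)]) (rule that)
  have "S (Z h) = dual.F h" for h
    by (rule cinner_ext) (simp only: adj adjoint_sym[OF Z(2)] Y(2) dual.F_adj)
  then show ?thesis
    using Z(1) by blast
qed

text \<open>The same factorisation from the opposite domination of \<open>S'\<close> by
  \<open>dual.F\<close>.\<close>

lemma exists_Zi: "\<exists>Z. bounded_clinear Z \<and> (\<forall>h. dual.F (Z h) = S h)"
proof -
  obtain \<sigma> where \<sigma>: "\<sigma> > 0" "\<And>x. norm (S' x) \<le> \<sigma> * norm x"
    by (rule bounded_clinear_bound[OF S']) (rule that)
  have "norm (S' h) \<le> sqrt (2 + 2 * \<sigma>\<^sup>2) * norm (dual.F h)" for h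
  proof -
    \<comment> \<open>In terms of \<open>k\<close> both sides are explicit: \<open>S' h\<close> is
      \<open>gram k\<close>, and \<open>(norm (dual.F h))\<^sup>2\<close> is the quadratic form of
      \<open>gram\<close> at \<open>k\<close>.\<close>
    define k where "k = Th (S' h)"
    have g: "S' h = gram k"
      by (simp add: k_def gram_Th)
    have "norm (gram k) \<le> norm k + norm (S' (S k))"
      unfolding gram_def by (rule norm_triangle_ineq)
    also have "\<dots> \<le> norm k + \<sigma> * norm (S k)"
      using \<sigma>(2) by simp
    finally have "(norm (gram k))\<^sup>2 \<le> (norm k + \<sigma> * norm (S k))\<^sup>2"
      by (simp add: power_mono)
    also have "\<dots> \<le> 2 * (norm k)\<^sup>2 + 2 * (\<sigma> * norm (S k))\<^sup>2"
      using sum_squares_bound[of "norm k" "\<sigma> * norm (S k)"] by (simp add: power2_sum)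
    also have "\<dots> \<le> (2 + 2 * \<sigma>\<^sup>2) * ((norm k)\<^sup>2 + (norm (S k))\<^sup>2)"
      by (simp add: algebra_simps power_mult_distrib)
    also have "(norm k)\<^sup>2 + (norm (S k))\<^sup>2 = (norm (dual.F h))\<^sup>2"
      using cinner_gram[of k] by (simp add: norm_dual_F g Th_gram Re_cinner_commute[of k] del: of_real_power)
    finally have "(norm (S' h))\<^sup>2 \<le> (sqrt (2 + 2 * \<sigma>\<^sup>2) * norm (dual.F h))\<^sup>2"
      by (simp add: g power_mult_distrib)
    then show ?thesis
      by (rule power2_le_imp_le) simp
  qed
  note bound = this
  obtain X where X: "bounded_clinear X" "\<And>h. X (dual.F h) = S' h"
    by (rule extend_bounded_clinear[OF bounded_clinear_add[OF dual.bounded_clinear_F]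
      bounded_clinear_scaleC[OF dual.bounded_clinear_F] bounded_clinear_add[OF S'] bounded_clinear_scaleC[OF S']
      dual.dense_range_F bound]) (rule that)
  obtain Z where Z: "bounded_clinear Z" "\<And>x y. cinner (X x) y = cinner x (Z y)"
    by (rule exists_adjoint[OF X(1)]) (rule that)
  have "dual.F (Z h) = S h" for h
    by (rule cinner_ext) (simp only: dual.F_adj adjoint_sym[OF Z(2)] X(2) adj)
  then show ?thesis
    using Z(1) by blast
qed

text \<open>\<open>Z\<close> is \<open>A\<close> composed with the inverse square root of \<open>I + A* A\<close>, and \<open>Zi\<close> is its inverse.\<close>

definition Z :: "'h \<Rightarrow> 'h"
  where "Z = (SOME Z. bounded_clinear Z \<and> (\<forall>h. S (Z h) = dual.F h))"

definition Zi :: "'h \<Rightarrow> 'h"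
  where "Zi = (SOME Z. bounded_clinear Z \<and> (\<forall>h. dual.F (Z h) = S h))"

lemma bounded_clinear_Z: "bounded_clinear Z" and S_Z: "S (Z h) = dual.F h"
  using someI_ex[OF exists_Z] by (simp_all add: Z_def)

lemma bounded_clinear_Zi: "bounded_clinear Zi" and F_Zi: "dual.F (Zi h) = S h"
  using someI_ex[OF exists_Zi] by (simp_all add: Zi_def)

lemma Z_Zi: "Z (Zi h) = h"
  by (rule injD[OF inj_S]) (simp add: S_Z F_Zi)

lemma Zi_Z: "Zi (Z h) = h"
  by (rule injD[OF dual.inj_F]) (simp add: S_Z F_Zi)

lemma Z_F: "Z (dual.F h) = F (Z h)"
  by (rule injD[OF inj_S]) (simp add: S_Z S_F)

lemma Z_Q:
  assumes "0 \<le> \<tau>" "\<tau> \<le> 1"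
  shows "Z (dual.Q \<tau> h) = Q \<tau> (Z h)"
  unfolding Q_def dual.Q_def
proof (rule frac_pow_intertwine)
  show "near_identity dual.F" "near_identity F" "bounded_clinear Z"
    by (fact dual.near_identity_F near_identity_F bounded_clinear_Z)+
  show "Z (dual.F x) = F (Z x)" for x
    by (fact Z_F)
qed (use assms in auto)

lemma Zi_Q: "0 \<le> \<tau> \<Longrightarrow> \<tau> \<le> 1 \<Longrightarrow> Zi (Q \<tau> h) = dual.Q \<tau> (Zi h)"
  by (metis Z_Q Zi_Z Z_Zi)

lemma Zi_F: "Zi (F h) = dual.F (Zi h)"
  by (metis Z_F Zi_Z Z_Zi)

end

context adjoint_pair
begin

text \<open>Checked on the dense range of \<open>F\<close>, where
  \<open>F g' = S' (dual.Z g')\<close> brings in the adjoint relation of \<open>S\<close>.\<close>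

lemma Z_adj: "cinner (Z h) g = cinner h (dual.Z g)"
proof -
  have "cinner (Z h) (F g') = cinner h (dual.Z (F g'))" for g'
  proof -
    have "cinner (Z h) (F g') = cinner (Z h) (S' (dual.Z g'))"
      by (simp add: dual.S_Z)
    also have "\<dots> = cinner (S (Z h)) (dual.Z g')"
      by (simp add: adj)
    also have "\<dots> = cinner h (dual.Z (F g'))"
      by (simp add: S_Z dual.F_adj dual.Z_F)
    finally show ?thesis .
  qed
  then have "cinner (F g') (Z h) = cinner (dual.Z (F g')) h" for g'
    by (metis cinner_commute)
  from bounded_clinear_eq_on_dense[OF bounded_clinear_cinner_left
      bounded_clinear_compose[OF bounded_clinear_cinner_left dual.bounded_clinear_Z] dense_range_F this]
  show ?thesis
    by (metis cinner_commute)
qed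

end

section \<open>The resolvent between the scales\<close>

text \<open>\<open>x - \<mu> S x\<close> is \<open>(A - \<mu>) S x\<close>, so its inverse
  \<open>J \<mu>\<close> is \<open>A (A - \<mu>)\<inverse>\<close>. The sectorial bound becomes a
  uniform bound on the closed right half-plane, the origin included, in terms of bounded
  operators.\<close>

locale dissipative_pair = adjoint_pair S S' for S S' :: "'h::{complex_hilbert, second_countable_topology} \<Rightarrow> 'h" +
  fixes M :: real
  assumes surj_resolvent: "Re \<mu> \<ge> 0 \<Longrightarrow> surj (\<lambda>x. x - \<mu> *\<^sub>C S x)"
    and norm_le_resolvent: "Re \<mu> \<ge> 0 \<Longrightarrow> norm x \<le> M * norm (x - \<mu> *\<^sub>C S x)"
begin

definition J :: "complex \<Rightarrow> 'h \<Rightarrow> 'h"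
  where "J \<mu> = inv (\<lambda>x. x - \<mu> *\<^sub>C S x)"

lemma bounded_clinear_1_sub: "bounded_clinear (\<lambda>x. x - \<mu> *\<^sub>C S x)"
  by (rule bounded_clinear_sub[OF bounded_clinear_ident bounded_clinear_scaleC_compose[OF S]])

lemma
  assumes "Re \<mu> \<ge> 0"
  shows bounded_clinear_J: "bounded_clinear (J \<mu>)"
    and J_1_sub: "J \<mu> (x - \<mu> *\<^sub>C S x) = x"
    and J_eq: "J \<mu> w - \<mu> *\<^sub>C S (J \<mu> w) = w"
    and norm_J_le: "norm (J \<mu> w) \<le> M * norm w"
proof -
  note * = bounded_clinear_inv[OF bounded_clinear_1_sub surj_resolvent[OF assms] norm_le_resolvent[OF assms], folded J_def]
  show "bounded_clinear (J \<mu>)" "J \<mu> (x - \<mu> *\<^sub>C S x) = x" "J \<mu> w - \<mu> *\<^sub>C S (J \<mu> w) = w"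
    by (fact *)+
  show "norm (J \<mu> w) \<le> M * norm w"
    using norm_le_resolvent[OF assms, of "J \<mu> w"] by (simp add: *(3))
qed

lemma J_S: "Re \<mu> \<ge> 0 \<Longrightarrow> J \<mu> (S w) = S (J \<mu> w)"
proof -
  assume \<mu>: "Re \<mu> \<ge> 0"
  have "S w = S (J \<mu> w) - \<mu> *\<^sub>C S (S (J \<mu> w))"
    using J_eq[OF \<mu>, of w] by (metis bounded_clinear_diff[OF S] bounded_clinear_scaleC[OF S])
  then show ?thesis
    using J_1_sub[OF \<mu>] by simp
qed

lemma adj_1_sub: "cinner (x - \<mu> *\<^sub>C S x) y = cinner x (y - cnj \<mu> *\<^sub>C S' y)"
  by (simp add: cinner_simps adj)

text \<open>Duality: write \<open>y\<close> as \<open>g - cnj \<mu> S g\<close>, move the operator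
  to the other side of the inner product and use the bound on \<open>g\<close>; the constant is
  unchanged.\<close>

lemma norm_le_resolvent_adj:
  assumes \<mu>: "Re \<mu> \<ge> 0"
  shows "norm y \<le> M * norm (y - \<mu> *\<^sub>C S' y)"
proof (cases "y = 0")
  case False
  have \<mu>': "Re (cnj \<mu>) \<ge> 0"
    using \<mu> by simp
  define g where "g = J (cnj \<mu>) y"
  have "(norm y)\<^sup>2 = cmod (cinner y y)"
    by (simp add: cinner_self norm_power)
  also have "cinner y y = cinner (g - cnj \<mu> *\<^sub>C S g) y"
    by (simp add: g_def J_eq[OF \<mu>'])
  also have "\<dots> = cinner g (y - \<mu> *\<^sub>C S' y)"
    using adj_1_sub[of g "cnj \<mu>" y] by simp
  also have "cmod \<dots> \<le> norm g * norm (y - \<mu> *\<^sub>C S' y)"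
    by (rule cinner_Cauchy_Schwarz)
  also have "\<dots> \<le> (M * norm y) * norm (y - \<mu> *\<^sub>C S' y)"
    unfolding g_def by (rule mult_right_mono[OF norm_J_le[OF \<mu>']]) simp
  finally show ?thesis
    using False by (simp add: power2_eq_square)
qed (use S' in \<open>simp add: bounded_clinear_zero\<close>)

lemma surj_resolvent_adj:
  assumes \<mu>: "Re \<mu> \<ge> 0"
  shows "surj (\<lambda>y. y - \<mu> *\<^sub>C S' y)"
proof (rule adjoint_surjI)
  show "bounded_clinear (\<lambda>y. y - \<mu> *\<^sub>C S' y)"
    by (rule bounded_clinear_sub[OF bounded_clinear_ident bounded_clinear_scaleC_compose[OF S']])
  show "norm y \<le> M * norm (y - \<mu> *\<^sub>C S' y)" for y
    by (rule norm_le_resolvent_adj[OF \<mu>])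
  fix y assume "\<And>x. cinner (x - \<mu> *\<^sub>C S' x) y = 0"
  moreover have "cinner (x - \<mu> *\<^sub>C S' x) y = cinner x (y - cnj \<mu> *\<^sub>C S y)" for x
    by (simp add: cinner_simps adj')
  ultimately have "cinner (y - cnj \<mu> *\<^sub>C S y) (y - cnj \<mu> *\<^sub>C S y) = 0"
    by simp
  then have "y - cnj \<mu> *\<^sub>C S y = 0"
    by simp
  then show "y = 0"
    using norm_le_resolvent[of "cnj \<mu>" y] \<mu> by simp
qed

end

sublocale dissipative_pair \<subseteq> dual: dissipative_pair S' S M
  by unfold_locales (fact surj_resolvent_adj norm_le_resolvent_adj)+

context dissipative_pair
begin

lemma norm_F_le: "norm (F x) \<le> 2 * norm x"
proof -
  have "norm (x - (x - F x)) \<le> norm x + norm (x - F x)"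
    by (rule norm_triangle_ineq4)
  then show ?thesis
    using near_identity.near[OF near_identity_F, of x] by simp
qed

text \<open>\<open>q = Zi (J \<mu> w)\<close> stands for the resolvent of \<open>A\<close>.  The bound interpolates between \<open>q\<close>, which is
  controlled by \<open>w\<close>, and \<open>dual.F q\<close>, which is controlled both by \<open>F w\<close> and by \<open>w / \<mu>\<close>.\<close>

lemma resolvent_step:
  assumes s: "0 \<le> s" "s < 1" and \<theta>: "0 < \<theta>" "\<theta> < 1"
  obtains K where "K > 0"
    "\<And>\<mu> w \<nu> N. Re \<mu> \<ge> 0 \<Longrightarrow> \<mu> \<noteq> 0 \<Longrightarrow> 0 < N \<Longrightarrow> 0 < \<nu> \<Longrightarrow> norm w \<le> N \<Longrightarrow> norm (F w) \<le> \<nu> * N \<Longrightarrow>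
      norm (dual.Q (1 - s) (Zi (J \<mu> w))) \<le> K * N * \<nu> powr (\<theta> * (1 - s)) * cmod \<mu> powr - ((1 - \<theta>) * (1 - s))"
proof -
  let ?a = "1 - s"
  obtain k where k: "k > 0" "\<And>x. norm (Zi x) \<le> k * norm x"
    using bounded_clinear_bound[OF bounded_clinear_Zi] by blast
  obtain K where K: "K > 0" "\<And>q m1 m2. norm q \<le> m1 \<Longrightarrow> norm (dual.F q) \<le> m2 \<Longrightarrow> 0 < m1 \<Longrightarrow> 0 < m2 \<Longrightarrow>
      norm (dual.Q ?a q) \<le> K * (m1 powr (1 - ?a) * m2 powr ?a)"
    using moment_inequality[OF dual.near_identity_F, of ?a] s unfolding dual.Q_def by (metis diff_gt_0_iff_gt diff_le_eq le_add_same_cancel1)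
  define C where "C = (k + 1) * (\<bar>M\<bar> + 1)"
  have "C > 0"
    unfolding C_def using k(1) by (intro mult_pos_pos) auto
  moreover have "k * \<bar>M\<bar> \<le> C" "\<bar>M\<bar> + 1 \<le> C"
    using k(1) mult_nonneg_nonneg[of k "\<bar>M\<bar>"] by (simp_all add: C_def algebra_simps)
  ultimately have C: "C > 0" "k * \<bar>M\<bar> \<le> C" "\<bar>M\<bar> + 1 \<le> C"
    by auto
  have "norm (dual.Q ?a (Zi (J \<mu> w))) \<le> K * C * N * \<nu> powr (\<theta> * ?a) * cmod \<mu> powr - ((1 - \<theta>) * ?a)"
    if \<mu>: "Re \<mu> \<ge> 0" "\<mu> \<noteq> 0" and N: "0 < N" and \<nu>: "0 < \<nu>" and w: "norm w \<le> N" "norm (F w) \<le> \<nu> * N" for \<mu> w \<nu> N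
  proof -
    have J: "norm (J \<mu> x) \<le> \<bar>M\<bar> * norm x" for x
      by (rule order_trans[OF norm_J_le[OF \<mu>(1)] mult_right_mono[OF abs_ge_self norm_ge_zero]])
    have q: "norm (Zi (J \<mu> w)) \<le> C * N"
    proof -
      have "norm (Zi (J \<mu> w)) \<le> k * (\<bar>M\<bar> * norm w)"
        using k(1) by (intro order_trans[OF k(2) mult_left_mono[OF J]]) simp
      also have "\<dots> \<le> C * norm w"
        using mult_right_mono[OF C(2), of "norm w"] by (simp add: mult.assoc)
      also have "\<dots> \<le> C * N"
        using w(1) C(1) by simp
      finally show ?thesis .
    qed
    have Fq: "dual.F (Zi (J \<mu> w)) = S (J \<mu> w)"
      by (rule F_Zi)
    have F1: "norm (dual.F (Zi (J \<mu> w))) \<le> C * N * \<nu>"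
    proof -
      \<comment> \<open>Commuting \<open>S\<close> with \<open>J \<mu>\<close> brings the weaker
        norm \<open>norm (F w)\<close> into play.\<close>
      have "S (J \<mu> w) = J \<mu> (Zi (F w))"
        by (simp add: J_S[OF \<mu>(1), symmetric] Zi_F F_Zi)
      then have "norm (S (J \<mu> w)) \<le> \<bar>M\<bar> * (k * norm (F w))"
        using order_trans[OF J mult_left_mono[OF k(2)]] by simp
      also have "\<dots> \<le> C * norm (F w)"
        using mult_right_mono[OF C(2), of "norm (F w)"] by (simp add: mult_ac)
      also have "\<dots> \<le> C * (\<nu> * N)"
        using w(2) C(1) by simp
      finally show ?thesis
        by (simp add: Fq mult_ac)
    qed
    have F2: "norm (dual.F (Zi (J \<mu> w))) \<le> C * N * (1 / cmod \<mu>)"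
    proof -
      have "\<mu> *\<^sub>C S (J \<mu> w) = J \<mu> w - w"
        using J_eq[OF \<mu>(1), of w] by (metis add_diff_cancel_left' diff_add_cancel)
      then have "cmod \<mu> * norm (S (J \<mu> w)) \<le> norm (J \<mu> w) + norm w"
        by (metis norm_scaleC norm_triangle_ineq4)
      also have "\<dots> \<le> (\<bar>M\<bar> + 1) * norm w"
        using J[of w] by (simp add: algebra_simps)
      also have "\<dots> \<le> C * N"
        using C(3) w(1) C(1) by (intro mult_mono) auto
      finally show ?thesis
        using \<mu>(2) by (simp add: Fq field_simps)
    qed
    \<comment> \<open>The smaller of the two bounds is at most their geometric mean with weights
      \<open>\<theta>\<close> and \<open>1 - \<theta>\<close>, which divides the gain between \<nu>
      and \<mu>.\<close>
    define m where "m = \<nu> powr \<theta> * (1 / cmod \<mu>) powr (1 - \<theta>)"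
    have "min \<nu> (1 / cmod \<mu>) = min \<nu> (1 / cmod \<mu>) powr \<theta> * min \<nu> (1 / cmod \<mu>) powr (1 - \<theta>)"
      using \<nu> \<mu>(2) by (simp flip: powr_add)
    also have "\<dots> \<le> m"
      unfolding m_def using \<nu> \<mu>(2) \<theta> by (intro mult_mono powr_mono2) auto
    finally have "C * N * min \<nu> (1 / cmod \<mu>) \<le> C * N * m"
      using C(1) N by (intro mult_left_mono) auto
    then have Fm: "norm (dual.F (Zi (J \<mu> w))) \<le> C * N * m"
      using F1 F2 by (auto simp: min_def split: if_splits)
    have m_pos: "m > 0"
      using \<nu> \<mu>(2) by (simp add: m_def)
    have "norm (dual.Q ?a (Zi (J \<mu> w))) \<le> K * ((C * N) powr (1 - ?a) * (C * N * m) powr ?a)"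
      by (rule K(2)[OF q Fm]) (use C(1) N m_pos in auto)
    also have "(C * N) powr (1 - ?a) * (C * N * m) powr ?a = C * N * m powr ?a"
    proof -
      have "X powr (1 - ?a) * (X * m) powr ?a = X * m powr ?a" if "X > 0" for X
        using that m_pos by (simp add: powr_mult powr_diff)
      then show ?thesis
        using C(1) N by (simp only: mult_pos_pos)
    qed
    also have "m powr ?a = \<nu> powr (\<theta> * ?a) * cmod \<mu> powr - ((1 - \<theta>) * ?a)"
      using \<nu> \<mu>(2) by (simp add: m_def powr_mult powr_powr powr_divide powr_minus_divide)
    finally show ?thesis
      by (simp add: mult_ac)
  qed
  then show ?thesis
    using that[of "K * C"] K(1) C(1) by auto
qed

text \<open>For \<open>w = Q (1 - r) h\<close> the negative norm of \<open>w\<close> is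
  \<open>N = norm (F h)\<close>. In Balakrishnan's integral for \<open>w\<close> the vectors
  \<open>F (res t h)\<close> have norm at most \<open>N\<close> and a further \<open>F\<close> gains
  \<open>2 / t\<close>, so \<open>resolvent_step\<close> with \<open>\<nu> = 2 / t\<close> gives
  decay in \<open>t\<close>. Such \<open>w\<close> are dense.\<close>

lemma resolvent_estimate_dense:
  assumes r: "0 \<le> r" and s: "0 \<le> s" and rs: "r + s < 1"
  obtains c \<epsilon> where "\<epsilon> > 0"
    "\<And>\<mu> w. Re \<mu> \<ge> 0 \<Longrightarrow> \<mu> \<noteq> 0 \<Longrightarrow>
      norm (dual.Q (1 - s) (Zi (J \<mu> w))) \<le> c * cmod \<mu> powr - \<epsilon> * norm (Q r w)"
proof -
  let ?a = "1 - s"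
  \<comment> \<open>Convergence at infinity asks for \<open>(1 - r) + \<theta> (1 - s) > 1\<close>,
    that is \<open>\<theta> > r / (1 - s)\<close>, and decay in \<mu> for
    \<open>\<theta> < 1\<close>. The midpoint meets both, as \<open>r + s < 1\<close> leaves
    room.\<close>
  define \<theta> where "\<theta> = (r / ?a + 1) / 2"
  have "r / ?a < 1"
    using rs s r by (simp add: divide_less_eq)
  then have \<theta>: "0 < \<theta>" "\<theta> < 1"
    using r rs s by (auto simp: \<theta>_def add_nonneg_pos)
  have \<theta>a: "r < \<theta> * ?a"
  proof -
    have "\<theta> * ?a = (r + ?a) / 2"
      using r rs by (simp add: \<theta>_def field_simps)
    then show ?thesis
      using rs by (simp only:) simp
  qed
  define \<epsilon> where "\<epsilon> = (1 - \<theta>) * ?a"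
  have \<epsilon>: "\<epsilon> > 0"
    using \<theta> rs r by (simp add: \<epsilon>_def)
  obtain K where K: "K > 0" "\<And>\<mu> w \<nu> N. Re \<mu> \<ge> 0 \<Longrightarrow> \<mu> \<noteq> 0 \<Longrightarrow> 0 < N \<Longrightarrow> 0 < \<nu> \<Longrightarrow>
      norm w \<le> N \<Longrightarrow> norm (F w) \<le> \<nu> * N \<Longrightarrow>
      norm (dual.Q ?a (Zi (J \<mu> w))) \<le> K * N * \<nu> powr (\<theta> * ?a) * cmod \<mu> powr - ((1 - \<theta>) * ?a)"
    by (rule resolvent_step[of s \<theta>]) (use s rs r \<theta> that in auto)
  note K_step = K(2)[folded \<epsilon>_def]
  define k where "k = K * 2 powr (\<theta> * ?a)"
  have clin: "bounded_clinear (\<lambda>w. dual.Q ?a (Zi (J \<mu> w)))" if "Re \<mu> \<ge> 0" for \<mu>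
    using s rs r that
    by (intro bounded_clinear_compose[OF dual.bounded_clinear_Q]
        bounded_clinear_compose[OF bounded_clinear_Zi] bounded_clinear_J) auto
  show ?thesis
  proof (cases "r = 0")
    \<comment> \<open>The exponent \<open>1 - r = 1\<close> lies outside the range of Balakrishnan's
      formula; here \<open>resolvent_step\<close> applies directly with
      \<open>\<nu> = 2\<close>.\<close>
    case True
    have "norm (dual.Q ?a (Zi (J \<mu> w))) \<le> k * cmod \<mu> powr - \<epsilon> * norm (Q r w)"
      if \<mu>: "Re \<mu> \<ge> 0" "\<mu> \<noteq> 0" for \<mu> w
    proof (cases "w = 0")
      case False
      have "norm (dual.Q ?a (Zi (J \<mu> w))) \<le> K * norm w * 2 powr (\<theta> * ?a) * cmod \<mu> powr - \<epsilon>"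
        by (rule K_step[OF \<mu>]) (use False norm_F_le in auto)
      then show ?thesis
        by (simp add: True Q_0 k_def mult_ac)
    qed (use bounded_clinear_zero[OF clin[OF \<mu>(1)]] in \<open>simp add: True Q_0\<close>)
    then show ?thesis
      using that[OF \<epsilon>] by blast
  next
    case False
    then have r: "0 < r" "r < 1"
      using r s rs by auto
    define c where "c = (1 / (1 - (1 - r)) + 1 / ((1 - r) + \<theta> * ?a - 1)) * 2 powr (1 - (1 - r)) * k"
    have main: "norm (dual.Q ?a (Zi (J \<mu> (Q (1 - r) h)))) \<le> c * cmod \<mu> powr - \<epsilon> * norm (Q r (Q (1 - r) h))"
      if \<mu>: "Re \<mu> \<ge> 0" "\<mu> \<noteq> 0" for \<mu> h
    proof (cases "h = 0")
      case False
      define N where "N = norm (F h)"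
      have N: "N > 0"
        using False F_0 by (auto simp: N_def)
      define m where "m = k * N * cmod \<mu> powr - \<epsilon>"
      interpret F: near_identity F
        by (rule near_identity_F)
      have "norm (dual.Q ?a (Zi (J \<mu> (frac_pow F (1 - r) h))))
          \<le> (1 / (1 - (1 - r)) + 1 / ((1 - r) + \<theta> * ?a - 1)) * m * 2 powr (1 - (1 - r))"
      proof (rule norm_frac_pow_le[OF near_identity_F _ _ _ _ clin[OF \<mu>(1)]])
        fix t :: real assume t: "0 < t"
        have w: "norm (F (F.res t h)) \<le> N"
          using F.norm_res_le[of t "F h"] t by (simp add: F.F_res_commute N_def)
        show "norm (dual.Q ?a (Zi (J \<mu> (F (F.res t h))))) \<le> m * (if t \<le> 2 then 1 else (2 / t) powr (\<theta> * ?a))"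
        proof (cases "t \<le> 2")
          case True
          have "norm (dual.Q ?a (Zi (J \<mu> (F (F.res t h))))) \<le> K * N * 2 powr (\<theta> * ?a) * cmod \<mu> powr - \<epsilon>"
            by (rule K_step[OF \<mu> N _ w]) (use norm_F_le[of "F (F.res t h)"] w in auto)
          then show ?thesis
            using True by (simp add: m_def k_def mult_ac)
        next
          case False
          have "norm (F (F (F.res t h))) \<le> 2 / t * N"
            using F.norm_F_res_le[OF t, of "F h"] t by (simp add: F.F_res_commute N_def)
          then have "norm (dual.Q ?a (Zi (J \<mu> (F (F.res t h))))) \<le> K * N * (2 / t) powr (\<theta> * ?a) * cmod \<mu> powr - \<epsilon>"
            using t by (intro K_step[OF \<mu> N _ w]) auto
          \<comment> \<open>The extra factor is at least 1 and gives both ranges of \<open>t\<close>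
            the common constant \<open>m\<close>.\<close>
          also have "\<dots> \<le> (K * N * (2 / t) powr (\<theta> * ?a) * cmod \<mu> powr - \<epsilon>) * 2 powr (\<theta> * ?a)"
          proof -
            have "1 \<le> 2 powr (\<theta> * ?a)"
              using \<theta> r rs by (intro ge_one_powr_ge_zero) auto
            moreover have "0 \<le> K * N * (2 / t) powr (\<theta> * ?a) * cmod \<mu> powr - \<epsilon>"
              using K(1) N by simp
            ultimately show ?thesis
              by (metis mult.right_neutral mult_left_mono)
          qed
          finally show ?thesis
            using False by (simp add: m_def k_def mult_ac)
        qed
      qed (use r \<theta>a in auto)
      then have "norm (dual.Q ?a (Zi (J \<mu> (Q (1 - r) h)))) \<le> c * cmod \<mu> powr - \<epsilon> * N"
        by (simp add: c_def m_def Q_def mult_ac)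
      moreover have "Q r (Q (1 - r) h) = F h"
        using Q_add[of r "1 - r" h] r by (simp add: Q_1)
      ultimately show ?thesis
        by (simp add: N_def)
    qed (use r in \<open>simp add: bounded_clinear_zero[OF clin[OF \<mu>(1)]] bounded_clinear_zero[OF bounded_clinear_Q]\<close>)
    have "norm (dual.Q ?a (Zi (J \<mu> w))) \<le> c * cmod \<mu> powr - \<epsilon> * norm (Q r w)"
      if \<mu>: "Re \<mu> \<ge> 0" "\<mu> \<noteq> 0" for \<mu> w
      by (rule norm_le_on_dense[OF clin[OF \<mu>(1)] bounded_clinear_Q dense_range_Q[of "1 - r"] main[OF \<mu>]])
        (use r in auto)
    then show ?thesis
      using that[OF \<epsilon>] by blast
  qed
qed

text \<open>The coordinate \<open>z\<close> stands for the element \<open>x = dual.Q (1 - r) z\<close> of the domain, and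
  \<open>Z z - \<mu> Q r x\<close> for \<open>(A - \<mu>) x\<close>; thus \<open>dual.Q (1 - r - s) z\<close> is \<open>x\<close> as an element of the space with index \<open>s\<close>.\<close>

theorem resolvent_estimate:
  assumes r: "0 \<le> r" and s: "0 \<le> s" and rs: "r + s < 1"
  obtains c \<epsilon> where "\<epsilon> > 0"
    "\<And>\<mu> z. Re \<mu> \<ge> 0 \<Longrightarrow> \<mu> \<noteq> 0 \<Longrightarrow>
      norm (dual.Q (1 - r - s) z) \<le> c * cmod \<mu> powr - \<epsilon> * norm (Z z - \<mu> *\<^sub>C Q r (dual.Q (1 - r) z))"
proof -
  obtain c \<epsilon> where \<epsilon>: "\<epsilon> > 0" and c: "\<And>\<mu> w. Re \<mu> \<ge> 0 \<Longrightarrow> \<mu> \<noteq> 0 \<Longrightarrow>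
      norm (dual.Q (1 - s) (Zi (J \<mu> w))) \<le> c * cmod \<mu> powr - \<epsilon> * norm (Q r w)"
    by (rule resolvent_estimate_dense[OF assms]) (rule that)
  have "norm (dual.Q (1 - r - s) z) \<le> c * cmod \<mu> powr - \<epsilon> * norm (Z z - \<mu> *\<^sub>C Q r (dual.Q (1 - r) z))"
    if \<mu>: "Re \<mu> \<ge> 0" "\<mu> \<noteq> 0" for \<mu> z
  proof (rule norm_le_on_dense[where e="dual.Q r" and f="dual.Q (1 - r - s)" and y=z
        and g="\<lambda>z. Z z - \<mu> *\<^sub>C Q r (dual.Q (1 - r) z)"])
    show "bounded_clinear (dual.Q (1 - r - s))" "closure (range (dual.Q r)) = UNIV"
      using assms by (auto intro!: dual.bounded_clinear_Q dual.dense_range_Q)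
    show "bounded_clinear (\<lambda>z. Z z - \<mu> *\<^sub>C Q r (dual.Q (1 - r) z))"
      using assms
      by (intro bounded_clinear_sub bounded_clinear_Z bounded_clinear_scaleC_compose
          bounded_clinear_compose[OF bounded_clinear_Q dual.bounded_clinear_Q]) auto
    fix q
    \<comment> \<open>For the coordinate \<open>dual.Q r q\<close> the vector \<open>x\<close> is
      \<open>dual.F q\<close>, which lies in the domain of \<open>A\<close> with
      \<open>A x = Z q\<close>; thus \<open>w\<close> is \<open>(A - \<mu>) x\<close> as an element
      of \<open>H\<close>.\<close>
    define w where "w = Z q - \<mu> *\<^sub>C S (Z q)"
    have "Zi (J \<mu> w) = q"
      by (simp add: w_def J_1_sub[OF \<mu>(1)] Zi_Z)
    moreover have "dual.Q (1 - r - s) (dual.Q r q) = dual.Q (1 - s) q"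
      using assms by (simp add: dual.Q_add)
    moreover have "Z (dual.Q r q) - \<mu> *\<^sub>C Q r (dual.Q (1 - r) (dual.Q r q)) = Q r w"
      using assms by (simp add: Z_Q w_def S_Z dual.Q_add dual.Q_1
          bounded_clinear_diff[OF bounded_clinear_Q] bounded_clinear_scaleC[OF bounded_clinear_Q])
    ultimately show "norm (dual.Q (1 - r - s) (dual.Q r q))
        \<le> c * cmod \<mu> powr - \<epsilon> * norm (Z (dual.Q r q) - \<mu> *\<^sub>C Q r (dual.Q (1 - r) (dual.Q r q)))"
      using c[OF \<mu>, of w] by simp
  qed
  then show ?thesis
    using that[OF \<epsilon>] by blast
qed

end

section \<open>Two half-planes\<close>

text \<open>Agreement on the axis makes the pasted function continuous, hence entire, and linear
  growth leaves a polynomial of degree at most 1.\<close>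

lemma Liouville_half_planes:
  fixes g1 g2 :: "complex \<Rightarrow> complex"
  assumes cont: "continuous_on {z. Re z \<ge> 0} g1" "continuous_on {z. Re z \<le> 0} g2"
    and holo: "g1 holomorphic_on {z. Re z > 0}" "g2 holomorphic_on {z. Re z < 0}"
    and eq: "\<And>z. Re z = 0 \<Longrightarrow> g1 z = g2 z"
    and bound: "\<And>z. Re z > 0 \<Longrightarrow> cmod (g1 z) \<le> c * (1 + cmod z)"
      "\<And>z. Re z < 0 \<Longrightarrow> cmod (g2 z) \<le> c * (1 + cmod z)"
  obtains a b where "\<And>z. Re z \<ge> 0 \<Longrightarrow> g1 z = a + b * z" "\<And>z. Re z \<le> 0 \<Longrightarrow> g2 z = a + b * z"
proof -
  define g where "g z = (if Re z \<le> 0 then g2 z else g1 z)" for z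
  have cont_g: "continuous_on UNIV g"
    unfolding g_def
    using continuous_on_cases_le[of UNIV Re 0 g2 g1] cont eq
    by (simp add: continuous_on_Re)
  have "g holomorphic_on UNIV"
  proof (rule holomorphic_on_paste_across_line[where d=1 and k=0])
    show "g holomorphic_on UNIV \<inter> {z. 1 \<bullet> z < 0}"
      using holo(2) by (rule holomorphic_transform[THEN holomorphic_on_subset]) (auto simp: g_def inner_complex_def)
    show "g holomorphic_on UNIV \<inter> {z. 0 < 1 \<bullet> z}"
      using holo(1) by (rule holomorphic_transform[THEN holomorphic_on_subset]) (auto simp: g_def inner_complex_def)
  qed (use cont_g in auto)
  \<comment> \<open>The growth bounds are given off the axis; density and continuity extend them to
    it.\<close>
  have bound_g: "cmod (g z) \<le> c * (1 + cmod z)" for z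
  proof -
    have "closed {z. cmod (g z) \<le> c * (1 + cmod z)}"
      by (intro closed_Collect_le continuous_intros cont_g)
    moreover have "- {z. 1 \<bullet> z = (0::real)} \<subseteq> {z. cmod (g z) \<le> c * (1 + cmod z)}"
      using bound by (auto simp: g_def inner_complex_def)
    ultimately have "closure (- {z::complex. 1 \<bullet> z = (0::real)}) \<subseteq> {z. cmod (g z) \<le> c * (1 + cmod z)}"
      by (simp add: closure_minimal)
    moreover have "closure (- {z::complex. 1 \<bullet> z = (0::real)}) = UNIV"
      unfolding closure_complement by (subst interior_hyperplane) auto
    ultimately show ?thesis
      by blast
  qed
  have c: "c \<ge> 0"
    using order_trans[OF norm_ge_zero bound_g[of 0]] by simp
  have "cmod (g z) \<le> 2 * c * cmod z ^ 1" if "1 \<le> cmod z" for z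
  proof -
    have "c * (1 + cmod z) \<le> c * (2 * cmod z)"
      using that c by (intro mult_left_mono) auto
    then show ?thesis
      using bound_g[of z] by simp
  qed
  note growth = this
  have g: "g z = g 0 + deriv g 0 * z" for z
  proof -
    have "g z = (\<Sum>k\<le>1. (deriv ^^ k) g 0 / fact k * z ^ k)"
      by (rule Liouville_polynomial[OF \<open>g holomorphic_on UNIV\<close> growth])
    then show ?thesis
      by simp
  qed
  show ?thesis
  proof (rule that)
    show "g1 z = g 0 + deriv g 0 * z" if "Re z \<ge> 0" for z
      using g[of z] eq[of z] that by (cases "Re z = 0") (auto simp: g_def)
    show "g2 z = g 0 + deriv g 0 * z" if "Re z \<le> 0" for z
      using g[of z] that by (simp add: g_def)
  qed
qed

text \<open>The sum and the difference of the values at \<open>t\<close> and \<open>-t\<close>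
  isolate \<open>a\<close> and \<open>b t\<close>.\<close>

lemma linear_function_decay_eq_0:
  fixes a b :: complex
  assumes \<epsilon>: "\<epsilon> > 0" and decay: "\<And>t::real. t \<noteq> 0 \<Longrightarrow> cmod (a + b * (\<i> * of_real t)) \<le> D * \<bar>t\<bar> powr - \<epsilon>"
  shows "a = 0" "b = 0"
proof -
  have lim: "((\<lambda>t. D * t powr - \<epsilon>) \<longlongrightarrow> D * 0) at_top"
    using \<epsilon> by (intro tendsto_mult_left tendsto_neg_powr filterlim_ident) simp
  have "cmod a \<le> D * t powr - \<epsilon>" "cmod b * t \<le> D * t powr - \<epsilon>" if "t > 0" for t
  proof -
    let ?p = "a + b * (\<i> * of_real t)" and ?m = "a + b * (\<i> * of_real (- t))"
    have le: "cmod ?p \<le> D * t powr - \<epsilon>" "cmod ?m \<le> D * t powr - \<epsilon>"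
      using decay[of t] decay[of "- t"] that by auto
    have "2 * cmod a = cmod (?p + ?m)"
      by simp
    then show "cmod a \<le> D * t powr - \<epsilon>"
      using norm_triangle_ineq[of ?p ?m] le by linarith
    have "?p - ?m = 2 * (b * (\<i> * of_real t))"
      by simp
    then have "2 * (cmod b * t) = cmod (?p - ?m)"
      using that by (simp add: norm_mult)
    then show "cmod b * t \<le> D * t powr - \<epsilon>"
      using norm_triangle_ineq4[of ?p ?m] le by linarith
  qed note * = this
  have "\<forall>\<^sub>F t in at_top. cmod a \<le> D * t powr - \<epsilon>"
    using eventually_gt_at_top[of 0] by eventually_elim (rule *(1))
  then have "cmod a \<le> D * 0"
    by (rule tendsto_lowerbound[OF lim]) simp
  then show "a = 0"
    by simp
  have "\<forall>\<^sub>F t in at_top. cmod b \<le> D * t powr - \<epsilon>"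
    using eventually_ge_at_top[of 1]
  proof eventually_elim
    case (elim t)
    then have "cmod b \<le> cmod b * t"
      by (simp add: mult_le_cancel_left1)
    then show ?case
      using *(2)[of t] elim by simp
  qed
  then have "cmod b \<le> D * 0"
    by (rule tendsto_lowerbound[OF lim]) simp
  then show "b = 0"
    by simp
qed

lemma bounded_linear_function_eq_0:
  fixes a b :: complex
  assumes "\<And>t::real. t > 0 \<Longrightarrow> cmod (a + b * (\<i> * of_real t)) \<le> D"
  shows "b = 0"
proof (rule ccontr)
  assume "b \<noteq> 0"
  define t where "t = (\<bar>D\<bar> + cmod a + 1) / cmod b"
  have t: "t > 0"
    using \<open>b \<noteq> 0\<close> by (simp add: t_def add_nonneg_pos)
  have "cmod (b * (\<i> * of_real t)) = \<bar>D\<bar> + cmod a + 1"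
    using t \<open>b \<noteq> 0\<close> by (simp add: norm_mult) (simp add: t_def)
  moreover have "cmod (b * (\<i> * of_real t)) \<le> cmod (a + b * (\<i> * of_real t)) + cmod a"
    using norm_triangle_ineq4[of "a + b * (\<i> * of_real t)" a] by simp
  ultimately show False
    using assms[OF t] by linarith
qed

text \<open>The quotient is given in product form, as resolvent identities deliver it;
  differentiability is relative to \<open>U\<close>, which will be a closed half-plane.\<close>

lemma holomorphic_on_quotientI:
  assumes "\<And>\<nu>. \<nu> \<in> U \<Longrightarrow> \<exists>g. (\<forall>\<mu>\<in>U. f \<mu> - f \<nu> = (\<mu> - \<nu>) * g \<mu>) \<and> (g \<longlongrightarrow> g \<nu>) (at \<nu> within U)"
  shows "f holomorphic_on U"
  unfolding holomorphic_on_def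
proof
  fix \<nu> assume "\<nu> \<in> U"
  then obtain g where g: "\<And>\<mu>. \<mu> \<in> U \<Longrightarrow> f \<mu> - f \<nu> = (\<mu> - \<nu>) * g \<mu>" "(g \<longlongrightarrow> g \<nu>) (at \<nu> within U)"
    using assms by blast
  have "((\<lambda>\<mu>. (f \<mu> - f \<nu>) / (\<mu> - \<nu>)) \<longlongrightarrow> g \<nu>) (at \<nu> within U)"
    using g(2) by (rule Lim_transform_eventually) (auto simp: eventually_at_filter g(1))
  then show "f field_differentiable at \<nu> within U"
    unfolding field_differentiable_def has_field_derivative_iff by blast
qed

section \<open>The Hamiltonian in coordinates\<close>

text \<open>The form in which \<open>B B*\<close> and \<open>C* C\<close> enter. For
  \<open>P = f f*\<close> the form \<open>(P h | h)\<close> is the square of the norm of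
  \<open>f* h\<close>, so the inequality bounds \<open>B B* y\<close> by the energy term of
  \<open>B* y\<close>.\<close>

definition pos_op :: "('a::complex_hilbert \<Rightarrow> 'a) \<Rightarrow> real \<Rightarrow> bool"
  where "pos_op P k \<longleftrightarrow> bounded_clinear P \<and> k > 0 \<and>
    (\<forall>h. cinner (P h) h = of_real (Re (cinner (P h) h)) \<and> (norm (P h))\<^sup>2 \<le> k * Re (cinner (P h) h))"

lemma pos_opD:
  assumes "pos_op P k"
  shows "bounded_clinear P" "k > 0" "cinner (P h) h = of_real (Re (cinner (P h) h))"
    "cinner h (P h) = of_real (Re (cinner (P h) h))"
    "(norm (P h))\<^sup>2 \<le> k * Re (cinner (P h) h)" "0 \<le> Re (cinner (P h) h)"
proof -
  show *: "bounded_clinear P" "k > 0" "cinner (P h) h = of_real (Re (cinner (P h) h))"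
    "(norm (P h))\<^sup>2 \<le> k * Re (cinner (P h) h)"
    using assms unfolding pos_op_def by metis+
  show "cinner h (P h) = of_real (Re (cinner (P h) h))"
    using *(3) by (metis cinner_commute complex_cnj_complex_of_real)
  show "0 \<le> Re (cinner (P h) h)"
    using *(2,4) by (meson order_trans zero_le_mult_iff zero_le_power2 not_less)
qed

context dissipative_pair
begin

text \<open>The first row is paired with \<open>y\<close>, the second with \<open>x\<close>: the
  terms of \<open>A\<close> and \<open>A*\<close> cancel by adjointness, those of \<mu> because
  \<mu> is imaginary. The right side \<open>a\<close> is kept general for use at
  \<open>\<mu> = 0\<close>.\<close>

lemma energy_identity:
  assumes r: "0 \<le> r" and s: "0 \<le> s" and rs: "r + s < 1" and \<mu>: "Re \<mu> = 0"
    and 1: "Z z - \<mu> *\<^sub>C Q r (dual.Q (1 - r) z) - Pb (Q (1 - r - s) e) = a"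
    and 2: "- Pc (dual.Q (1 - r - s) z) - dual.Z e - \<mu> *\<^sub>C dual.Q s (Q (1 - s) e) = d"
  shows "cinner (Pb (Q (1 - r - s) e)) (Q (1 - r - s) e) + cinner (dual.Q (1 - r - s) z) (Pc (dual.Q (1 - r - s) z))
    = - cinner a (Q (1 - r - s) e) - cinner (dual.Q (1 - r - s) z) d"
proof -
  let ?\<delta> = "1 - r - s"
  have "cinner (Z z) (Q ?\<delta> e) = cinner (dual.Q ?\<delta> z) (dual.Z e)"
    using assms by (simp add: Z_adj dual.Z_Q dual.Q_adj)
  moreover have "cinner (Q r (dual.Q (1 - r) z)) (Q ?\<delta> e) = cinner (dual.Q (1 - r) z) (Q (1 - s) e)"
    using assms by (simp add: Q_adj Q_add)
  moreover have "cinner (dual.Q ?\<delta> z) (dual.Q s (Q (1 - s) e)) = cinner (dual.Q (1 - r) z) (Q (1 - s) e)"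
    using assms by (simp add: dual.Q_add flip: dual.Q_adj)
  moreover have "cnj \<mu> = - \<mu>"
    using \<mu> by (simp add: complex_eq_iff)
  ultimately show ?thesis
    unfolding 1[symmetric] 2[symmetric] by (simp add: cinner_simps algebra_simps)
qed

text \<open>The resolvent identity
  \<open>J \<mu> - J \<nu> = (\<mu> - \<nu>) J \<mu> S J \<nu>\<close> gives the quotient; a second
  application with the uniform bound on \<open>J\<close> gives its continuity.\<close>

lemma holomorphic_J: "(\<lambda>\<mu>. cinner (J \<mu> u) h) holomorphic_on {\<mu>. Re \<mu> \<ge> 0}"
proof (rule holomorphic_on_quotientI)
  fix \<nu> :: complex assume \<nu>: "\<nu> \<in> {\<mu>. Re \<mu> \<ge> 0}"
  have diff: "J \<mu> x - J \<nu> x = (\<mu> - \<nu>) *\<^sub>C J \<mu> (S (J \<nu> x))" if \<mu>: "Re \<mu> \<ge> 0" for \<mu> x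
  proof -
    have "J \<nu> x - \<mu> *\<^sub>C S (J \<nu> x) = x - (\<mu> - \<nu>) *\<^sub>C S (J \<nu> x)"
      using J_eq[of \<nu> x] \<nu> by (simp add: complex_vector.scale_left_diff_distrib algebra_simps)
    then have "J \<nu> x = J \<mu> (x - (\<mu> - \<nu>) *\<^sub>C S (J \<nu> x))"
      using J_1_sub[OF \<mu>, of "J \<nu> x"] by simp
    then have "J \<nu> x = J \<mu> x - (\<mu> - \<nu>) *\<^sub>C J \<mu> (S (J \<nu> x))"
      by (simp only: bounded_clinear_diff[OF bounded_clinear_J[OF \<mu>]]
          bounded_clinear_scaleC[OF bounded_clinear_J[OF \<mu>]])
    then show ?thesis
      by (metis diff_add_cancel diff_diff_eq2 add_diff_cancel_left')
  qed
  let ?x = "S (J \<nu> u)"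
  have "((\<lambda>\<mu>. J \<mu> ?x - J \<nu> ?x) \<longlongrightarrow> 0) (at \<nu> within {\<mu>. Re \<mu> \<ge> 0})"
  proof (rule Lim_null_comparison)
    show "\<forall>\<^sub>F \<mu> in at \<nu> within {\<mu>. Re \<mu> \<ge> 0}. norm (J \<mu> ?x - J \<nu> ?x) \<le> cmod (\<mu> - \<nu>) * (M * norm (S (J \<nu> ?x)))"
      unfolding eventually_at_filter
      by (intro always_eventually allI impI) (auto simp: diff norm_scaleC intro!: mult_left_mono norm_J_le)
    have "((\<lambda>\<mu>. cmod (\<mu> - \<nu>) * (M * norm (S (J \<nu> ?x)))) \<longlongrightarrow> cmod (\<nu> - \<nu>) * (M * norm (S (J \<nu> ?x))))
        (at \<nu> within {\<mu>. Re \<mu> \<ge> 0})"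
      by (intro tendsto_intros)
    then show "((\<lambda>\<mu>. cmod (\<mu> - \<nu>) * (M * norm (S (J \<nu> ?x)))) \<longlongrightarrow> 0) (at \<nu> within {\<mu>. Re \<mu> \<ge> 0})"
      by simp
  qed
  then have "((\<lambda>\<mu>. J \<mu> ?x) \<longlongrightarrow> J \<nu> ?x) (at \<nu> within {\<mu>. Re \<mu> \<ge> 0})"
    by (simp add: LIM_zero_iff)
  then have "((\<lambda>\<mu>. cinner (J \<mu> ?x) h) \<longlongrightarrow> cinner (J \<nu> ?x) h) (at \<nu> within {\<mu>. Re \<mu> \<ge> 0})"
    by (intro tendsto_cinner tendsto_const)
  moreover have "cinner (J \<mu> u) h - cinner (J \<nu> u) h = (\<mu> - \<nu>) * cinner (J \<mu> ?x) h" if "Re \<mu> \<ge> 0" for \<mu>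
    by (simp add: diff[OF that] cinner_scaleC_left flip: cinner_diff_left)
  ultimately show "\<exists>g. (\<forall>\<mu>\<in>{\<mu>. Re \<mu> \<ge> 0}. cinner (J \<mu> u) h - cinner (J \<nu> u) h = (\<mu> - \<nu>) * g \<mu>) \<and>
      (g \<longlongrightarrow> g \<nu>) (at \<nu> within {\<mu>. Re \<mu> \<ge> 0})"
    by (intro exI[of _ "\<lambda>\<mu>. cinner (J \<mu> ?x) h"]) auto
qed

end

section \<open>Reflection argument for solutions on the closed half-plane\<close>

context dissipative_pair
begin

text \<open>The equations are the rows of \<open>(T - \<mu>) (x, y) = (0, w)\<close> carried over to
  \<open>H\<close>. They keep their shape when \<open>S\<close> and \<open>S'\<close> are exchanged,
  so one argument covers both spectral subspaces.\<close>

theorem coordinates_eq_0: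
  assumes r: "0 \<le> r" and s: "0 \<le> s" and rs: "r + s < 1"
    and Pb: "pos_op Pb kb" and Pc: "pos_op Pc kc"
    and eq1: "\<And>\<mu>. Re \<mu> \<ge> 0 \<Longrightarrow> Z (z \<mu>) - \<mu> *\<^sub>C Q r (dual.Q (1 - r) (z \<mu>)) - Pb (Q (1 - r - s) (e \<mu>)) = 0"
    and eq2: "\<And>\<mu>. Re \<mu> \<ge> 0 \<Longrightarrow>
      - Pc (dual.Q (1 - r - s) (z \<mu>)) - dual.Z (e \<mu>) - \<mu> *\<^sub>C dual.Q s (Q (1 - s) (e \<mu>)) = w"
    and holo: "\<And>h. (\<lambda>\<mu>. cinner (z \<mu>) h) holomorphic_on {\<mu>. Re \<mu> \<ge> 0}"
      "\<And>h. (\<lambda>\<mu>. cinner (e \<mu>) h) holomorphic_on {\<mu>. Re \<mu> \<ge> 0}"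
    and bound: "\<And>\<mu>. Re \<mu> > 0 \<Longrightarrow> norm (z \<mu>) \<le> c * (1 + cmod \<mu>)"
      "\<And>\<mu>. Re \<mu> > 0 \<Longrightarrow> norm (e \<mu>) \<le> c * (1 + cmod \<mu>)"
  shows "w = 0"
proof -
  let ?\<delta> = "1 - r - s"
  have \<delta>: "0 \<le> ?\<delta>" "?\<delta> \<le> 1" "0 \<le> 1 - s" "1 - s \<le> 1" "0 \<le> 1 - r" "1 - r \<le> 1" "s \<le> 1" "r \<le> 1"
    using r s rs by auto
  \<comment> \<open>\<open>dual.Q ?\<delta> (z \<mu>)\<close> is the coordinate of \<open>x\<close>
    in the space of index \<open>s\<close>, which is dual to the space represented by
    \<open>w\<close>.\<close>
  define f where "f \<mu> = cinner (dual.Q ?\<delta> (z \<mu>)) w" for \<mu>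
  have f: "f = (\<lambda>\<mu>. cinner (z \<mu>) (dual.Q ?\<delta> w))"
    by (simp only: f_def[abs_def] dual.Q_adj[OF \<delta>(1,2)])
  have f_holo: "f holomorphic_on {\<mu>. Re \<mu> \<ge> 0}"
    unfolding f by (rule holo)
  have f_bound: "cmod (f \<mu>) \<le> c * norm (dual.Q ?\<delta> w) * (1 + cmod \<mu>)" if "Re \<mu> > 0" for \<mu>
  proof -
    have "cmod (f \<mu>) \<le> norm (z \<mu>) * norm (dual.Q ?\<delta> w)"
      unfolding f by (rule cinner_Cauchy_Schwarz)
    also have "\<dots> \<le> (c * (1 + cmod \<mu>)) * norm (dual.Q ?\<delta> w)"
      by (rule mult_right_mono[OF bound(1)[OF that]]) simp
    finally show ?thesis
      by (simp add: mult_ac)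
  qed
  define \<beta> where "\<beta> \<mu> = Re (cinner (Pb (Q ?\<delta> (e \<mu>))) (Q ?\<delta> (e \<mu>)))" for \<mu>
  define \<gamma> where "\<gamma> \<mu> = Re (cinner (Pc (dual.Q ?\<delta> (z \<mu>))) (dual.Q ?\<delta> (z \<mu>)))" for \<mu>
  have \<beta>\<gamma>: "0 \<le> \<beta> \<mu>" "0 \<le> \<gamma> \<mu>" "(norm (Pb (Q ?\<delta> (e \<mu>))))\<^sup>2 \<le> kb * \<beta> \<mu>"
    "(norm (Pc (dual.Q ?\<delta> (z \<mu>))))\<^sup>2 \<le> kc * \<gamma> \<mu>" for \<mu>
    using pos_opD(5,6)[OF Pb] pos_opD(5,6)[OF Pc] by (simp_all add: \<beta>_def \<gamma>_def)
  have f_axis: "f \<mu> = - of_real (\<beta> \<mu> + \<gamma> \<mu>)" if \<mu>: "Re \<mu> = 0" for \<mu>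
  proof -
    have "of_real (\<beta> \<mu>) + of_real (\<gamma> \<mu>) = - f \<mu>"
      using energy_identity[where Pb=Pb and Pc=Pc and z="z \<mu>" and e="e \<mu>", OF r s rs \<mu> eq1 eq2] \<mu> pos_opD(3)[OF Pb, of "Q ?\<delta> (e \<mu>)"]
        pos_opD(4)[OF Pc, of "dual.Q ?\<delta> (z \<mu>)"]
      by (simp add: f_def \<beta>_def \<gamma>_def)
    then show ?thesis
      unfolding of_real_add by (simp only: minus_minus)
  qed
  define f' where "f' \<mu> = cnj (f (- cnj \<mu>))" for \<mu>
  have f_cont: "continuous_on {\<mu>. Re \<mu> \<ge> 0} f"
    by (rule holomorphic_on_imp_continuous_on[OF f_holo])
  have f'_cont: "continuous_on {\<mu>. Re \<mu> \<le> 0} f'"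
  proof -
    have "continuous_on {\<mu>. Re \<mu> \<le> 0} (\<lambda>\<mu>. - cnj \<mu>)"
      by (intro continuous_intros)
    then have "continuous_on {\<mu>. Re \<mu> \<le> 0} (\<lambda>\<mu>. f (- cnj \<mu>))"
      by (rule continuous_on_compose2[OF f_cont]) auto
    then show ?thesis
      unfolding f'_def by (rule continuous_on_cnj)
  qed
  have f'_holo: "f' holomorphic_on {\<mu>. Re \<mu> < 0}"
  proof -
    have "(\<lambda>\<mu>. f (- \<mu>)) holomorphic_on {\<mu>. Re \<mu> < 0}"
      by (rule holomorphic_on_compose_gen[OF _ f_holo, unfolded o_def]) (auto intro!: holomorphic_intros)
    moreover have "cnj ` {\<mu>. Re \<mu> < 0} = {\<mu>. Re \<mu> < 0}"
      by (auto intro!: image_eqI[of _ _ "cnj _"])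
    ultimately have "cnj \<circ> (\<lambda>\<mu>. f (- \<mu>)) \<circ> cnj holomorphic_on {\<mu>. Re \<mu> < 0}"
      by (intro holomorphic_on_compose_cnj_cnj) (simp_all add: open_halfspace_Re_lt)
    then show ?thesis
      by (simp add: f'_def[abs_def] o_def)
  qed
  obtain a b where ab: "\<And>\<mu>. Re \<mu> \<ge> 0 \<Longrightarrow> f \<mu> = a + b * \<mu>"
  proof (rule Liouville_half_planes[OF f_cont f'_cont _ f'_holo])
    show "f holomorphic_on {\<mu>. Re \<mu> > 0}"
      by (rule holomorphic_on_subset[OF f_holo]) auto
    show "f \<mu> = f' \<mu>" if "Re \<mu> = 0" for \<mu>
    proof -
      have "- cnj \<mu> = \<mu>"
        using that by (simp add: complex_eq_iff)
      then show ?thesis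
        by (simp add: f'_def f_axis[OF that])
    qed
    show "cmod (f \<mu>) \<le> c * norm (dual.Q ?\<delta> w) * (1 + cmod \<mu>)" if "0 < Re \<mu>" for \<mu>
      by (rule f_bound[OF that])
    show "cmod (f' \<mu>) \<le> c * norm (dual.Q ?\<delta> w) * (1 + cmod \<mu>)" if "Re \<mu> < 0" for \<mu>
      using f_bound[of "- cnj \<mu>"] that by (simp add: f'_def)
  qed (rule that)
  obtain c' \<epsilon> where \<epsilon>: "\<epsilon> > 0" and c': "\<And>\<mu> z. Re \<mu> \<ge> 0 \<Longrightarrow> \<mu> \<noteq> 0 \<Longrightarrow>
      norm (dual.Q ?\<delta> z) \<le> c' * cmod \<mu> powr - \<epsilon> * norm (Z z - \<mu> *\<^sub>C Q r (dual.Q (1 - r) z))"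
    by (rule resolvent_estimate[OF r s rs]) (rule that)
  have Kz: "norm (dual.Q ?\<delta> (z \<mu>)) \<le> c' * cmod \<mu> powr - \<epsilon> * norm (Pb (Q ?\<delta> (e \<mu>)))"
    if "Re \<mu> \<ge> 0" "\<mu> \<noteq> 0" for \<mu>
    using c'[OF that, of "z \<mu>"] eq1[OF that(1)] by simp
  \<comment> \<open>The energy on the axis and the resolvent estimate bound the square of
    \<open>f\<close> by \<open>\<bar>t\<bar> powr - (2 * \<epsilon>)\<close> times \<open>f\<close>
    in modulus; the zero of \<open>f\<close> is split off so that one factor cancels.\<close>
  have decay: "cmod (a + b * (\<i> * of_real t)) \<le> (c'\<^sup>2 * kb * (norm w)\<^sup>2) * \<bar>t\<bar> powr - (2 * \<epsilon>)" if t: "t \<noteq> 0" for t :: real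
  proof (cases "f (\<i> * of_real t) = 0")
    case True
    then show ?thesis
      using ab[of "\<i> * of_real t"] pos_opD(2)[OF Pb] by simp
  next
    case False
    let ?\<mu> = "\<i> * of_real t"
    have \<mu>: "Re ?\<mu> = 0" "?\<mu> \<noteq> 0" "cmod ?\<mu> = \<bar>t\<bar>"
      using t by (auto simp: norm_mult)
    have fabs: "cmod (f ?\<mu>) = \<beta> ?\<mu> + \<gamma> ?\<mu>"
      unfolding f_axis[OF \<mu>(1)] norm_minus_cancel norm_of_real using \<beta>\<gamma>[of ?\<mu>] by simp
    let ?p = "\<bar>t\<bar> powr - \<epsilon>"
    have "(cmod (f ?\<mu>))\<^sup>2 \<le> (norm (dual.Q ?\<delta> (z ?\<mu>)) * norm w)\<^sup>2"
      unfolding f_def by (rule power_mono[OF cinner_Cauchy_Schwarz]) simp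
    also have "\<dots> \<le> (c' * ?p * norm (Pb (Q ?\<delta> (e ?\<mu>))) * norm w)\<^sup>2"
      using Kz[of ?\<mu>] \<mu> by (intro power_mono mult_right_mono) auto
    also have "\<dots> = (c'\<^sup>2 * (norm w)\<^sup>2 * ?p\<^sup>2) * (norm (Pb (Q ?\<delta> (e ?\<mu>))))\<^sup>2"
      by (simp add: power_mult_distrib)
    also have "\<dots> \<le> (c'\<^sup>2 * (norm w)\<^sup>2 * ?p\<^sup>2) * (kb * cmod (f ?\<mu>))"
    proof (rule mult_left_mono)
      show "(norm (Pb (Q ?\<delta> (e ?\<mu>))))\<^sup>2 \<le> kb * cmod (f ?\<mu>)"
        using \<beta>\<gamma>[of ?\<mu>] pos_opD(2)[OF Pb] unfolding fabs
        by (smt (verit, best) mult_left_mono)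
    qed simp
    finally have "cmod (f ?\<mu>) * cmod (f ?\<mu>) \<le> (c'\<^sup>2 * kb * (norm w)\<^sup>2 * ?p\<^sup>2) * cmod (f ?\<mu>)"
      by (simp add: power2_eq_square mult_ac)
    then have "cmod (f ?\<mu>) \<le> c'\<^sup>2 * kb * (norm w)\<^sup>2 * ?p\<^sup>2"
      by (rule mult_right_le_imp_le) (use False in simp)
    moreover have "?p\<^sup>2 = \<bar>t\<bar> powr - (2 * \<epsilon>)"
      using t by (simp add: power2_eq_square flip: powr_add)
    ultimately show ?thesis
      using ab[of ?\<mu>] by simp
  qed
  have "a = 0" "b = 0"
    using linear_function_decay_eq_0[OF _ decay] \<epsilon> by auto
  then have f_0: "\<beta> \<mu> = 0" "\<gamma> \<mu> = 0" if "Re \<mu> = 0" for \<mu>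
    using ab[of \<mu>] f_axis[OF that] \<beta>\<gamma>(1,2)[of \<mu>] that by (auto simp flip: of_real_add)
  have Pb_0: "Pb (Q ?\<delta> (e \<mu>)) = 0" and Pc_0: "Pc (dual.Q ?\<delta> (z \<mu>)) = 0" if "Re \<mu> = 0" for \<mu>
    using \<beta>\<gamma>(3,4)[of \<mu>] by (simp_all add: f_0[OF that])
  \<comment> \<open>\<open>w2\<close> is the inverse of \<open>A*\<close> applied to the functional
    behind \<open>w\<close>, an honest vector of \<open>H\<close>. On the axis, where the term of
    \<open>C\<close> has vanished, the second row reads \<open>(A* + \<mu>) y = - w\<close>.\<close>
  define w2 where "w2 = Q (1 - s) (dual.Zi w)"
  define y where "y \<mu> = Q (1 - s) (e \<mu>)" for \<mu>
  have y_eq: "y \<mu> + \<mu> *\<^sub>C S' (y \<mu>) = - w2" if \<mu>: "Re \<mu> = 0" for \<mu>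
  proof -
    note lin = bounded_clinear_simps[OF dual.bounded_clinear_Zi] bounded_clinear_simps[OF bounded_clinear_Q[OF \<delta>(3,4)]]
    have "w = - dual.Z (e \<mu>) - \<mu> *\<^sub>C dual.Q s (y \<mu>)"
      using eq2[of \<mu>] \<mu> by (simp add: Pc_0 y_def)
    then have "w2 = Q (1 - s) (dual.Zi (- dual.Z (e \<mu>) - \<mu> *\<^sub>C dual.Q s (y \<mu>)))"
      by (simp add: w2_def)
    also have "\<dots> = - y \<mu> - \<mu> *\<^sub>C Q (1 - s) (dual.Zi (dual.Q s (y \<mu>)))"
      by (simp add: lin dual.Zi_Z y_def)
    also have "Q (1 - s) (dual.Zi (dual.Q s (y \<mu>))) = S' (y \<mu>)"
      using s \<delta> by (simp add: dual.Zi_Q Q_add Q_1 dual.F_Zi)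
    finally show ?thesis
      by simp
  qed
  have y_J: "y \<mu> = dual.J (- \<mu>) (- w2)" if "Re \<mu> = 0" for \<mu>
    using dual.J_1_sub[of "- \<mu>" "y \<mu>"] y_eq[OF that] that by (simp add: complex_vector.scale_minus_left)
  have "cinner (y \<i>) h = cinner (y 0) h" for h
  proof -
    \<comment> \<open>\<open>g1\<close> comes from the Hamiltonian on the right half-plane,
      \<open>g2\<close> from \<open>-A*\<close> on the left one; they agree on the axis, where the
      second row is decoupled.\<close>
    define g1 where "g1 \<mu> = cinner (e \<mu>) (Q (1 - s) h)" for \<mu>
    define g2 where "g2 \<mu> = cinner (dual.J (- \<mu>) (- w2)) h" for \<mu>
    have g1: "g1 \<mu> = cinner (y \<mu>) h" for \<mu>
      by (simp only: g1_def y_def Q_adj[OF \<delta>(3,4)])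
    have g1_holo: "g1 holomorphic_on {\<mu>. Re \<mu> \<ge> 0}"
      unfolding g1_def by (rule holo)
    have g2_holo: "g2 holomorphic_on {\<mu>. Re \<mu> \<le> 0}"
      unfolding g2_def
      by (rule holomorphic_on_compose_gen[OF _ dual.holomorphic_J, unfolded o_def]) (auto intro!: holomorphic_intros)
    define D where "D = \<bar>c\<bar> * norm (Q (1 - s) h) + \<bar>M\<bar> * norm w2 * norm h"
    have g2_bound: "cmod (g2 \<mu>) \<le> D" if "Re \<mu> \<le> 0" for \<mu>
    proof -
      have "cmod (g2 \<mu>) \<le> norm (dual.J (- \<mu>) (- w2)) * norm h"
        unfolding g2_def by (rule cinner_Cauchy_Schwarz)
      also have "\<dots> \<le> (\<bar>M\<bar> * norm w2) * norm h"
      proof (rule mult_right_mono)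
        have "norm (dual.J (- \<mu>) (- w2)) \<le> M * norm (- w2)"
          using that by (intro dual.norm_J_le) simp
        also have "\<dots> \<le> \<bar>M\<bar> * norm (- w2)"
          by (rule mult_right_mono) auto
        finally show "norm (dual.J (- \<mu>) (- w2)) \<le> \<bar>M\<bar> * norm w2"
          by simp
      qed simp
      also have "\<dots> \<le> D"
        by (simp add: D_def)
      finally show ?thesis .
    qed
    have "D \<ge> 0"
      by (simp add: D_def)
    obtain a b where ab: "\<And>\<mu>. Re \<mu> \<ge> 0 \<Longrightarrow> g1 \<mu> = a + b * \<mu>" "\<And>\<mu>. Re \<mu> \<le> 0 \<Longrightarrow> g2 \<mu> = a + b * \<mu>"
    proof (rule Liouville_half_planes[OF holomorphic_on_imp_continuous_on[OF g1_holo]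
          holomorphic_on_imp_continuous_on[OF g2_holo]])
      show "g1 holomorphic_on {\<mu>. Re \<mu> > 0}"
        by (rule holomorphic_on_subset[OF g1_holo]) auto
      show "g2 holomorphic_on {\<mu>. Re \<mu> < 0}"
        by (rule holomorphic_on_subset[OF g2_holo]) auto
      show "g1 \<mu> = g2 \<mu>" if "Re \<mu> = 0" for \<mu>
        by (simp add: g1 g2_def y_J[OF that])
      show "cmod (g1 \<mu>) \<le> D * (1 + cmod \<mu>)" if "0 < Re \<mu>" for \<mu>
      proof -
        have "cmod (g1 \<mu>) \<le> norm (e \<mu>) * norm (Q (1 - s) h)"
          unfolding g1_def by (rule cinner_Cauchy_Schwarz)
        also have "norm (e \<mu>) \<le> \<bar>c\<bar> * (1 + cmod \<mu>)"
          by (rule order_trans[OF bound(2)[OF that] mult_right_mono[OF abs_ge_self]]) simp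
        then have "norm (e \<mu>) * norm (Q (1 - s) h) \<le> (\<bar>c\<bar> * (1 + cmod \<mu>)) * norm (Q (1 - s) h)"
          by (rule mult_right_mono) simp
        also have "\<dots> \<le> D * (1 + cmod \<mu>)"
          by (simp add: D_def mult_ac distrib_left distrib_right)
        finally show ?thesis .
      qed
      show "cmod (g2 \<mu>) \<le> D * (1 + cmod \<mu>)" if "Re \<mu> < 0" for \<mu>
        using g2_bound[of \<mu>] that \<open>D \<ge> 0\<close> mult_left_mono[of 1 "1 + cmod \<mu>" D] by simp
    qed (rule that)
    \<comment> \<open>\<open>g2\<close> is bounded on the left half-plane, so the common affine
      function is constant.\<close>
    have "b = 0"
      by (rule bounded_linear_function_eq_0[of a _ D]) (use ab(2) g2_bound in \<open>simp flip: ab(2)\<close>)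
    then show ?thesis
      using ab(1)[of \<i>] ab(1)[of 0] by (simp add: g1)
  qed
  then have "y \<i> = y 0"
    by (rule cinner_ext)
  moreover have "y \<i> + \<i> *\<^sub>C S' (y \<i>) = - w2" "y 0 = - w2"
    using y_eq[of \<i>] y_eq[of 0] by simp_all
  \<comment> \<open>The same \<open>y\<close> solves the equation at \<open>\<i>\<close> and at
    \<open>0\<close>, so the two equations differ by \<open>\<i> S' y\<close> with
    \<open>y = - w2\<close>.\<close>
  ultimately have "\<i> *\<^sub>C S' w2 = 0" 
    by (simp add: bounded_clinear_minus[OF S'])
  then have "w2 = 0"
    using S'_0 by (simp add: complex_vector.scale_eq_0_iff)
  then have "dual.Zi w = 0"
    using Q_eq_0[OF \<delta>(3,4)] by (simp add: w2_def)
  then show "w = 0"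
    using dual.Z_Zi[of w] bounded_clinear_zero[OF dual.bounded_clinear_Z] by simp
qed

end

section \<open>Holomorphy of the restricted resolvent\<close>

lemma linear_opD:
  assumes "linear_op T"
  shows "complex_vector.subspace (opdom T)"
    "x \<in> opdom T \<Longrightarrow> y \<in> opdom T \<Longrightarrow> app T (x + y) = app T x + app T y"
    "x \<in> opdom T \<Longrightarrow> app T (a *\<^sub>C x) = a *\<^sub>C app T x"
    "x \<in> opdom T \<Longrightarrow> y \<in> opdom T \<Longrightarrow> app T (x - y) = app T x - app T y"
proof -
  show sub: "complex_vector.subspace (opdom T)"
    and "x \<in> opdom T \<Longrightarrow> y \<in> opdom T \<Longrightarrow> app T (x + y) = app T x + app T y"
    and "x \<in> opdom T \<Longrightarrow> app T (a *\<^sub>C x) = a *\<^sub>C app T x"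
    using assms by (simp_all add: linear_op_def)
  show "app T (x - y) = app T x - app T y" if xy: "x \<in> opdom T" "y \<in> opdom T"
  proof -
    have "(- 1) *\<^sub>C y \<in> opdom T"
      by (rule complex_vector.subspace_scale[OF sub xy(2)])
    then have "app T (x + (- 1) *\<^sub>C y) = app T x + app T ((- 1) *\<^sub>C y)"
      using assms xy(1) unfolding linear_op_def by blast
    also have "app T ((- 1) *\<^sub>C y) = (- 1) *\<^sub>C app T y"
      using assms xy(2) unfolding linear_op_def by blast
    finally show ?thesis
      by simp
  qed
qed

lemma
  assumes "\<mu> \<in> resolvent_set_on V T" "v \<in> V"
  shows resolvent_in_opdom: "resolvent T \<mu> v \<in> opdom T"
    and resolvent_eq: "app T (resolvent T \<mu> v) - \<mu> *\<^sub>C resolvent T \<mu> v = v"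
proof -
  have "bij_betw (\<lambda>x. app T x - \<mu> *\<^sub>C x) (opdom T) V"
    using assms(1) by (simp add: resolvent_set_on_def)
  then have *: "v \<in> (\<lambda>x. app T x - \<mu> *\<^sub>C x) ` opdom T"
    using assms(2) by (simp add: bij_betw_def)
  show "resolvent T \<mu> v \<in> opdom T"
    unfolding resolvent_def by (rule inv_into_into[OF *])
  show "app T (resolvent T \<mu> v) - \<mu> *\<^sub>C resolvent T \<mu> v = v"
    unfolding resolvent_def by (rule f_inv_into_f[OF *])
qed

lemma resolvent_unique:
  assumes "\<mu> \<in> resolvent_set_on V T" "x \<in> opdom T"
  shows "resolvent T \<mu> (app T x - \<mu> *\<^sub>C x) = x"
  using assms inv_into_f_f[of "\<lambda>x. app T x - \<mu> *\<^sub>C x" "opdom T" x]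
  by (simp add: resolvent_set_on_def bij_betw_def resolvent_def)

lemma resolvent_bound:
  assumes "\<mu> \<in> resolvent_set_on V T"
  obtains c where "c > 0" "\<And>v. v \<in> V \<Longrightarrow> norm (resolvent T \<mu> v) \<le> c * norm v"
proof -
  obtain c where c: "\<And>v. v \<in> V \<Longrightarrow> norm (resolvent T \<mu> v) \<le> c * norm v"
    using assms by (auto simp: resolvent_set_on_def)
  have "norm (resolvent T \<mu> v) \<le> (\<bar>c\<bar> + 1) * norm v" if "v \<in> V" for v
    by (rule order_trans[OF c[OF that] mult_right_mono]) auto
  then show ?thesis
    by (rule that[of "\<bar>c\<bar> + 1", rotated]) auto
qed

lemma resolvent_identity:
  assumes T: "linear_op T" and V: "complex_vector.subspace V" "opdom T \<subseteq> V"
    and \<mu>: "\<mu> \<in> resolvent_set_on V T" and \<nu>: "\<nu> \<in> resolvent_set_on V T" and v: "v \<in> V"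
  shows "resolvent T \<mu> v - resolvent T \<nu> v = (\<mu> - \<nu>) *\<^sub>C resolvent T \<mu> (resolvent T \<nu> v)"
proof -
  note lin = linear_opD[OF T]
  let ?p = "resolvent T \<mu> v" and ?q = "resolvent T \<nu> v"
  have q: "?q \<in> opdom T" "app T ?q - \<nu> *\<^sub>C ?q = v"
    by (rule resolvent_in_opdom[OF \<nu> v], rule resolvent_eq[OF \<nu> v])
  have p: "?p \<in> opdom T" "app T ?p - \<mu> *\<^sub>C ?p = v"
    by (rule resolvent_in_opdom[OF \<mu> v], rule resolvent_eq[OF \<mu> v])
  have qV: "?q \<in> V"
    using q(1) V(2) by blast
  let ?x = "resolvent T \<mu> ?q"
  have x: "?x \<in> opdom T" "app T ?x - \<mu> *\<^sub>C ?x = ?q"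
    by (rule resolvent_in_opdom[OF \<mu> qV], rule resolvent_eq[OF \<mu> qV])
  let ?y = "?q + (\<mu> - \<nu>) *\<^sub>C ?x"
  have sx: "(\<mu> - \<nu>) *\<^sub>C ?x \<in> opdom T"
    using lin(1) x(1) by (rule complex_vector.subspace_scale)
  then have y: "?y \<in> opdom T"
    using lin(1) q(1) by (simp add: complex_vector.subspace_add)
  have "app T ?y - \<mu> *\<^sub>C ?y = (app T ?q - \<mu> *\<^sub>C ?q) + (\<mu> - \<nu>) *\<^sub>C (app T ?x - \<mu> *\<^sub>C ?x)"
    by (simp add: lin(2)[OF q(1) sx] lin(3)[OF x(1)] complex_vector.scale_right_diff_distrib
        complex_vector.scale_right_distrib mult.commute)
  also have "\<dots> = app T ?q - \<nu> *\<^sub>C ?q"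
    unfolding x(2) by (simp add: complex_vector.scale_left_diff_distrib)
  finally have "?y = ?p"
    using resolvent_unique[OF \<mu> y] by (simp add: q(2))
  then show ?thesis
    by (metis add_diff_cancel_left')
qed

text \<open>\<open>l\<close> is linear and bounded on \<open>V\<close> only, because the coordinates
  to which it is applied are defined only there.\<close>

lemma holomorphic_resolvent:
  assumes T: "linear_op T" and V: "complex_vector.subspace V" "opdom T \<subseteq> V"
    and U: "U \<subseteq> resolvent_set_on V T" and v: "v \<in> V"
    and l: "\<And>x y. x \<in> V \<Longrightarrow> y \<in> V \<Longrightarrow> l (x + y) = l x + l y"
      "\<And>a x. x \<in> V \<Longrightarrow> l (a *\<^sub>C x) = a * l x"
      "\<And>x. x \<in> V \<Longrightarrow> cmod (l x) \<le> K * norm x"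
  shows "(\<lambda>\<mu>. l (resolvent T \<mu> v)) holomorphic_on U"
proof (rule holomorphic_on_quotientI)
  fix \<nu> assume \<nu>: "\<nu> \<in> U"
  let ?R = "resolvent T"
  have RV: "?R \<mu> x \<in> V" if "\<mu> \<in> U" "x \<in> V" for \<mu> x
    using resolvent_in_opdom[of \<mu> V T x] that U V(2) by blast
  have l_diff: "l x - l y = l (x - y)" if "x \<in> V" "y \<in> V" for x y
    using l(1)[of "x - y" y] complex_vector.subspace_diff[OF V(1) that] that by simp
  obtain c where c: "c > 0" "\<And>x. x \<in> V \<Longrightarrow> norm (?R \<nu> x) \<le> c * norm x"
    by (rule resolvent_bound[of \<nu> V T]) (use \<nu> U that in auto)
  have ident: "?R \<mu> x - ?R \<nu> x = (\<mu> - \<nu>) *\<^sub>C ?R \<mu> (?R \<nu> x)" "?R \<nu> x - ?R \<mu> x = (\<nu> - \<mu>) *\<^sub>C ?R \<nu> (?R \<mu> x)"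
    if "\<mu> \<in> U" "x \<in> V" for \<mu> x
    using resolvent_identity[OF T V _ _ that(2)] that(1) \<nu> U by blast+
  let ?q = "?R \<nu> v"
  have q: "?q \<in> V"
    by (rule RV[OF \<nu> v])
  \<comment> \<open>The identity with \<open>\<mu>\<close> and \<open>\<nu>\<close> exchanged puts
    the resolvent at the fixed \<open>\<nu>\<close> outside, so its bound \<open>c\<close> suffices;
    near \<open>\<nu>\<close> the unknown norm at \<open>\<mu>\<close> is absorbed.\<close>
  have close: "norm (?R \<mu> ?q - ?R \<nu> ?q) \<le> cmod (\<mu> - \<nu>) * (c * (2 * norm (?R \<nu> ?q)))"
    if \<mu>: "\<mu> \<in> U" "cmod (\<mu> - \<nu>) * c \<le> 1 / 2" for \<mu>
  proof -
    have "norm (?R \<mu> ?q - ?R \<nu> ?q) = cmod (\<mu> - \<nu>) * norm (?R \<nu> (?R \<mu> ?q))"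
      using ident(2)[OF \<mu>(1) q] by (metis norm_minus_commute norm_scaleC)
    also have "\<dots> \<le> cmod (\<mu> - \<nu>) * (c * norm (?R \<mu> ?q))"
      by (intro mult_left_mono c(2) RV \<mu>(1) q) simp
    finally have *: "norm (?R \<mu> ?q - ?R \<nu> ?q) \<le> cmod (\<mu> - \<nu>) * (c * norm (?R \<mu> ?q))" .
    have "cmod (\<mu> - \<nu>) * c * norm (?R \<mu> ?q) \<le> 1 / 2 * norm (?R \<mu> ?q)"
      by (rule mult_right_mono[OF \<mu>(2)]) simp
    then have "norm (?R \<mu> ?q) \<le> 2 * norm (?R \<nu> ?q)"
      using * norm_triangle_sub[of "?R \<mu> ?q" "?R \<nu> ?q"] by (simp add: mult.assoc)
    then have "cmod (\<mu> - \<nu>) * (c * norm (?R \<mu> ?q)) \<le> cmod (\<mu> - \<nu>) * (c * (2 * norm (?R \<nu> ?q)))"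
      using c(1) by (intro mult_left_mono) auto
    with * show ?thesis
      by linarith
  qed
  have lim: "((\<lambda>\<mu>. cmod (\<mu> - \<nu>) * x) \<longlongrightarrow> 0) (at \<nu> within U)" for x
  proof -
    have "((\<lambda>\<mu>. cmod (\<mu> - \<nu>) * x) \<longlongrightarrow> cmod (\<nu> - \<nu>) * x) (at \<nu> within U)"
      by (intro tendsto_intros)
    then show ?thesis
      by simp
  qed
  have ev: "\<forall>\<^sub>F \<mu> in at \<nu> within U. \<mu> \<in> U \<and> cmod (\<mu> - \<nu>) * c < 1 / 2"
    by (intro eventually_conj order_tendstoD(2)[OF lim]) (auto simp: eventually_at_filter)
  have "((\<lambda>\<mu>. l (?R \<mu> ?q) - l (?R \<nu> ?q)) \<longlongrightarrow> 0) (at \<nu> within U)"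
  proof (rule Lim_null_comparison)
    show "\<forall>\<^sub>F \<mu> in at \<nu> within U. norm (l (?R \<mu> ?q) - l (?R \<nu> ?q))
        \<le> cmod (\<mu> - \<nu>) * (\<bar>K\<bar> * (c * (2 * norm (?R \<nu> ?q))))"
      using ev
    proof eventually_elim
      case (elim \<mu>)
      have "cmod (l (?R \<mu> ?q) - l (?R \<nu> ?q)) = cmod (l (?R \<mu> ?q - ?R \<nu> ?q))"
        using elim \<nu> q by (simp add: l_diff RV)
      also have "\<dots> \<le> K * norm (?R \<mu> ?q - ?R \<nu> ?q)"
        using elim \<nu> q v by (intro l(3) complex_vector.subspace_diff[OF V(1)] RV) auto
      also have "\<dots> \<le> \<bar>K\<bar> * (cmod (\<mu> - \<nu>) * (c * (2 * norm (?R \<nu> ?q))))"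
        using elim close[of \<mu>] by (intro mult_mono) auto
      finally show ?case
        by (simp add: mult_ac)
    qed
  qed (rule lim)
  then have "((\<lambda>\<mu>. l (?R \<mu> ?q)) \<longlongrightarrow> l (?R \<nu> ?q)) (at \<nu> within U)"
    by (simp add: LIM_zero_iff)
  moreover have "l (?R \<mu> v) - l (?R \<nu> v) = (\<mu> - \<nu>) * l (?R \<mu> ?q)" if "\<mu> \<in> U" for \<mu>
    using that \<nu> v q by (simp add: l_diff RV ident(1) l(2))
  ultimately show "\<exists>g. (\<forall>\<mu>\<in>U. l (?R \<mu> v) - l (?R \<nu> v) = (\<mu> - \<nu>) * g \<mu>) \<and> (g \<longlongrightarrow> g \<nu>) (at \<nu> within U)"
    by (intro exI[of _ "\<lambda>\<mu>. l (?R \<mu> ?q)"]) auto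
qed

section \<open>A priori estimate and the resolvent in coordinates\<close>

context dissipative_pair
begin

text \<open>The Hamiltonian is bounded below in the graph norm: the energy identity at
  \<open>\<mu> = 0\<close> bounds the squares of the \<open>B\<close> and \<open>C\<close> terms by
  data times solution, which the inequality of means absorbs. It also makes the coordinates of a
  preimage unique.\<close>

lemma a_priori_estimate:
  assumes r: "0 \<le> r" and s: "0 \<le> s" and rs: "r + s < 1"
    and Pb: "pos_op Pb kb" and Pc: "pos_op Pc kc"
  obtains c where "c > 0"
    "\<And>z e a d. Z z - Pb (Q (1 - r - s) e) = a \<Longrightarrow> - Pc (dual.Q (1 - r - s) z) - dual.Z e = d \<Longrightarrow>
      norm z + norm e \<le> c * (norm a + norm d)"
proof -
  let ?\<delta> = "1 - r - s"
  have \<delta>: "0 \<le> ?\<delta>" "?\<delta> \<le> 1"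
    using assms by auto
  obtain k1 where k1: "k1 > 0" "\<And>x. norm (Zi x) \<le> k1 * norm x"
    by (rule bounded_clinear_bound[OF bounded_clinear_Zi]) (rule that)
  obtain k2 where k2: "k2 > 0" "\<And>x. norm (dual.Zi x) \<le> k2 * norm x"
    by (rule bounded_clinear_bound[OF dual.bounded_clinear_Zi]) (rule that)
  obtain q1 where q1: "q1 > 0" "\<And>x. norm (Q ?\<delta> x) \<le> q1 * norm x"
    by (rule bounded_clinear_bound[OF bounded_clinear_Q[OF \<delta>]]) (rule that)
  obtain q2 where q2: "q2 > 0" "\<And>x. norm (dual.Q ?\<delta> x) \<le> q2 * norm x"
    by (rule bounded_clinear_bound[OF dual.bounded_clinear_Q[OF \<delta>]]) (rule that)
  define k where "k = k1 + k2"
  define q where "q = q1 + q2"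
  define \<kappa> where "\<kappa> = kb + kc"
  have pos: "k > 0" "q > 0" "\<kappa> > 0" "kb > 0" "kc > 0"
    using k1 k2 q1 q2 pos_opD(2)[OF Pb] pos_opD(2)[OF Pc] by (auto simp: k_def q_def \<kappa>_def)
  have k: "norm (Zi x) \<le> k * norm x" "norm (dual.Zi x) \<le> k * norm x" for x
    using order_trans[OF k1(2) mult_right_mono[of k1 k "norm x"]]
      order_trans[OF k2(2) mult_right_mono[of k2 k "norm x"]] k1(1) k2(1) by (auto simp: k_def)
  have q: "norm (Q ?\<delta> x) \<le> q * norm x" "norm (dual.Q ?\<delta> x) \<le> q * norm x" for x
    using order_trans[OF q1(2) mult_right_mono[of q1 q "norm x"]]
      order_trans[OF q2(2) mult_right_mono[of q2 q "norm x"]] q1(1) q2(1) by (auto simp: q_def)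
  have "norm z + norm e \<le> (2 * k + 4 * (k\<^sup>2 * \<kappa> * q)) * (norm a + norm d)"
    if 1: "Z z - Pb (Q ?\<delta> e) = a" and 2: "- Pc (dual.Q ?\<delta> z) - dual.Z e = d" for z e a d
  proof -
    define m where "m = norm a + norm d"
    define n where "n = norm z + norm e"
    define \<beta> where "\<beta> = Re (cinner (Pb (Q ?\<delta> e)) (Q ?\<delta> e))"
    define \<gamma> where "\<gamma> = Re (cinner (Pc (dual.Q ?\<delta> z)) (dual.Q ?\<delta> z))"
    have mn: "m \<ge> 0" "n \<ge> 0"
      by (auto simp: m_def n_def)
    have \<beta>\<gamma>: "0 \<le> \<beta>" "0 \<le> \<gamma>" "(norm (Pb (Q ?\<delta> e)))\<^sup>2 \<le> kb * \<beta>" "(norm (Pc (dual.Q ?\<delta> z)))\<^sup>2 \<le> kc * \<gamma>"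
      using pos_opD(5,6)[OF Pb] pos_opD(5,6)[OF Pc] by (simp_all add: \<beta>_def \<gamma>_def)
    have "cinner (Pb (Q ?\<delta> e)) (Q ?\<delta> e) + cinner (dual.Q ?\<delta> z) (Pc (dual.Q ?\<delta> z))
        = - cinner a (Q ?\<delta> e) - cinner (dual.Q ?\<delta> z) d"
      by (rule energy_identity[OF r s rs, where \<mu>=0]) (use 1 2 in auto)
    then have "\<beta> + \<gamma> = Re (- cinner a (Q ?\<delta> e) - cinner (dual.Q ?\<delta> z) d)"
      by (simp add: \<beta>_def \<gamma>_def Re_cinner_commute[of "Pc _"]) (metis plus_complex.sel(1) minus_complex.sel(1) uminus_complex.sel(1))
    also have "\<dots> \<le> cmod (cinner a (Q ?\<delta> e)) + cmod (cinner (dual.Q ?\<delta> z) d)"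
      using abs_Re_le_cmod[of "cinner a (Q ?\<delta> e)"] abs_Re_le_cmod[of "cinner (dual.Q ?\<delta> z) d"] by simp
    also have "\<dots> \<le> norm a * (q * norm e) + (q * norm z) * norm d"
      by (intro add_mono order_trans[OF cinner_Cauchy_Schwarz] mult_left_mono mult_right_mono q) auto
    also have "\<dots> \<le> q * (m * n)"
      using pos(2) by (simp add: m_def n_def algebra_simps)
    finally have sum: "\<beta> + \<gamma> \<le> q * (m * n)" .
    \<comment> \<open>With weight 1/4 the two applications cost \<open>n / 2\<close>, which is
      absorbed on the left; doubling the rest produces the constant claimed.\<close>
    have AM_GM: "k * X \<le> n / 4 + k\<^sup>2 * \<kappa> * q * m" if "X\<^sup>2 \<le> \<kappa> * (q * (m * n))" for X :: real
    proof (rule power2_le_imp_le)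
      have "(k * X)\<^sup>2 \<le> k\<^sup>2 * (\<kappa> * (q * (m * n)))"
        using that by (simp add: power_mult_distrib mult_left_mono)
      also have "\<dots> = 4 * ((n / 4) * (k\<^sup>2 * \<kappa> * q * m))"
        by simp
      also have "\<dots> \<le> (n / 4 + k\<^sup>2 * \<kappa> * q * m)\<^sup>2"
        using sum_squares_bound[of "n / 4" "k\<^sup>2 * \<kappa> * q * m"] by (simp add: power2_sum)
      finally show "(k * X)\<^sup>2 \<le> (n / 4 + k\<^sup>2 * \<kappa> * q * m)\<^sup>2" .
    qed (use mn pos in auto)
    have "(norm (Pb (Q ?\<delta> e)))\<^sup>2 \<le> \<kappa> * (q * (m * n))"
      by (rule order_trans[OF \<beta>\<gamma>(3) mult_mono]) (use sum \<beta>\<gamma>(1,2) pos mn in \<open>auto simp: \<kappa>_def\<close>)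
    note Pb_le = AM_GM[OF this]
    have "(norm (Pc (dual.Q ?\<delta> z)))\<^sup>2 \<le> \<kappa> * (q * (m * n))"
      by (rule order_trans[OF \<beta>\<gamma>(4) mult_mono]) (use sum \<beta>\<gamma>(1,2) pos mn in \<open>auto simp: \<kappa>_def\<close>)
    note Pc_le = AM_GM[OF this]
    have "z = Zi (a + Pb (Q ?\<delta> e))"
      using 1 Zi_Z[of z] by (metis diff_add_cancel)
    then have "norm z \<le> k * norm a + k * norm (Pb (Q ?\<delta> e))"
      using order_trans[OF k(1) mult_left_mono[OF norm_triangle_ineq]] pos(1) by (simp add: distrib_left)
    moreover have "e = dual.Zi (- d - Pc (dual.Q ?\<delta> z))"
      using dual.Zi_Z[of e] by (simp flip: 2)
    then have "norm e \<le> k * norm d + k * norm (Pc (dual.Q ?\<delta> z))"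
      using order_trans[OF k(2) mult_left_mono[OF norm_triangle_ineq4[of "- d" "Pc (dual.Q ?\<delta> z)"]]] pos(1)
      by (simp add: distrib_left)
    ultimately have "n \<le> k * m + (n / 2 + 2 * (k\<^sup>2 * \<kappa> * q * m))"
      using Pb_le Pc_le by (simp add: n_def m_def distrib_left)
    then have "n \<le> (2 * k + 4 * (k\<^sup>2 * \<kappa> * q)) * m"
      by (simp add: distrib_right)
    then show ?thesis
      by (simp add: n_def m_def)
  qed
  moreover have "2 * k + 4 * (k\<^sup>2 * \<kappa> * q) > 0"
    using pos by (simp add: add_pos_pos)
  ultimately show ?thesis
    using that by blast
qed

end

text \<open>\<open>u \<mapsto> (z, e)\<close> below are the coordinates of the inverse of \<open>T\<close>, restricted to \<open>V\<close>; the coordinates of the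
  resolvent at \<open>\<mu>\<close> are then those of \<open>T\<inverse> (u + \<mu> (T - \<mu>)\<inverse> u)\<close>.\<close>

locale hamiltonian_coordinates = dissipative_pair S S' M
  for S S' :: "'h::{complex_hilbert, second_countable_topology} \<Rightarrow> 'h" and M +
  fixes r s kb kc :: real and Pb Pc :: "'h \<Rightarrow> 'h"
    and Jr :: "'v::complex_banach \<Rightarrow> 'h" and Js :: "'w::complex_banach \<Rightarrow> 'h"
    and \<Psi>1 :: "'h \<Rightarrow> 'v" and \<Psi>2 :: "'h \<Rightarrow> 'w"
    and T :: "('v \<times> 'w, 'v \<times> 'w) unbounded_op"
  assumes r: "0 \<le> r" and s: "0 \<le> s" and rs: "r + s < 1"
    and Pb: "pos_op Pb kb" and Pc: "pos_op Pc kc"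
    and Jr: "bounded_clinear Jr" "inj Jr" and Js: "bounded_clinear Js" "inj Js"
    and Jr_\<Psi>: "Jr (\<Psi>1 z) = Q r (dual.Q (1 - r) z)" and Js_\<Psi>: "Js (\<Psi>2 e) = dual.Q s (Q (1 - s) e)"
    and dom: "opdom T = range \<Psi>1 \<times> range \<Psi>2"
    and Jr_T: "Jr (fst (app T (\<Psi>1 z, \<Psi>2 e))) = Z z - Pb (Q (1 - r - s) e)"
    and Js_T: "Js (snd (app T (\<Psi>1 z, \<Psi>2 e))) = - Pc (dual.Q (1 - r - s) z) - dual.Z e"
begin

text \<open>The graph norm is recovered from the norm of V0 by going through the inverse of
  \<open>T\<close>, which costs the factor \<open>1 + cmod \<mu>\<close>. \<open>U\<close> is the
  closed half-plane of the equations, \<open>U'\<close> the open one where the dichotomy gives its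
  bound.\<close>

lemma coordinates_resolvent:
  assumes V: "complex_vector.subspace V" and u: "u \<in> V"
    and U: "U \<subseteq> resolvent_set_on V (op_restrict T V)" "0 \<in> U" "U' \<subseteq> U"
    and bound: "\<And>\<mu>. \<mu> \<in> U' \<Longrightarrow> norm (resolvent (op_restrict T V) \<mu> u) \<le> N"
  obtains z e c where
    "\<And>\<mu>. \<mu> \<in> U \<Longrightarrow> Z (z \<mu>) - \<mu> *\<^sub>C Q r (dual.Q (1 - r) (z \<mu>)) - Pb (Q (1 - r - s) (e \<mu>)) = Jr (fst u)"
    "\<And>\<mu>. \<mu> \<in> U \<Longrightarrow> - Pc (dual.Q (1 - r - s) (z \<mu>)) - dual.Z (e \<mu>) - \<mu> *\<^sub>C dual.Q s (Q (1 - s) (e \<mu>)) = Js (snd u)"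
    "\<And>h. (\<lambda>\<mu>. cinner (z \<mu>) h) holomorphic_on U" "\<And>h. (\<lambda>\<mu>. cinner (e \<mu>) h) holomorphic_on U"
    "\<And>\<mu>. \<mu> \<in> U' \<Longrightarrow> norm (z \<mu>) \<le> c * (1 + cmod \<mu>)" "\<And>\<mu>. \<mu> \<in> U' \<Longrightarrow> norm (e \<mu>) \<le> c * (1 + cmod \<mu>)"
proof -
  let ?\<delta> = "1 - r - s"
  let ?T = "op_restrict T V"
  have \<delta>: "0 \<le> ?\<delta>" "?\<delta> \<le> 1" "0 \<le> 1 - s" "1 - s \<le> 1" "0 \<le> 1 - r" "1 - r \<le> 1" "s \<le> 1" "r \<le> 1"
    using r s rs by auto
  note lin = bounded_clinear_simps[OF Jr(1)] bounded_clinear_simps[OF Js(1)]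
    bounded_clinear_simps[OF bounded_clinear_Q[OF r \<delta>(8)]] bounded_clinear_simps[OF dual.bounded_clinear_Q[OF s \<delta>(7)]]
    bounded_clinear_simps[OF bounded_clinear_Q[OF \<delta>(3,4)]] bounded_clinear_simps[OF dual.bounded_clinear_Q[OF \<delta>(5,6)]]
    bounded_clinear_simps[OF bounded_clinear_Q[OF \<delta>(1,2)]] bounded_clinear_simps[OF dual.bounded_clinear_Q[OF \<delta>(1,2)]]
    bounded_clinear_simps[OF bounded_clinear_Z] bounded_clinear_simps[OF dual.bounded_clinear_Z]
    bounded_clinear_simps[OF pos_opD(1)[OF Pb]] bounded_clinear_simps[OF pos_opD(1)[OF Pc]]
  have \<Psi>_add: "\<Psi>1 (z + z') = \<Psi>1 z + \<Psi>1 z'" "\<Psi>2 (z + z') = \<Psi>2 z + \<Psi>2 z'"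
    and \<Psi>_scale: "\<Psi>1 (a *\<^sub>C z) = a *\<^sub>C \<Psi>1 z" "\<Psi>2 (a *\<^sub>C z) = a *\<^sub>C \<Psi>2 z" for z z' a
    by (rule injD[OF Jr(2)] injD[OF Js(2)]; simp add: Jr_\<Psi> Js_\<Psi> lin)+
  \<comment> \<open>\<open>P v z e\<close> says that \<open>(z, e)\<close> are the coordinates of a
    preimage of \<open>v\<close>. As a relation it can be shown linear and single-valued before
    existence, which holds on \<open>V\<close>.\<close>
  define P where "P v z e \<longleftrightarrow> app T (\<Psi>1 z, \<Psi>2 e) = v" for v z e
  have P_iff: "P v z e \<longleftrightarrow> Z z - Pb (Q ?\<delta> e) = Jr (fst v) \<and> - Pc (dual.Q ?\<delta> z) - dual.Z e = Js (snd v)" for v z e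
    unfolding P_def prod_eq_iff inj_eq[OF Jr(2), symmetric] inj_eq[OF Js(2), symmetric] Jr_T Js_T ..
  have P_add: "P (v + v') (z + z') (e + e')" if "P v z e" "P v' z' e'" for v v' z z' e e'
  proof -
    note that[unfolded P_iff]
    then show ?thesis
      unfolding P_iff by (simp only: lin fst_add snd_add minus_add_distrib add_diff_add)
  qed
  have P_scale: "P (a *\<^sub>C v) (a *\<^sub>C z) (a *\<^sub>C e)" if "P v z e" for v z e a
  proof -
    note that[unfolded P_iff]
    then show ?thesis
      unfolding P_iff
      by (simp only: lin scaleC_prod_def fst_conv snd_conv complex_vector.scale_minus_right[symmetric]
          complex_vector.scale_right_diff_distrib[symmetric])
  qed
  obtain c0 where c0: "c0 > 0" "\<And>z e a d. Z z - Pb (Q ?\<delta> e) = a \<Longrightarrow> - Pc (dual.Q ?\<delta> z) - dual.Z e = d \<Longrightarrow>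
      norm z + norm e \<le> c0 * (norm a + norm d)"
    by (rule a_priori_estimate[OF r s rs Pb Pc]) (rule that)
  obtain kr where kr: "kr > 0" "\<And>x. norm (Jr x) \<le> kr * norm x"
    by (rule bounded_clinear_bound[OF Jr(1)]) (rule that)
  obtain ks where ks: "ks > 0" "\<And>x. norm (Js x) \<le> ks * norm x"
    by (rule bounded_clinear_bound[OF Js(1)]) (rule that)
  define c1 where "c1 = c0 * (kr + ks)"
  have c1: "c1 > 0"
    using c0 kr ks by (simp add: c1_def add_pos_pos)
  have P_bound: "norm z + norm e \<le> c1 * norm v" if "P v z e" for v z e
  proof -
    have "norm z + norm e \<le> c0 * (norm (Jr (fst v)) + norm (Js (snd v)))"
      using that unfolding P_iff by (intro c0(2)) auto
    also have "\<dots> \<le> c0 * (kr * norm v + ks * norm v)"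
    proof (intro mult_left_mono add_mono order_trans[OF kr(2)] order_trans[OF ks(2)])
      show "norm (fst v) \<le> norm v" "norm (snd v) \<le> norm v"
        using norm_fst_le[of "fst v" "snd v"] norm_snd_le[of "snd v" "fst v"] by simp_all
    qed (use c0(1) kr(1) ks(1) in auto)
    finally show ?thesis
      by (simp add: c1_def algebra_simps)
  qed
  have P_unique: "z = z' \<and> e = e'" if "P v z e" "P v z' e'" for v z z' e e'
  proof -
    have "P (v + (- 1) *\<^sub>C v) (z + (- 1) *\<^sub>C z') (e + (- 1) *\<^sub>C e')"
      by (intro P_add P_scale that)
    from P_bound[OF this] have "norm (z - z') + norm (e - e') \<le> 0"
      by simp
    then have "norm (z - z') = 0" "norm (e - e') = 0"
      using norm_ge_zero[of "z - z'"] norm_ge_zero[of "e - e'"] by linarith+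
    then show ?thesis
      by simp
  qed
  have opdom_V: "opdom ?T = opdom T \<inter> V" "app ?T = app T"
    by (simp_all add: op_restrict_def)
  have domE: "\<exists>z e. p = (\<Psi>1 z, \<Psi>2 e)" if "p \<in> opdom T" for p
    using that unfolding dom by auto
  have linT: "linear_op ?T"
    unfolding linear_op_def opdom_V
  proof (intro conjI ballI allI)
    have mem: "(\<Psi>1 z, \<Psi>2 e) \<in> opdom T" for z e
      by (simp add: dom)
    have "complex_vector.subspace (opdom T)"
      unfolding complex_vector.subspace_def
    proof (intro conjI ballI allI)
      show "0 \<in> opdom T"
        using mem[of 0 0] \<Psi>_scale[of 0 0] by (simp add: zero_prod_def)
      fix p assume "p \<in> opdom T"
      then obtain z e where p: "p = (\<Psi>1 z, \<Psi>2 e)"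
        using domE by blast
      show "a *\<^sub>C p \<in> opdom T" for a
        using mem[of "a *\<^sub>C z" "a *\<^sub>C e"] by (simp add: p scaleC_prod_def \<Psi>_scale)
      fix p' assume "p' \<in> opdom T"
      then obtain z' e' where p': "p' = (\<Psi>1 z', \<Psi>2 e')"
        using domE by blast
      show "p + p' \<in> opdom T"
        using mem[of "z + z'" "e + e'"] by (simp add: p p' \<Psi>_add)
    qed
    then show "complex_vector.subspace (opdom T \<inter> V)"
      using V by (rule complex_vector.subspace_inter)
    fix p assume p: "p \<in> opdom T \<inter> V"
    then obtain z e where p_eq: "p = (\<Psi>1 z, \<Psi>2 e)"
      using domE by blast
    then have P: "P (app T p) z e"
      by (simp add: P_def)
    show "app T (a *\<^sub>C p) = a *\<^sub>C app T p" for a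
      using P_scale[OF P, of a] by (simp add: P_def p_eq scaleC_prod_def \<Psi>_scale)
    fix p' assume p': "p' \<in> opdom T \<inter> V"
    then obtain z' e' where p'_eq: "p' = (\<Psi>1 z', \<Psi>2 e')"
      using domE by blast
    then have P': "P (app T p') z' e'"
      by (simp add: P_def)
    show "app T (p + p') = app T p + app T p'"
      using P_add[OF P P'] by (simp add: P_def p_eq p'_eq \<Psi>_add)
  qed
  \<comment> \<open>The resolvent at 0 provides the preimage; this is the purpose of
    \<open>0 \<in> U\<close>.\<close>
  have "\<exists>z e. P v z e" if "v \<in> V" for v
  proof -
    have "resolvent ?T 0 v \<in> opdom ?T" "app ?T (resolvent ?T 0 v) - 0 *\<^sub>C resolvent ?T 0 v = v"
      using U that by (intro resolvent_in_opdom resolvent_eq; blast)+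
    moreover from this obtain z e where "resolvent ?T 0 v = (\<Psi>1 z, \<Psi>2 e)"
      using domE[of "resolvent ?T 0 v"] by (auto simp: opdom_V)
    ultimately have "P v z e"
      by (simp add: opdom_V P_def)
    then show ?thesis
      by blast
  qed
  then obtain zf ef where zef: "\<And>v. v \<in> V \<Longrightarrow> P v (zf v) (ef v)"
    by metis
  have add: "zf (v + v') = zf v + zf v'" "ef (v + v') = ef v + ef v'" if "v \<in> V" "v' \<in> V" for v v'
    using P_unique[OF zef P_add[OF zef zef]] that complex_vector.subspace_add[OF V] by blast+
  have scale: "zf (a *\<^sub>C v) = a *\<^sub>C zf v" "ef (a *\<^sub>C v) = a *\<^sub>C ef v" if "v \<in> V" for v a
    using P_unique[OF zef P_scale[OF zef]] that complex_vector.subspace_scale[OF V] by blast+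
  have norm_le: "norm (zf v) \<le> c1 * norm v" "norm (ef v) \<le> c1 * norm v" if "v \<in> V" for v
    using P_bound[OF zef[OF that]] norm_ge_zero[of "zf v"] norm_ge_zero[of "ef v"] by linarith+
  define \<rho> where "\<rho> \<mu> = resolvent ?T \<mu> u" for \<mu>
  have \<rho>: "\<rho> \<mu> \<in> opdom T" "\<rho> \<mu> \<in> V" "app T (\<rho> \<mu>) = u + \<mu> *\<^sub>C \<rho> \<mu>" if "\<mu> \<in> U" for \<mu>
  proof -
    have \<mu>: "\<mu> \<in> resolvent_set_on V ?T"
      using U that by blast
    show "\<rho> \<mu> \<in> opdom T" "\<rho> \<mu> \<in> V"
      using resolvent_in_opdom[OF \<mu> u] by (auto simp: opdom_V \<rho>_def)
    show "app T (\<rho> \<mu>) = u + \<mu> *\<^sub>C \<rho> \<mu>"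
      using resolvent_eq[OF \<mu> u] unfolding opdom_V \<rho>_def by (rule iffD1[OF diff_eq_eq])
  qed
  define z where "z \<mu> = zf u + \<mu> *\<^sub>C zf (\<rho> \<mu>)" for \<mu>
  define e where "e \<mu> = ef u + \<mu> *\<^sub>C ef (\<rho> \<mu>)" for \<mu>
  have coord: "\<rho> \<mu> = (\<Psi>1 (z \<mu>), \<Psi>2 (e \<mu>))" "P (u + \<mu> *\<^sub>C \<rho> \<mu>) (z \<mu>) (e \<mu>)" if \<mu>: "\<mu> \<in> U" for \<mu>
  proof -
    obtain z' e' where \<rho>_eq: "\<rho> \<mu> = (\<Psi>1 z', \<Psi>2 e')"
      using domE[OF \<rho>(1)[OF \<mu>]] by blast
    have P': "P (u + \<mu> *\<^sub>C \<rho> \<mu>) z' e'"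
      using \<rho>(3)[OF \<mu>] by (simp add: P_def \<rho>_eq)
    moreover have P: "P (u + \<mu> *\<^sub>C \<rho> \<mu>) (z \<mu>) (e \<mu>)"
      unfolding z_def e_def by (intro P_add P_scale zef u \<rho>(2) \<mu>)
    ultimately show "\<rho> \<mu> = (\<Psi>1 (z \<mu>), \<Psi>2 (e \<mu>))" "P (u + \<mu> *\<^sub>C \<rho> \<mu>) (z \<mu>) (e \<mu>)"
      using P_unique[OF P' P] \<rho>_eq by simp_all
  qed
  have eqs: "Z (z \<mu>) - \<mu> *\<^sub>C Q r (dual.Q (1 - r) (z \<mu>)) - Pb (Q ?\<delta> (e \<mu>)) = Jr (fst u)"
    "- Pc (dual.Q ?\<delta> (z \<mu>)) - dual.Z (e \<mu>) - \<mu> *\<^sub>C dual.Q s (Q (1 - s) (e \<mu>)) = Js (snd u)"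
    if "\<mu> \<in> U" for \<mu>
  proof -
    have "fst (\<rho> \<mu>) = \<Psi>1 (z \<mu>)" "snd (\<rho> \<mu>) = \<Psi>2 (e \<mu>)"
      by (simp_all add: coord(1)[OF that])
    then have "Z (z \<mu>) - Pb (Q ?\<delta> (e \<mu>)) = Jr (fst u) + \<mu> *\<^sub>C Q r (dual.Q (1 - r) (z \<mu>))"
      "- Pc (dual.Q ?\<delta> (z \<mu>)) - dual.Z (e \<mu>) = Js (snd u) + \<mu> *\<^sub>C dual.Q s (Q (1 - s) (e \<mu>))"
      using coord(2)[OF that] unfolding P_iff
      by (simp_all add: scaleC_prod_def bounded_clinear_simps[OF Jr(1)] bounded_clinear_simps[OF Js(1)] Jr_\<Psi> Js_\<Psi>)
    then show "Z (z \<mu>) - \<mu> *\<^sub>C Q r (dual.Q (1 - r) (z \<mu>)) - Pb (Q ?\<delta> (e \<mu>)) = Jr (fst u)"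
      "- Pc (dual.Q ?\<delta> (z \<mu>)) - dual.Z (e \<mu>) - \<mu> *\<^sub>C dual.Q s (Q (1 - s) (e \<mu>)) = Js (snd u)"
      by (simp_all add: algebra_simps)
  qed
  have holo: "(\<lambda>\<mu>. cinner (f u + \<mu> *\<^sub>C f (\<rho> \<mu>)) h) holomorphic_on U"
    if f: "\<And>v v'. v \<in> V \<Longrightarrow> v' \<in> V \<Longrightarrow> f (v + v') = f v + f v'"
      "\<And>v a. v \<in> V \<Longrightarrow> f (a *\<^sub>C v) = a *\<^sub>C f v" "\<And>v. v \<in> V \<Longrightarrow> norm (f v) \<le> c1 * norm v"
    for f h
  proof -
    have "(\<lambda>\<mu>. cinner (f (\<rho> \<mu>)) h) holomorphic_on U"
      unfolding \<rho>_def
    proof (rule holomorphic_resolvent[OF linT V _ U(1) u, where l="\<lambda>x. cinner (f x) h"])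
      show "cmod (cinner (f x) h) \<le> c1 * norm h * norm x" if "x \<in> V" for x
        using order_trans[OF cinner_Cauchy_Schwarz mult_right_mono[OF f(3)[OF that] norm_ge_zero]]
        by (simp add: mult_ac)
    qed (use f in \<open>auto simp: opdom_V cinner_simps\<close>)
    then show ?thesis
      unfolding cinner_add_left cinner_scaleC_left by (intro holomorphic_intros)
  qed
  define c2 where "c2 = c1 * (norm u + \<bar>N\<bar>)"
  have growth: "norm (f u + \<mu> *\<^sub>C f (\<rho> \<mu>)) \<le> c2 * (1 + cmod \<mu>)"
    if f: "\<And>v. v \<in> V \<Longrightarrow> norm (f v) \<le> c1 * norm v" and \<mu>: "\<mu> \<in> U'" for f :: "'v \<times> 'w \<Rightarrow> 'h" and \<mu>
  proof -
    have "norm (f u + \<mu> *\<^sub>C f (\<rho> \<mu>)) \<le> norm (f u) + cmod \<mu> * norm (f (\<rho> \<mu>))"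
      using norm_triangle_ineq[of "f u" "\<mu> *\<^sub>C f (\<rho> \<mu>)"] by (simp add: norm_scaleC)
    also have "\<dots> \<le> c1 * norm u + cmod \<mu> * (c1 * \<bar>N\<bar>)"
    proof (intro add_mono mult_left_mono f u)
      have "norm (f (\<rho> \<mu>)) \<le> c1 * norm (\<rho> \<mu>)"
        using \<rho>(2) \<mu> U(3) by (intro f) blast
      also have "\<dots> \<le> c1 * \<bar>N\<bar>"
        using bound[OF \<mu>] c1 by (intro mult_left_mono) (auto simp: \<rho>_def)
      finally show "norm (f (\<rho> \<mu>)) \<le> c1 * \<bar>N\<bar>" .
    qed simp
    also have "\<dots> \<le> c2 * (1 + cmod \<mu>)"
      using c1 by (simp add: c2_def algebra_simps)
    finally show ?thesis .
  qed
  show ?thesis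
    by (rule that[of z e c2]) (use eqs in \<open>simp_all add: z_def e_def holo growth add scale norm_le\<close>)
qed

lemma minus_subspace_eq_0:
  assumes V: "complex_vector.subspace V" and U: "{\<mu>. Re \<mu> \<ge> 0} \<subseteq> resolvent_set_on V (op_restrict T V)"
    and bound: "\<And>\<mu> v. Re \<mu> > 0 \<Longrightarrow> v \<in> V \<Longrightarrow> norm (resolvent (op_restrict T V) \<mu> v) \<le> N * norm v"
    and w: "(0, w) \<in> V"
  shows "w = 0"
proof -
  obtain z e c where *:
    "\<And>\<mu>. \<mu> \<in> {\<mu>. Re \<mu> \<ge> 0} \<Longrightarrow> Z (z \<mu>) - \<mu> *\<^sub>C Q r (dual.Q (1 - r) (z \<mu>)) - Pb (Q (1 - r - s) (e \<mu>)) = Jr (fst (0, w))"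
    "\<And>\<mu>. \<mu> \<in> {\<mu>. Re \<mu> \<ge> 0} \<Longrightarrow> - Pc (dual.Q (1 - r - s) (z \<mu>)) - dual.Z (e \<mu>) - \<mu> *\<^sub>C dual.Q s (Q (1 - s) (e \<mu>)) = Js (snd (0::'v, w))"
    "\<And>h. (\<lambda>\<mu>. cinner (z \<mu>) h) holomorphic_on {\<mu>. Re \<mu> \<ge> 0}" "\<And>h. (\<lambda>\<mu>. cinner (e \<mu>) h) holomorphic_on {\<mu>. Re \<mu> \<ge> 0}"
    "\<And>\<mu>. \<mu> \<in> {\<mu>. Re \<mu> > 0} \<Longrightarrow> norm (z \<mu>) \<le> c * (1 + cmod \<mu>)" "\<And>\<mu>. \<mu> \<in> {\<mu>. Re \<mu> > 0} \<Longrightarrow> norm (e \<mu>) \<le> c * (1 + cmod \<mu>)"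
  proof (rule coordinates_resolvent[OF V w U])
    show "norm (resolvent (op_restrict T V) \<mu> (0, w)) \<le> N * norm (0::'v, w)" if "\<mu> \<in> {\<mu>. Re \<mu> > 0}" for \<mu>
      using that by (intro bound w) simp
  qed (auto intro: that)
  have "Js w = 0"
    by (rule coordinates_eq_0[OF r s rs Pb Pc, of z e _ c])
      (use * in \<open>simp_all add: bounded_clinear_zero[OF Jr(1)]\<close>)
  then show ?thesis
    using Js bounded_clinear_zero[OF Js(1)] by (metis injD)
qed

text \<open>With \<open>z\<close>, \<open>e\<close> and \<open>\<mu>\<close> replaced by \<open>e\<close>, \<open>- z\<close> and \<open>- \<mu>\<close>, the Hamiltonian turns into that of the
  adjoint of \<open>A\<close>, and the half-planes are interchanged.\<close>

lemma plus_subspace_eq_0: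
  assumes V: "complex_vector.subspace V" and U: "{\<mu>. Re \<mu> \<le> 0} \<subseteq> resolvent_set_on V (op_restrict T V)"
    and bound: "\<And>\<mu> v. Re \<mu> < 0 \<Longrightarrow> v \<in> V \<Longrightarrow> norm (resolvent (op_restrict T V) \<mu> v) \<le> N * norm v"
    and v: "(v, 0) \<in> V"
  shows "v = 0"
proof -
  obtain z e c where *:
    "\<And>\<mu>. \<mu> \<in> {\<mu>. Re \<mu> \<le> 0} \<Longrightarrow> Z (z \<mu>) - \<mu> *\<^sub>C Q r (dual.Q (1 - r) (z \<mu>)) - Pb (Q (1 - r - s) (e \<mu>)) = Jr (fst (v, 0::'w))"
    "\<And>\<mu>. \<mu> \<in> {\<mu>. Re \<mu> \<le> 0} \<Longrightarrow> - Pc (dual.Q (1 - r - s) (z \<mu>)) - dual.Z (e \<mu>) - \<mu> *\<^sub>C dual.Q s (Q (1 - s) (e \<mu>)) = Js (snd (v, 0))"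
    "\<And>h. (\<lambda>\<mu>. cinner (z \<mu>) h) holomorphic_on {\<mu>. Re \<mu> \<le> 0}" "\<And>h. (\<lambda>\<mu>. cinner (e \<mu>) h) holomorphic_on {\<mu>. Re \<mu> \<le> 0}"
    "\<And>\<mu>. \<mu> \<in> {\<mu>. Re \<mu> < 0} \<Longrightarrow> norm (z \<mu>) \<le> c * (1 + cmod \<mu>)" "\<And>\<mu>. \<mu> \<in> {\<mu>. Re \<mu> < 0} \<Longrightarrow> norm (e \<mu>) \<le> c * (1 + cmod \<mu>)"
  proof (rule coordinates_resolvent[OF V v U])
    show "norm (resolvent (op_restrict T V) \<mu> (v, 0)) \<le> N * norm (v, 0::'w)" if "\<mu> \<in> {\<mu>. Re \<mu> < 0}" for \<mu>
      using that by (intro bound v) simp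
  qed (auto intro: that)
  define z' where "z' \<mu> = e (- \<mu>)" for \<mu>
  define e' where "e' \<mu> = - z (- \<mu>)" for \<mu>
  have \<delta>: "1 - s - r = 1 - r - s" "0 \<le> 1 - r - s" "1 - r - s \<le> 1" "0 \<le> 1 - s" "1 - s \<le> 1" "0 \<le> 1 - r" "1 - r \<le> 1" "s \<le> 1" "r \<le> 1"
    using r s rs by auto
  note lin = bounded_clinear_minus[OF bounded_clinear_Z] bounded_clinear_minus[OF pos_opD(1)[OF Pc]]
    bounded_clinear_minus[OF bounded_clinear_Q[OF r \<delta>(9)]] bounded_clinear_minus[OF dual.bounded_clinear_Q[OF \<delta>(6,7)]]
    bounded_clinear_minus[OF dual.bounded_clinear_Q[OF \<delta>(2,3)]]
  have "Jr v = 0"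
  proof (rule dual.coordinates_eq_0[OF s r _ Pc Pb, of z' e' _ c])
    show "s + r < 1"
      using rs by simp
    show "dual.Z (z' \<mu>) - \<mu> *\<^sub>C dual.Q s (Q (1 - s) (z' \<mu>)) - Pc (dual.Q (1 - s - r) (e' \<mu>)) = 0" if "Re \<mu> \<ge> 0" for \<mu>
      using *(2)[of "- \<mu>"] that
      by (simp add: z'_def e'_def \<delta>(1) lin bounded_clinear_zero[OF Js(1)]) (simp add: algebra_simps eq_neg_iff_add_eq_0)
    show "- Pb (Q (1 - s - r) (z' \<mu>)) - Z (e' \<mu>) - \<mu> *\<^sub>C Q r (dual.Q (1 - r) (e' \<mu>)) = Jr v" if "Re \<mu> \<ge> 0" for \<mu>
      using *(1)[of "- \<mu>"] that
      by (simp add: z'_def e'_def \<delta>(1) lin) (simp add: algebra_simps)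
    show "(\<lambda>\<mu>. cinner (z' \<mu>) h) holomorphic_on {\<mu>. Re \<mu> \<ge> 0}" for h
      unfolding z'_def
      by (rule holomorphic_on_compose_gen[OF _ *(4), unfolded o_def]) (auto intro!: holomorphic_intros)
    have "(\<lambda>\<mu>. cinner (z (- \<mu>)) h) holomorphic_on {\<mu>. Re \<mu> \<ge> 0}" for h
      by (rule holomorphic_on_compose_gen[OF _ *(3), unfolded o_def]) (auto intro!: holomorphic_intros)
    then show "(\<lambda>\<mu>. cinner (e' \<mu>) h) holomorphic_on {\<mu>. Re \<mu> \<ge> 0}" for h
      unfolding e'_def cinner_minus_left by (rule holomorphic_on_minus)
    show "norm (z' \<mu>) \<le> c * (1 + cmod \<mu>)" "norm (e' \<mu>) \<le> c * (1 + cmod \<mu>)" if "Re \<mu> > 0" for \<mu>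
      using *(5,6)[of "- \<mu>"] that by (simp_all add: z'_def e'_def)
  qed
  then show ?thesis
    using Jr bounded_clinear_zero[OF Jr(1)] by (metis injD)
qed

end

section \<open>Identification of the scales\<close>

text \<open>The embedding and \<open>frac_pow F \<tau>\<close> induce the same norm on
  \<open>H\<close> and have dense ranges, so each extends along the other, and the extensions are
  mutually inverse. The abstract completion is thereby identified with \<open>H\<close>.\<close>

lemma neg_scale_space_isometry:
  fixes \<iota> :: "'h::{complex_hilbert, second_countable_topology} \<Rightarrow> 'v::complex_banach"
  assumes F: "near_identity F" and L: "is_inverse_op F L" and \<tau>: "0 \<le> \<tau>" "\<tau> \<le> 1"
    and dense: "closure (range (frac_pow F \<tau>)) = UNIV"
    and \<iota>: "is_neg_scale_space L \<tau> \<iota>"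
  obtains J Ji where "bounded_clinear J" "bounded_clinear Ji" "\<And>x. J (\<iota> x) = frac_pow F \<tau> x"
    "\<And>y. J (Ji y) = y" "\<And>v. Ji (J v) = v"
proof -
  interpret near_identity F by fact
  have \<iota>': "\<And>x y. \<iota> (x + y) = \<iota> x + \<iota> y" "\<And>a x. \<iota> (a *\<^sub>C x) = a *\<^sub>C \<iota> x" "closure (range \<iota>) = UNIV"
    "\<And>x. norm (\<iota> x) = norm (frac_pow F \<tau> x)"
    using \<iota> scale_norm_neg_eq[OF F L \<tau>] by (auto simp: is_neg_scale_space_def)
  note Q = bounded_clinear_frac_pow[OF \<tau>]
  obtain J where J: "bounded_clinear J" "\<And>x. J (\<iota> x) = frac_pow F \<tau> x"
    by (rule extend_bounded_clinear[OF \<iota>'(1,2) bounded_clinear_add[OF Q] bounded_clinear_scaleC[OF Q] \<iota>'(3), of 1])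
      (simp add: \<iota>'(4), rule that)
  obtain Ji where Ji: "bounded_clinear Ji" "\<And>x. Ji (frac_pow F \<tau> x) = \<iota> x"
    by (rule extend_bounded_clinear[OF bounded_clinear_add[OF Q] bounded_clinear_scaleC[OF Q] \<iota>'(1,2) dense, of 1])
      (simp add: \<iota>'(4), rule that)
  have "J (Ji y) = y" for y
    by (rule bounded_clinear_eq_on_dense[OF bounded_clinear_compose[OF J(1) Ji(1)] bounded_clinear_ident dense])
      (simp add: J(2) Ji(2))
  moreover have "Ji (J v) = v" for v
    by (rule bounded_clinear_eq_on_dense[OF bounded_clinear_compose[OF Ji(1) J(1)] bounded_clinear_ident \<iota>'(3)])
      (simp add: J(2) Ji(2))
  ultimately show ?thesis
    using that J Ji(1) by blast
qed

text \<open>Density makes the filter proper, as the limit in \<open>pairing\<close> requires to be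
  determined.\<close>

lemma filtercomap_nhds_neq_bot:
  fixes \<iota> :: "'a \<Rightarrow> 'b::metric_space"
  assumes "closure (range \<iota>) = UNIV"
  shows "filtercomap \<iota> (nhds \<phi>) \<noteq> bot"
proof
  assume "filtercomap \<iota> (nhds \<phi>) = bot"
  then have "\<forall>\<^sub>F x in filtercomap \<iota> (nhds \<phi>). False"
    by simp
  then obtain P where P: "\<forall>\<^sub>F y in nhds \<phi>. P y" "\<And>x. \<not> P (\<iota> x)"
    by (auto simp: eventually_filtercomap)
  then obtain d where d: "d > 0" "\<And>y. dist y \<phi> < d \<Longrightarrow> P y"
    by (auto simp: eventually_nhds_metric)
  have "\<phi> \<in> closure (range \<iota>)"
    using assms by simp
  then obtain y where "y \<in> range \<iota>" "dist y \<phi> < d"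
    using d(1) closure_approachable by blast
  then show False
    using d(2) P(2) by blast
qed

text \<open>\<open>N\<close> moves to the other side, where it extends to the continuous map
  \<open>J\<close>; the limit is the value at \<open>\<phi>\<close>.\<close>

lemma pairing_eq:
  fixes \<iota> :: "'h::complex_hilbert \<Rightarrow> 'v::complex_banach"
  assumes dense: "closure (range \<iota>) = UNIV" and J: "bounded_clinear J" "\<And>z. J (\<iota> z) = N z"
    and N: "\<And>y z. cinner (N y) z = cinner y (N z)"
  shows "pairing \<iota> (N x) \<phi> = cinner x (J \<phi>)"
  unfolding pairing_def
proof (rule tendsto_Lim)
  show "\<not> trivial_limit (filtercomap \<iota> (nhds \<phi>))"
    using filtercomap_nhds_neq_bot[OF dense] by simp
  have "((\<lambda>z. J (\<iota> z)) \<longlongrightarrow> J \<phi>) (filtercomap \<iota> (nhds \<phi>))"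
    by (rule bounded_clinear_tendsto[OF J(1) filterlim_filtercomap])
  then have "((\<lambda>z. cinner x (N z)) \<longlongrightarrow> cinner x (J \<phi>)) (filtercomap \<iota> (nhds \<phi>))"
    unfolding J(2) by (intro tendsto_cinner tendsto_const)
  moreover have "(\<lambda>z. cinner x (N z)) = cinner (N x)"
    by (simp add: fun_eq_iff N)
  ultimately show "(cinner (N x) \<longlongrightarrow> cinner x (J \<phi>)) (filtercomap \<iota> (nhds \<phi>))"
    by (simp only:)
qed

lemma pos_op_compose_adjoint:
  fixes f :: "'a::complex_hilbert \<Rightarrow> 'b::complex_hilbert"
  assumes f: "bounded_clinear f" and g: "bounded_clinear g" and adj: "\<And>x y. cinner (f x) y = cinner x (g y)"
  obtains k where "pos_op (\<lambda>y. f (g y)) k"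
proof -
  obtain k where k: "k > 0" "\<And>x. norm (f x) \<le> k * norm x"
    by (rule bounded_clinear_bound[OF f]) (rule that)
  have *: "cinner (f (g y)) y = of_real ((norm (g y))\<^sup>2)" for y
    by (simp add: adj cinner_self)
  have "(norm (f (g y)))\<^sup>2 \<le> k\<^sup>2 * (norm (g y))\<^sup>2" for y
    using power_mono[OF k(2)[of "g y"], of 2] by (simp add: power_mult_distrib)
  then have "pos_op (\<lambda>y. f (g y)) (k\<^sup>2)"
    unfolding pos_op_def * using k(1) bounded_clinear_compose[OF f g] by (simp del: of_real_power)
  then show ?thesis
    by (rule that)
qed

lemma B_adj_eq:
  fixes B :: "'u::complex_hilbert \<Rightarrow> 'v::complex_banach"
  assumes "\<And>u. pairing \<iota> x (B u) = cinner w u"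
  shows "B_adj \<iota> B x = w"
  unfolding B_adj_def
proof (rule the_equality)
  show "\<forall>u. pairing \<iota> x (B u) = cinner w u"
    using assms by blast
  show "w' = w" if "\<forall>u. pairing \<iota> x (B u) = cinner w' u" for w'
    by (rule cinner_ext) (use that assms in simp)
qed

context adjoint_pair
begin

text \<open>With \<open>x = S u\<close> the adjoint condition becomes
  \<open>(u | y) = (u | S' z)\<close> for all \<open>u\<close>.\<close>

lemma is_inverse_op_hilbert_adjoint:
  assumes A: "is_inverse_op S A"
  shows "is_inverse_op S' (hilbert_adjoint A)"
proof -
  have iff: "(\<forall>x\<in>opdom A. cinner (app A x) y = cinner x z) \<longleftrightarrow> y = S' z" for y z
  proof -
    have "(\<forall>x\<in>opdom A. cinner (app A x) y = cinner x z) \<longleftrightarrow> (\<forall>u. cinner u y = cinner u (S' z))"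
      using A by (simp add: is_inverse_op_def adj)
    also have "\<dots> \<longleftrightarrow> y = S' z"
      using cinner_ext_right by blast
    finally show ?thesis .
  qed
  show ?thesis
    unfolding is_inverse_op_def hilbert_adjoint_def iff
    using inj_eq[OF dual.inj_S] by auto
qed

text \<open>The domain of \<open>A A*\<close> is the range of \<open>S' S\<close>, which
  \<open>gram\<close> reparametrises as the range of \<open>G\<close>:
  \<open>S' S u = G (gram u)\<close>.\<close>

lemma is_inverse_op_G:
  assumes A: "is_inverse_op S A" and A': "is_inverse_op S' A'"
  shows "is_inverse_op G (id_plus (op_comp A A'))"
proof -
  have dom: "opdom (id_plus (op_comp A A')) = {S' (S u) | u. True}"
    using A A' by (auto simp: id_plus_def op_comp_def is_inverse_op_def)
  have "range G = {S' (S u) | u. True}"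
  proof (intro equalityI subsetI)
    fix x assume "x \<in> {S' (S u) | u. True}"
    then obtain u where "x = S' (S u)"
      by blast
    then have "x = G (gram u)"
      by (simp add: G_eq Th_gram)
    then show "x \<in> range G"
      by simp
  qed (auto simp: G_eq)
  moreover have "app (id_plus (op_comp A A')) (G v) = v" for v
    using A A' gram_Th[of v]
    by (simp add: id_plus_def op_comp_def is_inverse_op_def G_eq gram_def add.commute)
  ultimately show ?thesis
    by (simp add: is_inverse_op_def dom)
qed

lemma is_inverse_op_F:
  assumes "is_inverse_op S A" "is_inverse_op S' A'"
  shows "is_inverse_op F (op_power (id_plus (op_comp A A')) (1 / 2))"
  unfolding F_def
  by (rule is_inverse_op_op_power[OF near_identity_G is_inverse_op_G[OF assms]]) auto

end

context adjoint_pair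
begin

lemma is_inverse_op_Lam:
  assumes A: "is_inverse_op S A"
  shows "is_inverse_op F (Lam A)" "is_inverse_op dual.F (Lam_star A)"
  unfolding Lam_def Lam_star_def
  using is_inverse_op_F[OF A is_inverse_op_hilbert_adjoint[OF A]]
    dual.is_inverse_op_F[OF is_inverse_op_hilbert_adjoint[OF A] A] by blast+

text \<open>Points of the domain of \<open>A\<close> are \<open>dual.F q\<close>. Their scale
  distance from \<open>x\<close> is that of \<open>dual.Q r q\<close> from \<open>z\<close>, and
  \<open>\<iota> (A (dual.F q))\<close> is the continuous expression
  \<open>Ji (Z (dual.Q r q))\<close>; so the limit is its value at \<open>z\<close>.\<close>

lemma scale_ext_eq:
  fixes \<iota> :: "'h \<Rightarrow> 'v::complex_banach"
  assumes A: "is_inverse_op S A" and L: "is_inverse_op dual.F L" and r: "0 \<le> r" "r \<le> 1"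
    and J: "bounded_clinear Ji" "\<And>x. J (\<iota> x) = Q r x" "\<And>v. Ji (J v) = v"
  shows "scale_ext L (1 - r) \<iota> A (dual.Q (1 - r) z) = Ji (Z z)"
  unfolding scale_ext_def
proof (rule tendsto_Lim)
  let ?x = "dual.Q (1 - r) z"
  let ?F = "inf (principal (opdom A)) (filtercomap (\<lambda>y. scale_norm L (1 - r) (y - ?x)) (nhds 0))"
  have r': "0 \<le> 1 - r" "1 - r \<le> 1"
    using r by auto
  have point: "dual.F q \<in> opdom A" "scale_norm L (1 - r) (dual.F q - ?x) = norm (dual.Q r q - z)"
    "\<iota> (app A (dual.F q)) = Ji (Z (dual.Q r q))" for q
  proof -
    show "dual.F q \<in> opdom A"
      using A S_Z[of q] by (metis is_inverse_op_def rangeI)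
    have "dual.F q - ?x = dual.Q (1 - r) (dual.Q r q - z)"
      using r' r by (simp add: bounded_clinear_diff[OF dual.bounded_clinear_Q] dual.Q_add dual.Q_1)
    then show "scale_norm L (1 - r) (dual.F q - ?x) = norm (dual.Q r q - z)"
      using scale_norm_eq[OF dual.near_identity_F L r'] by (simp add: dual.Q_def)
    have "app A (dual.F q) = Z q"
      using A S_Z[of q] by (metis is_inverse_op_def)
    then show "\<iota> (app A (dual.F q)) = Ji (Z (dual.Q r q))"
      using J(3)[of "\<iota> (Z q)"] by (simp add: J(2) Z_Q[OF r])
  qed
  have dom: "\<exists>q. y = dual.F q" if "y \<in> opdom A" for y
    using that A F_Zi by (auto simp: is_inverse_op_def) metis
  show "\<not> trivial_limit ?F"
  proof
    assume "trivial_limit ?F"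
    then have "\<forall>\<^sub>F y in ?F. False"
      by simp
    then have "\<forall>\<^sub>F y in filtercomap (\<lambda>y. scale_norm L (1 - r) (y - ?x)) (nhds 0). y \<notin> opdom A"
      by (simp add: inf_commute[of "principal _"] eventually_inf_principal)
    then obtain P where P: "\<forall>\<^sub>F t in nhds 0. P t" "\<And>y. P (scale_norm L (1 - r) (y - ?x)) \<Longrightarrow> y \<notin> opdom A"
      unfolding eventually_filtercomap by blast
    then obtain d where d: "d > 0" "\<And>t. dist t 0 < d \<Longrightarrow> P t"
      by (auto simp: eventually_nhds_metric)
    have "z \<in> closure (range (dual.Q r))"
      using dual.dense_range_Q[OF r] by simp
    then obtain q where "dist (dual.Q r q) z < d"
      using d(1) by (auto simp: closure_approachable)
    then have "P (scale_norm L (1 - r) (dual.F q - ?x))"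
      by (intro d(2)) (simp add: point(2) dist_norm)
    then show False
      using P(2) point(1) by blast
  qed
  obtain k where k: "k > 0" "\<And>y. norm (Ji (Z y)) \<le> k * norm y"
    by (rule bounded_clinear_bound[OF bounded_clinear_compose[OF J(1) bounded_clinear_Z]]) (rule that)
  have small: "dist (\<iota> (app A y)) (Ji (Z z)) \<le> k * scale_norm L (1 - r) (y - ?x)" if "y \<in> opdom A" for y
  proof -
    obtain q where y: "y = dual.F q"
      using dom[OF \<open>y \<in> opdom A\<close>] by blast
    show ?thesis
      using k(2)[of "dual.Q r q - z"]
      by (simp add: y point dist_norm bounded_clinear_diff[OF bounded_clinear_Z] bounded_clinear_diff[OF J(1)])
  qed
  have "((\<lambda>y. k * scale_norm L (1 - r) (y - ?x)) \<longlongrightarrow> k * 0) ?F"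
    by (rule tendsto_mult_left[OF tendsto_mono[OF inf_le2 filterlim_filtercomap]])
  then have lim: "((\<lambda>y. k * scale_norm L (1 - r) (y - ?x)) \<longlongrightarrow> 0) ?F"
    by simp
  show "((\<lambda>y. \<iota> (app A y)) \<longlongrightarrow> Ji (Z z)) ?F"
  proof (rule tendstoI)
    fix \<epsilon> :: real assume "\<epsilon> > 0"
    then have "\<forall>\<^sub>F y in ?F. k * scale_norm L (1 - r) (y - ?x) < \<epsilon>"
      using order_tendstoD(2)[OF lim] by blast
    moreover have "\<forall>\<^sub>F y in ?F. y \<in> opdom A"
      by (rule filter_leD[OF inf_le1]) (simp add: eventually_principal)
    ultimately show "\<forall>\<^sub>F y in ?F. dist (\<iota> (app A y)) (Ji (Z z)) < \<epsilon>"
      by eventually_elim (rule order.strict_trans1[OF small])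
  qed
qed

end

section \<open>Sectorial operators\<close>

lemma sectorial_resolvent:
  assumes "sectorial A"
  obtains M where "\<And>\<mu>. Re \<mu> \<ge> 0 \<Longrightarrow> \<mu> \<noteq> 0 \<Longrightarrow> \<mu> \<in> resolvent_set A"
    "\<And>\<mu> y. Re \<mu> \<ge> 0 \<Longrightarrow> \<mu> \<noteq> 0 \<Longrightarrow> norm (resolvent A \<mu> y) \<le> M / cmod \<mu> * norm y"
proof -
  obtain \<theta> M where \<theta>: "\<theta> \<ge> 0" and sub: "sector (pi / 2 + \<theta>) \<subseteq> resolvent_set A"
    and le: "\<forall>\<mu>\<in>sector (pi / 2 + \<theta>). \<forall>y. norm (resolvent A \<mu> y) \<le> M / cmod \<mu> * norm y"
    using assms unfolding sectorial_def by blast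
  have sector: "\<mu> \<in> sector (pi / 2 + \<theta>)" if "Re \<mu> \<ge> 0" "\<mu> \<noteq> 0" for \<mu>
  proof -
    have "\<bar>Arg \<mu>\<bar> \<le> pi / 2"
      using that Arg_Re_nonneg by simp
    then have "- (pi / 2 + \<theta>) \<le> Arg \<mu>" "Arg \<mu> \<le> pi / 2 + \<theta>"
      using \<theta> by linarith+
    then show ?thesis
      using that by (simp add: sector_def)
  qed
  show ?thesis
    by (rule that[of M]) (use sector sub le in auto)
qed

text \<open>Injectivity of \<open>S'\<close> says that the domain of \<open>A\<close> is dense. The
  definition of \<open>sectorial\<close> does not state this; it has to be extracted from the
  resolvent bound.\<close>

lemma sectorial_dissipative_pair:
  fixes A :: "('h::{complex_hilbert, second_countable_topology}, 'h) unbounded_op"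
  assumes A: "sectorial A" and 0: "0 \<in> resolvent_set A"
  obtains S S' M where "dissipative_pair S S' M" "is_inverse_op S A"
proof -
  have lin: "linear_op A"
    using A by (simp add: sectorial_def)
  define S where "S = resolvent A 0"
  have S_dom: "S y \<in> opdom A" and A_S: "app A (S y) = y" for y
    using resolvent_in_opdom[OF 0, of y] resolvent_eq[OF 0, of y] by (simp_all add: S_def)
  have S_A: "S (app A x) = x" if "x \<in> opdom A" for x
    using resolvent_unique[OF 0 that] by (simp add: S_def)
  have inv: "is_inverse_op S A"
    using S_dom A_S S_A by (auto simp: is_inverse_op_def) (metis rangeI)
  have dom_ops: "S x + S y \<in> opdom A" "a *\<^sub>C S x \<in> opdom A" for x y a
    using linear_opD(1)[OF lin] S_dom by (auto intro: complex_vector.subspace_add complex_vector.subspace_scale)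
  obtain c where "\<And>y. y \<in> UNIV \<Longrightarrow> norm (resolvent A 0 y) \<le> c * norm y"
    by (rule resolvent_bound[OF 0]) (rule that)
  then have c: "norm (S y) \<le> c * norm y" for y
    by (simp add: S_def)
  have S: "bounded_clinear S"
  proof (rule bounded_clinearI[where K=c])
    show "S (x + y) = S x + S y" for x y
      using S_A[OF dom_ops(1)[of x y]] by (simp add: linear_opD(2)[OF lin] S_dom A_S)
    show "S (a *\<^sub>C x) = a *\<^sub>C S x" for a x
      using S_A[OF dom_ops(2)[of a x]] by (simp add: linear_opD(3)[OF lin] S_dom A_S)
  qed (rule c)
  have S_0: "x = 0" if "S x = 0" for x
    using A_S[of x] linear_opD(3)[OF lin S_dom[of x], of 0] that by simp
  obtain S' where S': "bounded_clinear S'" and adj: "\<And>x y. cinner (S x) y = cinner x (S' y)"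
    by (rule exists_adjoint[OF S]) (rule that)
  obtain M where M: "\<And>\<mu>. Re \<mu> \<ge> 0 \<Longrightarrow> \<mu> \<noteq> 0 \<Longrightarrow> \<mu> \<in> resolvent_set A"
    "\<And>\<mu> y. Re \<mu> \<ge> 0 \<Longrightarrow> \<mu> \<noteq> 0 \<Longrightarrow> norm (resolvent A \<mu> y) \<le> M / cmod \<mu> * norm y"
    by (rule sectorial_resolvent[OF A]) (rule that)
  define N where "N = \<bar>M\<bar> + 1"
  have surj: "surj (\<lambda>x. x - \<mu> *\<^sub>C S x)" if \<mu>: "Re \<mu> \<ge> 0" for \<mu>
  proof (cases "\<mu> = 0")
    case False
    have "app A (resolvent A \<mu> y) - \<mu> *\<^sub>C S (app A (resolvent A \<mu> y)) = y" for y
      using resolvent_eq[OF M(1)[OF \<mu> False], of y] resolvent_in_opdom[OF M(1)[OF \<mu> False], of y]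
      by (simp add: S_A)
    then show ?thesis
      by (rule surjI)
  qed (simp add: surj_def)
  \<comment> \<open>Split \<open>x\<close> into \<open>x - \<mu> S x\<close> and
    \<open>\<mu> S x\<close>; as \<open>S x\<close> is the resolvent of the first summand, the
    second is at most \<open>M\<close> times as large, whence
    \<open>N = \<bar>M\<bar> + 1\<close>.\<close>
  have below: "norm x \<le> N * norm (x - \<mu> *\<^sub>C S x)" if \<mu>: "Re \<mu> \<ge> 0" for \<mu> x
  proof (cases "\<mu> = 0")
    case False
    have "resolvent A \<mu> (x - \<mu> *\<^sub>C S x) = S x"
      using resolvent_unique[OF M(1)[OF \<mu> False] S_dom[of x]] by (simp add: A_S)
    then have "norm (S x) \<le> M / cmod \<mu> * norm (x - \<mu> *\<^sub>C S x)"
      using M(2)[OF \<mu> False, of "x - \<mu> *\<^sub>C S x"] by simp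
    then have "norm (\<mu> *\<^sub>C S x) \<le> M * norm (x - \<mu> *\<^sub>C S x)"
      using False by (simp add: norm_scaleC field_simps)
    moreover have "norm x \<le> norm (x - \<mu> *\<^sub>C S x) + norm (\<mu> *\<^sub>C S x)"
      using norm_triangle_ineq[of "x - \<mu> *\<^sub>C S x" "\<mu> *\<^sub>C S x"] by simp
    moreover have "M * norm (x - \<mu> *\<^sub>C S x) \<le> \<bar>M\<bar> * norm (x - \<mu> *\<^sub>C S x)"
      by (rule mult_right_mono) auto
    ultimately show ?thesis
      by (simp add: N_def distrib_right)
  qed (simp add: N_def distrib_right)
  have S'_0: "y = 0" if y: "S' y = 0" for y
    \<comment> \<open>The domain of \<open>A\<close> is dense: \<open>g n\<close> is \<open>A (A - n)\<inverse> y\<close>, which tends weakly to \<open>0\<close>, while \<open>(g n | y)\<close> is constant.\<close>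
  proof -
    have "\<exists>g. g - of_nat n *\<^sub>C S g = y" for n
    proof -
      obtain x where "y = x - of_nat n *\<^sub>C S x"
        using surjD[OF surj[of "of_nat n"], of y] by auto
      then show ?thesis
        by (intro exI[of _ x]) simp
    qed
    then obtain g where g: "\<And>n. g n - of_nat n *\<^sub>C S (g n) = y"
      by metis
    have g_bound: "norm (g n) \<le> N * norm y" for n
      using below[of "of_nat n" "g n"] by (simp add: g)
    have "cinner (g n) y = of_real ((norm y)\<^sup>2)" for n
    proof -
      have "cinner (g n - of_nat n *\<^sub>C S (g n)) y = cinner (g n) y"
        by (simp add: cinner_simps adj y)
      then show ?thesis
        by (simp only: g cinner_self)
    qed
    then have g_y: "cmod (cinner (g n) y) = (norm y)\<^sup>2" for n
      by (simp add: norm_power)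
    have lim: "(\<lambda>n. cinner (g (Suc n)) (S' h)) \<longlonglongrightarrow> 0" for h
    proof (rule Lim_null_comparison)
      let ?b = "(N + 1) * norm y * norm h"
      show "\<forall>\<^sub>F n in sequentially. norm (cinner (g (Suc n)) (S' h)) \<le> ?b * (1 / real (Suc n))"
      proof (intro always_eventually allI)
        fix n
        have "of_nat (Suc n) *\<^sub>C S (g (Suc n)) = g (Suc n) - y"
          using g[of "Suc n"] by (metis add_diff_cancel_left' diff_add_cancel)
        then have "real (Suc n) * norm (S (g (Suc n))) = norm (g (Suc n) - y)"
          by (metis norm_of_nat norm_scaleC)
        also have "\<dots> \<le> (N + 1) * norm y"
          using norm_triangle_ineq4[of "g (Suc n)" y] g_bound[of "Suc n"] by (simp add: distrib_right)
        finally have "norm (S (g (Suc n))) \<le> (N + 1) * norm y * (1 / real (Suc n))"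
          by (simp add: field_simps)
        then have "norm (S (g (Suc n))) * norm h \<le> (N + 1) * norm y * (1 / real (Suc n)) * norm h"
          by (rule mult_right_mono) simp
        moreover have "cmod (cinner (g (Suc n)) (S' h)) \<le> norm (S (g (Suc n))) * norm h"
          unfolding adj[symmetric] by (rule cinner_Cauchy_Schwarz)
        ultimately show "norm (cinner (g (Suc n)) (S' h)) \<le> ?b * (1 / real (Suc n))"
          by (simp add: mult_ac)
      qed
      have "(\<lambda>n. ?b * (1 / real (Suc n))) \<longlonglongrightarrow> ?b * 0"
        by (intro tendsto_mult_left LIMSEQ_Suc[OF lim_1_over_n])
      then show "(\<lambda>n. ?b * (1 / real (Suc n))) \<longlonglongrightarrow> 0"
        by simp
    qed
    \<comment> \<open>\<open>y\<close> is replaced by some \<open>S' h\<close> within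
      \<open>\<epsilon>\<close>, because convergence to 0 has been shown on the range of
      \<open>S'\<close>, which is dense as \<open>S\<close> is injective.\<close>
    have "(norm y)\<^sup>2 \<le> N * norm y * \<epsilon>" if "\<epsilon> > 0" for \<epsilon>
    proof -
      have "closure (range S') = UNIV"
      proof (rule dense_range_if_adjoint_inj[OF S'])
        fix x assume "\<And>z. cinner (S' z) x = 0"
        then have "cinner (S x) (S x) = 0"
          by (simp only: adjoint_sym[OF adj])
        then show "x = 0"
          by (simp add: S_0)
      qed
      then obtain h where h: "dist (S' h) y < \<epsilon>"
        using \<open>\<epsilon> > 0\<close> closure_approachable[of y "range S'"] by auto
      have "(norm y)\<^sup>2 \<le> cmod (cinner (g (Suc n)) (S' h)) + N * norm y * \<epsilon>" for n
      proof -
        have "cinner (g (Suc n)) y = cinner (g (Suc n)) (S' h) - cinner (g (Suc n)) (S' h - y)"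
          by (simp add: cinner_diff_right)
        then have "(norm y)\<^sup>2 \<le> cmod (cinner (g (Suc n)) (S' h)) + cmod (cinner (g (Suc n)) (S' h - y))"
          using g_y norm_triangle_ineq4 by metis
        also have "cmod (cinner (g (Suc n)) (S' h - y)) \<le> (N * norm y) * \<epsilon>"
          using h by (intro order_trans[OF cinner_Cauchy_Schwarz] mult_mono g_bound)
            (auto simp: dist_norm N_def)
        finally show ?thesis
          by simp
      qed
      moreover have "(\<lambda>n. cmod (cinner (g (Suc n)) (S' h)) + N * norm y * \<epsilon>) \<longlonglongrightarrow> cmod 0 + N * norm y * \<epsilon>"
        by (intro tendsto_intros lim)
      ultimately have "(norm y)\<^sup>2 \<le> cmod 0 + N * norm y * \<epsilon>"
        by (intro LIMSEQ_le[OF tendsto_const]) auto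
      then show ?thesis
        by simp
    qed note small = this
    show "y = 0"
    proof (rule ccontr)
      assume "y \<noteq> 0"
      have "N > 0"
        by (simp add: N_def add_nonneg_pos)
      have "norm y \<le> N * \<epsilon>" if "\<epsilon> > 0" for \<epsilon>
        using small[OF that] \<open>y \<noteq> 0\<close> by (simp add: power2_eq_square)
      moreover have "norm y / (2 * N) > 0"
        using \<open>y \<noteq> 0\<close> \<open>N > 0\<close> by simp
      ultimately have "norm y \<le> N * (norm y / (2 * N))"
        by blast
      then show False
        using \<open>y \<noteq> 0\<close> \<open>N > 0\<close> by simp
    qed
  qed
  have "dissipative_pair S S' N"
    by unfold_locales (fact S S' adj S_0 S'_0 surj below)+
  then show ?thesis
    using that inv by blast
qed

section \<open>Graphs\<close>

text \<open>A trivial intersection with the vertical axis makes the relation single-valued, and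
  \<open>V\<close> is then itself the graph whose closedness is asked for.\<close>

lemma subspace_graph:
  fixes V :: "('v::complex_banach \<times> 'w::complex_banach) set"
  assumes V: "complex_vector.subspace V" "closed V" and 0: "\<And>w. (0, w) \<in> V \<Longrightarrow> w = 0"
  shows "\<exists>X. closed_op X \<and> V = {(x, app X x) | x. x \<in> opdom X}"
proof -
  define X where "X = Op (fst ` V) (\<lambda>x. SOME y. (x, y) \<in> V)"
  have unique: "y = y'" if "(x, y) \<in> V" "(x, y') \<in> V" for x y y'
    using 0[of "y - y'"] complex_vector.subspace_diff[OF V(1) that] by simp
  have X: "(x, app X x) \<in> V" if "x \<in> opdom X" for x
    using that by (auto simp: X_def intro: someI)
  have app: "app X x = y" if "(x, y) \<in> V" for x y
    by (rule unique[OF X that]) (use that in \<open>force simp: X_def\<close>)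
  have graph: "V = {(x, app X x) | x. x \<in> opdom X}"
  proof (intro equalityI subsetI)
    fix p assume p: "p \<in> V"
    then have "fst p \<in> opdom X"
      by (simp add: X_def)
    moreover have "app X (fst p) = snd p"
      using p by (intro app) simp
    ultimately show "p \<in> {(x, app X x) | x. x \<in> opdom X}"
      by (auto simp: prod_eq_iff)
  qed (use X in auto)
  have "linear_op X"
    unfolding linear_op_def
  proof (intro conjI ballI allI)
    have add: "(x + y, app X x + app X y) \<in> V" if "x \<in> opdom X" "y \<in> opdom X" for x y
      using complex_vector.subspace_add[OF V(1) X[OF that(1)] X[OF that(2)]] by simp
    have scale: "(a *\<^sub>C x, a *\<^sub>C app X x) \<in> V" if "x \<in> opdom X" for a x
      using complex_vector.subspace_scale[OF V(1) X[OF that], of a] by (simp add: scaleC_prod_def)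
    have dom: "x \<in> opdom X" if "(x, y) \<in> V" for x y
      using that by (force simp: X_def)
    have "(0, 0) \<in> V"
      using complex_vector.subspace_0[OF V(1)] by (simp add: zero_prod_def)
    then show "complex_vector.subspace (opdom X)"
      unfolding complex_vector.subspace_def using dom add scale by blast
    show "app X (x + y) = app X x + app X y" if "x \<in> opdom X" "y \<in> opdom X" for x y
      by (rule app[OF add[OF that]])
    show "app X (a *\<^sub>C x) = a *\<^sub>C app X x" if "x \<in> opdom X" for a x
      by (rule app[OF scale[OF that]])
  qed
  then have "closed_op X"
    using V(2) graph by (simp add: closed_op_def)
  then show ?thesis
    using graph by blast
qed

lemma subspace_inverse_graph:
  fixes V :: "('v::complex_banach \<times> 'w::complex_banach) set"
  assumes V: "complex_vector.subspace V" "closed V" and 0: "\<And>v. (v, 0) \<in> V \<Longrightarrow> v = 0"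
  shows "\<exists>Y. closed_op Y \<and> V = {(app Y y, y) | y. y \<in> opdom Y}"
proof -
  let ?W = "prod.swap -` V"
  have "complex_vector.subspace ?W"
    unfolding complex_vector.subspace_def
  proof (intro conjI ballI allI)
    show "0 \<in> ?W"
      using complex_vector.subspace_0[OF V(1)] by (simp add: zero_prod_def)
    show "p + q \<in> ?W" if "p \<in> ?W" "q \<in> ?W" for p q
    proof -
      have "prod.swap (p + q) = prod.swap p + prod.swap q"
        by (simp add: prod_eq_iff)
      then show ?thesis
        using complex_vector.subspace_add[OF V(1)] that by simp
    qed
    show "a *\<^sub>C p \<in> ?W" if "p \<in> ?W" for a p
    proof -
      have "prod.swap (a *\<^sub>C p) = a *\<^sub>C prod.swap p"
        by (simp add: scaleC_prod_def)
      then show ?thesis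
        using complex_vector.subspace_scale[OF V(1)] that by simp
    qed
  qed
  moreover have "closed ?W"
    by (intro closed_vimage V continuous_on_swap)
  moreover have "w = 0" if "(0, w) \<in> ?W" for w
    using that 0 by simp
  ultimately obtain Y where Y: "closed_op Y" "?W = {(x, app Y x) | x. x \<in> opdom Y}"
    using subspace_graph[of ?W] by blast
  have "(a, b) \<in> V \<longleftrightarrow> (b, a) \<in> ?W" for a b
    by simp
  then have "V = {(app Y y, y) | y. y \<in> opdom Y}"
    unfolding Y(2) by auto
  then show ?thesis
    using Y(1) by blast
qed

theorem proposition6p4:
  fixes A :: "('h::{complex_hilbert, second_countable_topology}, 'h) unbounded_op"
    and r s :: real
    and \<iota>r :: "'h \<Rightarrow> 'v::complex_banach"
    and \<iota>s :: "'h \<Rightarrow> 'w::complex_banach"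
    and B :: "'u::complex_hilbert \<Rightarrow> 'v"
    and C :: "('h, 'y::complex_hilbert) unbounded_op"
    and V0p V0m :: "('v \<times> 'w) set"
  assumes "sectorial A" and "0 \<in> resolvent_set A"
    and "0 \<le> r" and "0 \<le> s" and "r + s < 1"
    and "is_neg_scale_space (Lam A) r \<iota>r"
    and "is_neg_scale_space (Lam_star A) s \<iota>s"
    and "bounded_clinear B"
    and "bounded_on_scale (Lam_star A) s C"
    and "{\<mu>. Re \<mu> = 0} \<subseteq> resolvent_set (hamiltonian A r s \<iota>r \<iota>s B C)"
    and "spectral_subspaces (hamiltonian A r s \<iota>r \<iota>s B C) V0p V0m"
  shows "\<exists>(X0m :: ('v, 'w) unbounded_op) (Y0p :: ('w, 'v) unbounded_op).
    closed_op X0m \<and> V0m = {(x, app X0m x) | x. x \<in> opdom X0m} \<and>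
    closed_op Y0p \<and> V0p = {(app Y0p y, y) | y. y \<in> opdom Y0p}"
proof -
  obtain S S' M where dissipative: "dissipative_pair S S' M" and A: "is_inverse_op S A"
    by (rule sectorial_dissipative_pair[OF assms(1,2)]) (rule that)
  interpret dissipative_pair S S' M
    by (rule dissipative)
  let ?L = "Lam A" and ?Ls = "Lam_star A" and ?A' = "hilbert_adjoint A" and ?\<delta> = "1 - r - s"
  note r = assms(3) and s = assms(4) and rs = assms(5)
  have \<delta>: "0 \<le> ?\<delta>" "?\<delta> \<le> 1" "0 \<le> 1 - s" "1 - s \<le> 1" "0 \<le> 1 - r" "1 - r \<le> 1" "r \<le> 1" "s \<le> 1"
    using r s rs by auto
  note A' = is_inverse_op_hilbert_adjoint[OF A]
  note L = is_inverse_op_Lam(1)[OF A] and Ls = is_inverse_op_Lam(2)[OF A]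
  have dense: "closure (range \<iota>r) = UNIV" "closure (range \<iota>s) = UNIV"
    using assms(6,7) by (auto simp: is_neg_scale_space_def)
  obtain Jr Jri where Jr: "bounded_clinear Jr" "bounded_clinear Jri" "\<And>x. Jr (\<iota>r x) = Q r x"
    "\<And>y. Jr (Jri y) = y" "\<And>v. Jri (Jr v) = v"
    by (rule neg_scale_space_isometry[OF near_identity_F L r \<delta>(7) _ assms(6), folded Q_def])
      (use dense_range_Q[OF r \<delta>(7)] in simp, rule that)
  obtain Js Jsi where Js: "bounded_clinear Js" "bounded_clinear Jsi" "\<And>x. Js (\<iota>s x) = dual.Q s x"
    "\<And>y. Js (Jsi y) = y" "\<And>v. Jsi (Js v) = v"
    by (rule neg_scale_space_isometry[OF dual.near_identity_F Ls s \<delta>(8) _ assms(7), folded dual.Q_def])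
      (use dual.dense_range_Q[OF s \<delta>(8)] in simp, rule that)
  have inv_\<iota>: "inv \<iota>r (\<iota>r x) = x" "inv \<iota>s (\<iota>s x) = x" for x
    by (rule inv_f_f, rule injI, metis Jr(3) inj_Q[OF r \<delta>(7)] injD)
      (rule inv_f_f, rule injI, metis Js(3) dual.inj_Q[OF s \<delta>(8)] injD)
  \<comment> \<open>\<open>B\<close>, and below \<open>C\<close>, in the coordinates of the scales
    with adjoints taken in \<open>H\<close>: \<open>Bj Bt\<close> and \<open>Ct Cj\<close> represent
    \<open>B B*\<close> and \<open>C* C\<close>.\<close>
  define Bj where "Bj u = Jr (B u)" for u
  have Bj: "bounded_clinear Bj"
    unfolding Bj_def[abs_def] by (rule bounded_clinear_compose[OF Jr(1) assms(8)])
  obtain Bt where Bt: "bounded_clinear Bt" "\<And>u h. cinner (Bj u) h = cinner u (Bt h)"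
    by (rule exists_adjoint[OF Bj]) (rule that)
  have C: "linear_op C" "opdom C = range (dual.Q s)"
    using assms(9) scale_space_eq[OF dual.near_identity_F Ls s \<delta>(8)] by (auto simp: bounded_on_scale_def dual.Q_def)
  obtain K where K: "\<And>x. x \<in> opdom C \<Longrightarrow> norm (app C x) \<le> K * scale_norm ?Ls s x"
    using assms(9) by (auto simp: bounded_on_scale_def)
  define Cj where "Cj z = app C (dual.Q s z)" for z
  have Cj: "bounded_clinear Cj"
  proof (rule bounded_clinearI[where K=K])
    note Q = bounded_clinear_simps[OF dual.bounded_clinear_Q[OF s \<delta>(8)]]
    show "Cj (x + y) = Cj x + Cj y" "Cj (a *\<^sub>C x) = a *\<^sub>C Cj x" for x y a
      using linear_opD(2,3)[OF C(1)] C(2) by (simp_all add: Cj_def Q)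
    show "norm (Cj x) \<le> K * norm x" for x
      using K[of "dual.Q s x"] C(2) scale_norm_eq[OF dual.near_identity_F Ls s \<delta>(8), of x]
      by (simp add: Cj_def dual.Q_def)
  qed
  obtain Ct where Ct: "bounded_clinear Ct" "\<And>z y. cinner (Cj z) y = cinner z (Ct y)"
    by (rule exists_adjoint[OF Cj]) (rule that)
  obtain kb where Pb: "pos_op (\<lambda>h. Bj (Bt h)) kb"
    by (rule pos_op_compose_adjoint[OF Bj Bt]) (rule that)
  obtain kc where Pc: "pos_op (\<lambda>h. Ct (Cj h)) kc"
    by (rule pos_op_compose_adjoint[OF Ct(1) Cj adjoint_sym[OF Ct(2)]]) (rule that)
  \<comment> \<open>\<open>y = Q (1 - s) e\<close> equals \<open>Q r (Q ?\<delta> e)\<close>, so its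
    coordinate in the space of index \<open>r\<close> is \<open>Q ?\<delta> e\<close>.\<close>
  have B_adj: "B_adj \<iota>r B (Q (1 - s) e) = Bt (Q ?\<delta> e)" for e
  proof (rule B_adj_eq)
    fix u
    have "pairing \<iota>r (Q r (Q ?\<delta> e)) (B u) = cinner (Q ?\<delta> e) (Jr (B u))"
      by (rule pairing_eq[OF dense(1) Jr(1,3) Q_adj[OF r \<delta>(7)]])
    then show "pairing \<iota>r (Q (1 - s) e) (B u) = cinner (Bt (Q ?\<delta> e)) u"
      using r \<delta> by (simp add: Q_add adjoint_sym[OF Bt(2)] Bj_def)
  qed
  have pairing_s: "pairing \<iota>s (dual.Q s z) \<phi> = cinner z (Js \<phi>)" for z \<phi>
    by (rule pairing_eq[OF dense(2) Js(1,3) dual.Q_adj[OF s \<delta>(8)]])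
  have C_adj: "C_adj \<iota>s C y = Jsi (Ct y)" for y
    unfolding C_adj_def
  proof (rule the_equality)
    show "\<forall>x\<in>opdom C. cinner (app C x) y = pairing \<iota>s x (Jsi (Ct y))"
      by (auto simp: C(2) pairing_s Js(4) Ct(2)[symmetric] Cj_def)
    fix \<phi> assume "\<forall>x\<in>opdom C. cinner (app C x) y = pairing \<iota>s x \<phi>"
    then have "cinner z (Ct y) = cinner z (Js \<phi>)" for z
      by (simp add: C(2) pairing_s Ct(2)[symmetric] Cj_def)
    then have "Ct y = Js \<phi>"
      by (rule cinner_ext_right)
    then show "\<phi> = Jsi (Ct y)"
      by (simp add: Js(5))
  qed
  let ?T = "hamiltonian A r s \<iota>r \<iota>s B C"
  let ?\<Psi>1 = "\<lambda>z. \<iota>r (dual.Q (1 - r) z)" and ?\<Psi>2 = "\<lambda>e. \<iota>s (Q (1 - s) e)"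
  have ext: "scale_ext ?Ls (1 - r) \<iota>r A (dual.Q (1 - r) z) = Jri (Z z)"
    "scale_ext ?L (1 - s) \<iota>s ?A' (Q (1 - s) e) = Jsi (dual.Z e)" for z e
    by (rule scale_ext_eq[OF A Ls r \<delta>(7) Jr(2,3,5)], rule dual.scale_ext_eq[OF A' L s \<delta>(8) Js(2,3,5)])
  have T: "app ?T (?\<Psi>1 z, ?\<Psi>2 e) =
      (Jri (Z z) - B (Bt (Q ?\<delta> e)), - Jsi (Ct (Cj (dual.Q ?\<delta> z))) - Jsi (dual.Z e))" for z e
  proof -
    have "app C (dual.Q (1 - r) z) = Cj (dual.Q ?\<delta> z)"
      using s \<delta> by (simp add: Cj_def dual.Q_add)
    then show ?thesis
      by (simp add: hamiltonian_def inv_\<iota> Let_def ext B_adj C_adj)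
  qed
  interpret hamiltonian_coordinates S S' M r s kb kc "\<lambda>h. Bj (Bt h)" "\<lambda>h. Ct (Cj h)" Jr Js ?\<Psi>1 ?\<Psi>2 ?T
  proof unfold_locales
    show "0 \<le> r" "0 \<le> s" "r + s < 1" "pos_op (\<lambda>h. Bj (Bt h)) kb" "pos_op (\<lambda>h. Ct (Cj h)) kc"
      "bounded_clinear Jr" "bounded_clinear Js"
      by (fact r s rs Pb Pc Jr(1) Js(1))+
    show "inj Jr" "inj Js"
      by (rule inj_on_inverseI[of _ Jri], rule Jr(5), rule inj_on_inverseI[of _ Jsi], rule Js(5))
    show "Jr (?\<Psi>1 z) = Q r (dual.Q (1 - r) z)" "Js (?\<Psi>2 e) = dual.Q s (Q (1 - s) e)" for z e
      by (fact Jr(3) Js(3))+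
    have "scale_space ?Ls (1 - r) = range (dual.Q (1 - r))" "scale_space ?L (1 - s) = range (Q (1 - s))"
      using scale_space_eq[OF dual.near_identity_F Ls \<delta>(5,6)] scale_space_eq[OF near_identity_F L \<delta>(3,4)]
      by (simp_all add: Q_def dual.Q_def)
    then show "opdom ?T = range ?\<Psi>1 \<times> range ?\<Psi>2"
      by (simp add: hamiltonian_def image_image)
    show "Jr (fst (app ?T (?\<Psi>1 z, ?\<Psi>2 e))) = Z z - Bj (Bt (Q ?\<delta> e))" for z e
      by (simp add: T bounded_clinear_diff[OF Jr(1)] Jr(4) Bj_def)
    show "Js (snd (app ?T (?\<Psi>1 z, ?\<Psi>2 e))) = - Ct (Cj (dual.Q ?\<delta> z)) - dual.Z e" for z e
      by (simp add: T bounded_clinear_diff[OF Js(1)] bounded_clinear_minus[OF Js(1)] Js(4))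
  qed
  \<comment> \<open>The spectra lie in open half-planes, so the opposite closed half-planes, axis
    included, belong to the resolvent sets.\<close>
  have V: "complex_vector.subspace V0p" "closed V0p" "complex_vector.subspace V0m" "closed V0m"
    and res: "{\<mu>. Re \<mu> \<le> 0} \<subseteq> resolvent_set_on V0p (op_restrict ?T V0p)"
      "{\<mu>. Re \<mu> \<ge> 0} \<subseteq> resolvent_set_on V0m (op_restrict ?T V0m)"
    using assms(11) by (auto simp: spectral_subspaces_def spectrum_on_def)
  have "\<exists>M. \<forall>\<mu>. Re \<mu> < 0 \<longrightarrow> (\<forall>y\<in>V0p. norm (resolvent (op_restrict ?T V0p) \<mu> y) \<le> M * norm y)"
    using assms(11) unfolding spectral_subspaces_def by (elim conjE)
  moreover have "\<exists>M. \<forall>\<mu>. Re \<mu> > 0 \<longrightarrow> (\<forall>y\<in>V0m. norm (resolvent (op_restrict ?T V0m) \<mu> y) \<le> M * norm y)"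
    using assms(11) unfolding spectral_subspaces_def by (elim conjE)
  ultimately obtain Np Nm
    where Np: "\<forall>\<mu>. Re \<mu> < 0 \<longrightarrow> (\<forall>y\<in>V0p. norm (resolvent (op_restrict ?T V0p) \<mu> y) \<le> Np * norm y)"
      and Nm: "\<forall>\<mu>. Re \<mu> > 0 \<longrightarrow> (\<forall>y\<in>V0m. norm (resolvent (op_restrict ?T V0m) \<mu> y) \<le> Nm * norm y)"
    by (elim exE) (rule that)
  have p0: "v = 0" if "(v, 0) \<in> V0p" for v
    by (rule plus_subspace_eq_0[OF V(1) res(1) _ that, of Np]) (use Np in simp)
  have m0: "w = 0" if "(0, w) \<in> V0m" for w
    by (rule minus_subspace_eq_0[OF V(3) res(2) _ that, of Nm]) (use Nm in simp)
  obtain X where "closed_op X" "V0m = {(x, app X x) | x. x \<in> opdom X}"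
    using subspace_graph[OF V(3,4) m0] by blast
  moreover obtain Y where "closed_op Y" "V0p = {(app Y y, y) | y. y \<in> opdom Y}"
    using subspace_inverse_graph[OF V(1,2) p0] by blast
  ultimately show ?thesis
    by (intro exI[of _ X] exI[of _ Y] conjI)
qed

end
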